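(* The variety of complex $4$-dimensional nilpotent mono Leibniz algebras has dimension $15$ and has exactly three irreducible components, $\overline{O(\mathfrak{L}_2)}$, $\overline{O(\mathbb{M}_{12}^{\alpha})}$ and $\overline{O(\mathbb{M}_{14}^{\alpha})}$, where on a basis $e_1,\dots,e_4$ (products not listed are zero, $\alpha\in\mathbb{C}$): $\mathfrak{L}_2$: $e_1e_1=e_2,\ e_2e_1=e_3,\ e_3e_1=e_4$; $\mathbb{M}_{12}^{\alpha}$: $e_1e_1=\alpha e_4,\ e_1e_2=e_3,\ e_1e_3=e_4,\ e_2e_1=-e_3,\ e_2e_2=e_4,\ e_3e_1=-e_4,\ e_3e_3=e_4$; $\mathbb{M}_{14}^{\alpha}$: $e_1e_1=e_3,\ e_1e_2=e_3,\ e_2e_1=e_4,\ e_2e_2=\alpha e_3,\ e_3e_2=e_4$. In particular, there is exactly one rigid algebra in this variety.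
   Context: An algebra is a Leibniz algebra if it satisfies $(xy)z=(xz)y+x(yz)$; it is a mono Leibniz algebra if every subalgebra generated by one element is a Leibniz algebra; it is nilpotent if for some $n$ every product of $n$ elements (any bracketing) vanishes. Fix an $n$-dimensional complex vector space $V$; algebra structures on $V$ are bilinear maps $V\times V\to V$, identified with their structure constants in $\mathbb{C}^{n^3}$. Structures satisfying given polynomial identities form an affine variety on which $GL(V)$ acts by $(g*\mu)(x,y)=g\mu(g^{-1}x,g^{-1}y)$; orbits are isomorphism classes. For a parametric family, $\overline{O(\cdot)}$ denotes the Zariski closure of the union of the orbits of all members. An algebra is rigid if its orbit is Zariski-open in the variety. The dimension of the variety is the maximum dimension of its irreducible components. *)

theory Defs
  imports "HOL-Analysis.Analysis"
begin

inductive_set poly_fun :: "(('i \<Rightarrow> complex) \<Rightarrow> complex) set" where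
  pf_const: "(\<lambda>x. c) \<in> poly_fun"
| pf_coord: "(\<lambda>x. x i) \<in> poly_fun"
| pf_add: "f \<in> poly_fun \<Longrightarrow> g \<in> poly_fun \<Longrightarrow> (\<lambda>x. f x + g x) \<in> poly_fun"
| pf_mult: "f \<in> poly_fun \<Longrightarrow> g \<in> poly_fun \<Longrightarrow> (\<lambda>x. f x * g x) \<in> poly_fun"

definition zclosed :: "('i \<Rightarrow> complex) set \<Rightarrow> bool" where
  "zclosed S \<longleftrightarrow> (\<exists>F \<subseteq> poly_fun. S = {x. \<forall>f\<in>F. f x = 0})"

definition zopen :: "('i \<Rightarrow> complex) set \<Rightarrow> bool" where
  "zopen U \<longleftrightarrow> zclosed (- U)"

definition zclosure :: "('i \<Rightarrow> complex) set \<Rightarrow> ('i \<Rightarrow> complex) set" where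
  "zclosure S = \<Inter> {C. zclosed C \<and> S \<subseteq> C}"

text \<open>Irreducible subsets (for the Zariski topology; equivalently in the subspace topology).\<close>
definition zirreducible :: "('i \<Rightarrow> complex) set \<Rightarrow> bool" where
  "zirreducible S \<longleftrightarrow> S \<noteq> {} \<and>
     (\<forall>A B. zclosed A \<longrightarrow> zclosed B \<longrightarrow> S \<subseteq> A \<union> B \<longrightarrow> S \<subseteq> A \<or> S \<subseteq> B)"

definition zcomponents :: "('i \<Rightarrow> complex) set \<Rightarrow> ('i \<Rightarrow> complex) set set" where
  "zcomponents X = {S. S \<subseteq> X \<and> zirreducible S \<and>
       (\<forall>T. T \<subseteq> X \<longrightarrow> zirreducible T \<longrightarrow> S \<subseteq> T \<longrightarrow> T = S)}"

definition zchain :: "('i \<Rightarrow> complex) set \<Rightarrow> nat \<Rightarrow> (nat \<Rightarrow> ('i \<Rightarrow> complex) set) \<Rightarrow> bool" where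
  "zchain X k Z \<longleftrightarrow>
     (\<forall>i\<le>k. zirreducible (Z i) \<and> (\<exists>C. zclosed C \<and> Z i = X \<inter> C)) \<and>
     (\<forall>i<k. Z i \<subset> Z (Suc i))"

definition has_zdim :: "('i \<Rightarrow> complex) set \<Rightarrow> nat \<Rightarrow> bool" where
  "has_zdim X d \<longleftrightarrow> (\<exists>Z. zchain X d Z) \<and> (\<forall>k Z. zchain X k Z \<longrightarrow> k \<le> d)"

datatype idx = E1 | E2 | E3 | E4

lemma UNIV_idx: "(UNIV :: idx set) = {E1, E2, E3, E4}"
  using idx.exhaust by auto

instance idx :: finite
  by standard (simp add: UNIV_idx)

text \<open>V = complex^4 with basis e1..e4; an algebra structure is given by its structure
  constants: \<open>\<mu> (i,j,k)\<close> is the coefficient of \<open>e_k\<close> in \<open>e_i e_j\<close>.\<close>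
type_synonym struct = "idx \<times> idx \<times> idx \<Rightarrow> complex"
type_synonym vec = "complex ^ idx"

definition mult :: "struct \<Rightarrow> vec \<Rightarrow> vec \<Rightarrow> vec" where
  "mult \<mu> x y = (\<chi> k. \<Sum>i\<in>UNIV. \<Sum>j\<in>UNIV. x$i * y$j * \<mu> (i, j, k))"

inductive prod_of :: "struct \<Rightarrow> nat \<Rightarrow> vec \<Rightarrow> bool" for \<mu> where
  prod_single: "prod_of \<mu> 1 x"
| prod_mult: "prod_of \<mu> a x \<Longrightarrow> prod_of \<mu> b y \<Longrightarrow> prod_of \<mu> (a + b) (mult \<mu> x y)"

definition nilpotent_alg :: "struct \<Rightarrow> bool" where
  "nilpotent_alg \<mu> \<longleftrightarrow> (\<exists>n\<ge>1. \<forall>x. prod_of \<mu> n x \<longrightarrow> x = 0)"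

definition is_subalgebra :: "struct \<Rightarrow> vec set \<Rightarrow> bool" where
  "is_subalgebra \<mu> S \<longleftrightarrow> 0 \<in> S \<and> (\<forall>a\<in>S. \<forall>b\<in>S. a + b \<in> S) \<and>
     (\<forall>c. \<forall>a\<in>S. c *s a \<in> S) \<and> (\<forall>a\<in>S. \<forall>b\<in>S. mult \<mu> a b \<in> S)"

definition gen_subalg :: "struct \<Rightarrow> vec \<Rightarrow> vec set" where
  "gen_subalg \<mu> x = \<Inter> {S. is_subalgebra \<mu> S \<and> x \<in> S}"

definition leibniz_on :: "struct \<Rightarrow> vec set \<Rightarrow> bool" where
  "leibniz_on \<mu> S \<longleftrightarrow> (\<forall>x\<in>S. \<forall>y\<in>S. \<forall>z\<in>S.
      mult \<mu> (mult \<mu> x y) z = mult \<mu> (mult \<mu> x z) y + mult \<mu> x (mult \<mu> y z))"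

definition mono_leibniz :: "struct \<Rightarrow> bool" where
  "mono_leibniz \<mu> \<longleftrightarrow> (\<forall>x. leibniz_on \<mu> (gen_subalg \<mu> x))"

definition NML :: "struct set" where
  "NML = {\<mu>. nilpotent_alg \<mu> \<and> mono_leibniz \<mu>}"

definition act :: "complex^idx^idx \<Rightarrow> struct \<Rightarrow> struct" where
  "act g \<mu> = (\<lambda>(i, j, k). (g *v mult \<mu> (matrix_inv g *v axis i 1) (matrix_inv g *v axis j 1)) $ k)"

definition orbit :: "struct \<Rightarrow> struct set" where
  "orbit \<mu> = {act g \<mu> | g. invertible g}"

definition rigid_in :: "struct set \<Rightarrow> struct \<Rightarrow> bool" where
  "rigid_in X \<mu> \<longleftrightarrow> \<mu> \<in> X \<and> (\<exists>U. zopen U \<and> orbit \<mu> = X \<inter> U)"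

definition L2 :: struct where
  "L2 = (\<lambda>ijk. if ijk = (E1, E1, E2) \<or> ijk = (E2, E1, E3) \<or> ijk = (E3, E1, E4) then 1 else 0)"

definition M12 :: "complex \<Rightarrow> struct" where
  "M12 \<alpha> = (\<lambda>ijk.
     if ijk = (E1, E1, E4) then \<alpha>
     else if ijk = (E1, E2, E3) then 1
     else if ijk = (E1, E3, E4) then 1
     else if ijk = (E2, E1, E3) then -1
     else if ijk = (E2, E2, E4) then 1
     else if ijk = (E3, E1, E4) then -1
     else if ijk = (E3, E3, E4) then 1
     else 0)"

definition M14 :: "complex \<Rightarrow> struct" where
  "M14 \<alpha> = (\<lambda>ijk.
     if ijk = (E1, E1, E3) then 1
     else if ijk = (E1, E2, E3) then 1
     else if ijk = (E2, E1, E4) then 1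
     else if ijk = (E2, E2, E3) then \<alpha>
     else if ijk = (E3, E2, E4) then 1
     else 0)"

end

theory Submission
  imports Defs
begin

text \<open>A nilpotent structure has a basis in which it is strictly triangular. For triangular structures
  the identities \<open>x(xx) = 0\<close> and \<open>(xx)(xx) = 0\<close>, which the Leibniz identity
  forces on one-generated subalgebras, leave up to a change of basis exactly three \<^emph>\<open>linear\<close>
  families: \<open>xy = y\<^sub>1 T(x)\<close> with \<open>T\<close> strictly triangular; products
  \<open>B(x,y) e\<^sub>3 + C(x,y) e\<^sub>4\<close> with \<open>B\<close> alternating in the first two coordinates and
  \<open>C\<close> an arbitrary bilinear form in the first three; and the same with \<open>B\<close> arbitrary and
  \<open>C(\<cdot>, e\<^sub>3) = 0\<close>. The generic members of these families are isomorphic to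
  \<open>L2\<close>, \<open>M12 \<alpha>\<close> and \<open>M14 \<alpha>\<close>.

  By the decomposition of a generic invertible matrix into a unipotent upper triangular one and one
  stabilizing a flag, the closure of the saturation of each family is the closure of the image of a
  polynomial map from affine space of dimension 12, 15 and 15 respectively. Hence it is irreducible, and
  a counting argument on monomials bounds the length of chains of irreducible closed subsets by the number
  of parameters. Switching on the parameters one at a time gives a chain of length 15.

  The orbit of \<open>L2\<close> is open, being cut out by the nonvanishing of \<open>((xy)z)w\<close>. An open
  orbit in one of the other two components would contain almost all members of the one-parameter
  family, which are pairwise nonisomorphic.\<close>

section \<open>The Zariski topology\<close>

text \<open>Neither nilpotency of unspecified index nor the condition on one-generated subalgebras
  is visibly a system of polynomial equations. That \<open>NML\<close> is closed comes out of the
  classification, as \<open>NML\<close> \<subseteq> \<open>GL_saturation families\<close>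
  \<subseteq> \<open>NML'\<close> \<subseteq> \<open>NML\<close>, where \<open>NML'\<close> asks
  that all products of 9 factors vanish together with the explicit \<open>power_identities\<close>.

  Limits are replaced by rational curves: a polynomial that vanishes at all but finitely many points
  of such a curve vanishes wherever the curve is defined. This gives the density of generic members
  in a family and of the big cell in the group.

  The length of a chain is bounded by transcendence degree: each strict inclusion yields a function
  algebraically independent of the earlier ones, and an image of affine m-space carries at most m
  independent functions.

  The numbers of parameters are 12 = 6 + 6 and 15 = 10 + 5, coefficients of a structure plus entries
  of a unipotent matrix. The first family needs the full flag; the other two are defined by a flag
  without its first step, which saves one unipotent entry.\<close>

lemma poly_fun_power: "f \<in> poly_fun \<Longrightarrow> (\<lambda>x. f x ^ n) \<in> poly_fun"
  by (induction n) (auto intro: poly_fun.intros)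

lemma poly_fun_minus: "f \<in> poly_fun \<Longrightarrow> (\<lambda>x. - f x) \<in> poly_fun"
  using pf_mult[OF pf_const[of "-1"], of f] by simp

lemma poly_fun_diff: "f \<in> poly_fun \<Longrightarrow> g \<in> poly_fun \<Longrightarrow> (\<lambda>x. f x - g x) \<in> poly_fun"
  using pf_add[OF _ poly_fun_minus, of f g] by simp

lemma poly_fun_sum: "(\<And>a. a \<in> A \<Longrightarrow> f a \<in> poly_fun) \<Longrightarrow> (\<lambda>x. \<Sum>a\<in>A. f a x) \<in> poly_fun"
  by (induction A rule: infinite_finite_induct) (auto intro: poly_fun.intros)

lemma poly_fun_prod: "(\<And>a. a \<in> A \<Longrightarrow> f a \<in> poly_fun) \<Longrightarrow> (\<lambda>x. \<Prod>a\<in>A. f a x) \<in> poly_fun"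
  by (induction A rule: infinite_finite_induct) (auto intro: poly_fun.intros)

lemmas poly_fun_intros =
  poly_fun.intros poly_fun_power poly_fun_minus poly_fun_diff poly_fun_sum poly_fun_prod

lemma zclosed_zero: "f \<in> poly_fun \<Longrightarrow> zclosed {x. f x = 0}"
  unfolding zclosed_def by (intro exI[of _ "{f}"]) auto

lemma zclosed_INT: "(\<And>a. a \<in> I \<Longrightarrow> zclosed (S a)) \<Longrightarrow> zclosed (\<Inter>a\<in>I. S a)"
proof -
  assume "\<And>a. a \<in> I \<Longrightarrow> zclosed (S a)"
  then have "\<forall>a\<in>I. \<exists>F \<subseteq> poly_fun. S a = {x. \<forall>f\<in>F. f x = 0}"
    by (simp add: zclosed_def)
  then obtain F where F: "\<forall>a\<in>I. F a \<subseteq> poly_fun \<and> S a = {x. \<forall>f\<in>F a. f x = 0}"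
    by (rule bchoice[THEN exE])
  then have "(\<Inter>a\<in>I. S a) = {x. \<forall>f\<in>(\<Union>a\<in>I. F a). f x = 0}"
    by auto
  moreover have "(\<Union>a\<in>I. F a) \<subseteq> poly_fun" using F by blast
  ultimately show ?thesis unfolding zclosed_def by blast
qed

lemma zclosed_Int: "zclosed A \<Longrightarrow> zclosed B \<Longrightarrow> zclosed (A \<inter> B)"
  using zclosed_INT[of UNIV "\<lambda>b. if b then A else B"] by (simp add: UNIV_bool Int_commute)

lemma zclosed_Collect_all: "(\<And>a. zclosed {x. P a x}) \<Longrightarrow> zclosed {x. \<forall>a. P a x}"
  using zclosed_INT[of UNIV "\<lambda>a. {x. P a x}"] by (simp add: Collect_all_eq)

lemma zclosed_Collect_conj: "zclosed {x. P x} \<Longrightarrow> zclosed {x. Q x} \<Longrightarrow> zclosed {x. P x \<and> Q x}"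
  using zclosed_Int[of "{x. P x}" "{x. Q x}"] by (simp add: Collect_conj_eq)

lemma zclosed_Collect_imp: "(P \<Longrightarrow> zclosed {x. Q x}) \<Longrightarrow> zclosed {x. P \<longrightarrow> Q x}"
  using zclosed_zero[OF pf_const[of 0]] by (cases P) auto

lemma zclosed_Un:
  assumes "zclosed A" "zclosed B" shows "zclosed (A \<union> B)"
proof -
  obtain F where F: "F \<subseteq> poly_fun" "A = {x. \<forall>f\<in>F. f x = 0}"
    using assms by (auto simp: zclosed_def)
  obtain G where G: "G \<subseteq> poly_fun" "B = {x. \<forall>f\<in>G. f x = 0}"
    using assms by (auto simp: zclosed_def)
  define H where "H = (\<lambda>(f, g) x. f x * g x) ` (F \<times> G)"
  have H: "(\<lambda>x. f x * g x) \<in> H" if "f \<in> F" "g \<in> G" for f g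
    using that by (force simp: H_def)
  have "A \<union> B = {x. \<forall>h\<in>H. h x = 0}"
  proof (intro equalityI subsetI)
    fix x assume x: "x \<in> {x. \<forall>h\<in>H. h x = 0}"
    show "x \<in> A \<union> B"
    proof (rule ccontr)
      assume "x \<notin> A \<union> B"
      then obtain f g where fg: "f \<in> F" "f x \<noteq> 0" "g \<in> G" "g x \<noteq> 0"
        unfolding F(2) G(2) by blast
      have "(\<lambda>x. f x * g x) x = 0"
        using x H[OF fg(1,3)] by (simp only: mem_Collect_eq) (drule bspec)
      then show False using fg by simp
    qed
  next
    fix x assume x: "x \<in> A \<union> B"
    then show "x \<in> {x. \<forall>h\<in>H. h x = 0}"
      by (auto simp: F(2) G(2) H_def)
  qed
  moreover have "H \<subseteq> poly_fun"
    using F(1) G(1) by (auto simp: H_def intro!: pf_mult)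
  ultimately show ?thesis unfolding zclosed_def by blast
qed

lemma subset_zclosure: "S \<subseteq> zclosure S"
  by (auto simp: zclosure_def)

lemma zclosure_minimal: "S \<subseteq> C \<Longrightarrow> zclosed C \<Longrightarrow> zclosure S \<subseteq> C"
  by (auto simp: zclosure_def)

lemma zclosed_zclosure: "zclosed (zclosure S)"
  using zclosed_INT[of "{C. zclosed C \<and> S \<subseteq> C}" id] by (simp add: zclosure_def)

lemma zclosure_mono: "S \<subseteq> T \<Longrightarrow> zclosure S \<subseteq> zclosure T"
  by (meson zclosure_minimal subset_zclosure zclosed_zclosure order_trans)

lemma zclosure_eqI: "S \<subseteq> zclosure T \<Longrightarrow> T \<subseteq> zclosure S \<Longrightarrow> zclosure S = zclosure T"
  by (meson subset_antisym zclosure_minimal zclosed_zclosure)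

lemma zclosureI:
  assumes "\<And>f. f \<in> poly_fun \<Longrightarrow> (\<And>y. y \<in> S \<Longrightarrow> f y = 0) \<Longrightarrow> f x = 0"
  shows "x \<in> zclosure S"
  unfolding zclosure_def
proof (clarify)
  fix C assume C: "zclosed C" "S \<subseteq> C"
  then obtain F where F: "F \<subseteq> poly_fun" "C = {x. \<forall>f\<in>F. f x = 0}"
    by (auto simp: zclosed_def)
  have "f x = 0" if "f \<in> F" for f
    using that F C(2) by (intro assms[of f]) auto
  then show "x \<in> C"
    by (simp add: F(2))
qed

lemma zclosureD:
  assumes "x \<in> zclosure S" "f \<in> poly_fun" "\<And>y. y \<in> S \<Longrightarrow> f y = 0"
  shows "f x = 0"
  using zclosure_minimal[OF _ zclosed_zero[OF assms(2)], of S] assms by auto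

lemma zclosed_separate:
  assumes "zclosed C" "x \<notin> C"
  obtains f where "f \<in> poly_fun" "f x \<noteq> 0" "\<And>y. y \<in> C \<Longrightarrow> f y = 0"
  using assms by (auto simp: zclosed_def)

section \<open>Irreducible sets and irreducible components\<close>

text \<open>This says that the vanishing ideal is prime. Two single polynomials suffice, because a
  point outside a closed set is separated from it by one polynomial.\<close>

lemma zirreducible_iff:
  "zirreducible S \<longleftrightarrow> S \<noteq> {} \<and> (\<forall>f\<in>poly_fun. \<forall>g\<in>poly_fun.
     (\<forall>x\<in>S. f x * g x = 0) \<longrightarrow> (\<forall>x\<in>S. f x = 0) \<or> (\<forall>x\<in>S. g x = 0))" (is "_ \<longleftrightarrow> ?R")
proof
  assume S: "zirreducible S"
  show ?R
  proof (intro conjI ballI impI)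
    fix f g :: "('a \<Rightarrow> complex) \<Rightarrow> complex"
    assume "f \<in> poly_fun" "g \<in> poly_fun" "\<forall>x\<in>S. f x * g x = 0"
    then have "zclosed {x. f x = 0}" "zclosed {x. g x = 0}" "S \<subseteq> {x. f x = 0} \<union> {x. g x = 0}"
      by (auto intro: zclosed_zero)
    then show "(\<forall>x\<in>S. f x = 0) \<or> (\<forall>x\<in>S. g x = 0)"
      using S unfolding zirreducible_def by blast
  qed (use S in \<open>simp add: zirreducible_def\<close>)
next
  assume R: ?R
  show "zirreducible S"
    unfolding zirreducible_def
  proof (intro conjI allI impI)
    fix A B assume A: "zclosed A" "zclosed B" "S \<subseteq> A \<union> B"
    show "S \<subseteq> A \<or> S \<subseteq> B"
    proof (rule ccontr)
      assume "\<not> ?thesis"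
      then obtain x y where xy: "x \<in> S" "x \<notin> A" "y \<in> S" "y \<notin> B" by auto
      obtain f where f: "f \<in> poly_fun" "f x \<noteq> 0" "\<And>y. y \<in> A \<Longrightarrow> f y = 0"
        using zclosed_separate[OF A(1) xy(2)] by blast
      obtain g where g: "g \<in> poly_fun" "g y \<noteq> 0" "\<And>y. y \<in> B \<Longrightarrow> g y = 0"
        using zclosed_separate[OF A(2) xy(4)] by blast
      have "\<forall>x\<in>S. f x * g x = 0" using A f g by auto
      then have "(\<forall>x\<in>S. f x = 0) \<or> (\<forall>x\<in>S. g x = 0)"
        using R f(1) g(1) by blast
      then show False using f g xy by auto
    qed
  qed (use R in simp)
qed

lemma zirreducibleD:
  assumes "zirreducible S" "f \<in> poly_fun" "g \<in> poly_fun" "\<And>x. x \<in> S \<Longrightarrow> f x * g x = 0"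
  shows "(\<forall>x\<in>S. f x = 0) \<or> (\<forall>x\<in>S. g x = 0)"
proof -
  have "\<forall>f\<in>poly_fun. \<forall>g\<in>poly_fun.
     (\<forall>x\<in>S. f x * g x = 0) \<longrightarrow> (\<forall>x\<in>S. f x = 0) \<or> (\<forall>x\<in>S. g x = 0)"
    using zirreducible_iff[THEN iffD1, OF assms(1)] by (rule conjunct2)
  from bspec[OF bspec[OF this assms(2)] assms(3)] assms(4) show ?thesis by blast
qed

lemma zirreducible_zclosure:
  assumes "zirreducible S" shows "zirreducible (zclosure S)"
  unfolding zirreducible_iff
proof (intro conjI ballI impI)
  show "zclosure S \<noteq> {}"
    using assms subset_zclosure[of S] by (auto simp: zirreducible_iff)
next
  fix f g :: "('a \<Rightarrow> complex) \<Rightarrow> complex"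
  assume *: "f \<in> poly_fun" "g \<in> poly_fun" "\<forall>x\<in>zclosure S. f x * g x = 0"
  then have "\<forall>x\<in>S. f x * g x = 0" using subset_zclosure[of S] by blast
  then have "(\<forall>x\<in>S. f x = 0) \<or> (\<forall>x\<in>S. g x = 0)"
    using zirreducibleD[OF assms *(1,2)] by blast
  then show "(\<forall>x\<in>zclosure S. f x = 0) \<or> (\<forall>x\<in>zclosure S. g x = 0)"
    using * zclosureD by blast
qed

lemma zirreducible_subset_Un:
  "zirreducible S \<Longrightarrow> zclosed A \<Longrightarrow> zclosed B \<Longrightarrow> S \<subseteq> A \<union> B \<Longrightarrow> S \<subseteq> A \<or> S \<subseteq> B"
  unfolding zirreducible_def by blast

text \<open>Irreducibility applied twice puts any irreducible subset of \<open>X\<close> into one of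
  the three sets, so maximality only has to be compared among \<open>A\<close>, \<open>B\<close> and
  \<open>C\<close>.\<close>

lemma zcomponents_three:
  assumes X: "X = A \<union> B \<union> C"
    and cl: "zclosed A" "zclosed B" "zclosed C"
    and irr: "zirreducible A" "zirreducible B" "zirreducible C"
    and ne: "\<not> A \<subseteq> B" "\<not> A \<subseteq> C" "\<not> B \<subseteq> A" "\<not> B \<subseteq> C" "\<not> C \<subseteq> A" "\<not> C \<subseteq> B"
  shows "zcomponents X = {A, B, C}" "card (zcomponents X) = 3"
proof -
  have sub: "T \<subseteq> A \<or> T \<subseteq> B \<or> T \<subseteq> C" if "T \<subseteq> X" "zirreducible T" for T
    using zirreducible_subset_Un[OF that(2) zclosed_Un[OF cl(1,2)] cl(3)]
      zirreducible_subset_Un[OF that(2) cl(1,2)] that X by blast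
  show eq: "zcomponents X = {A, B, C}"
  proof (intro equalityI subsetI)
    fix S assume "S \<in> zcomponents X"
    then have S: "S \<subseteq> X" "zirreducible S"
      and m: "\<And>T. T \<subseteq> X \<Longrightarrow> zirreducible T \<Longrightarrow> S \<subseteq> T \<Longrightarrow> T = S"
      unfolding zcomponents_def by auto
    have "A \<subseteq> X" "B \<subseteq> X" "C \<subseteq> X" using X by auto
    then show "S \<in> {A, B, C}"
      using sub[OF S] m[of A] m[of B] m[of C] irr by blast
  next
    have main: "S \<in> zcomponents X"
      if "S \<subseteq> X" "zirreducible S" "\<And>D. D \<in> {A,B,C} \<Longrightarrow> S \<subseteq> D \<Longrightarrow> D = S" for S
      unfolding zcomponents_def
    proof (clarsimp, intro conjI allI impI that(1,2))
      fix T assume T: "T \<subseteq> X" "zirreducible T" "S \<subseteq> T"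
      have "T \<subseteq> D \<Longrightarrow> D \<in> {A,B,C} \<Longrightarrow> T = S" for D
        using that(3)[of D] T by blast
      then show "T = S" using sub[OF T(1,2)] by blast
    qed
    fix S assume "S \<in> {A, B, C}"
    then show "S \<in> zcomponents X"
      using main[of A] main[of B] main[of C] irr ne X by blast
  qed
  have "A \<noteq> B" "A \<noteq> C" "B \<noteq> C" using ne by auto
  then show "card (zcomponents X) = 3" by (simp add: eq)
qed

subsection \<open>Rational curves\<close>

text \<open>These are the rational functions of \<open>t\<close> whose denominator is a power of
  \<open>q\<close>, with denominators cleared; values at the roots of \<open>q\<close> are
  unconstrained.\<close>

definition regular_off :: "complex poly \<Rightarrow> (complex \<Rightarrow> complex) set" where
  "regular_off q = {h. \<exists>n p. \<forall>t. poly q t \<noteq> 0 \<longrightarrow> h t * poly q t ^ n = poly p t}"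

lemma regular_off_poly: "(\<lambda>t. poly p t) \<in> regular_off q"
  unfolding regular_off_def by (rule CollectI, rule exI[of _ 0], rule exI[of _ p]) simp

lemma regular_off_const: "(\<lambda>t. c) \<in> regular_off q"
  using regular_off_poly[of "[:c:]" q] by simp

lemma regular_off_id: "(\<lambda>t. t) \<in> regular_off q"
  using regular_off_poly[of "[:0,1:]" q] by simp

lemma regular_off_add:
  assumes "f \<in> regular_off q" "g \<in> regular_off q"
  shows "(\<lambda>t. f t + g t) \<in> regular_off q"
proof -
  obtain n p where f: "\<And>t. poly q t \<noteq> 0 \<Longrightarrow> f t * poly q t ^ n = poly p t"
    using assms unfolding regular_off_def by blast
  obtain m r where g: "\<And>t. poly q t \<noteq> 0 \<Longrightarrow> g t * poly q t ^ m = poly r t"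
    using assms unfolding regular_off_def by blast
  have "(f t + g t) * poly q t ^ (n + m) = poly (p * q ^ m + r * q ^ n) t"
    if "poly q t \<noteq> 0" for t
    using f[OF that, symmetric] g[OF that, symmetric] by (simp add: power_add algebra_simps)
  then show ?thesis unfolding regular_off_def by blast
qed

lemma regular_off_mult:
  assumes "f \<in> regular_off q" "g \<in> regular_off q"
  shows "(\<lambda>t. f t * g t) \<in> regular_off q"
proof -
  obtain n p where f: "\<And>t. poly q t \<noteq> 0 \<Longrightarrow> f t * poly q t ^ n = poly p t"
    using assms unfolding regular_off_def by blast
  obtain m r where g: "\<And>t. poly q t \<noteq> 0 \<Longrightarrow> g t * poly q t ^ m = poly r t"
    using assms unfolding regular_off_def by blast
  have "(f t * g t) * poly q t ^ (n + m) = poly (p * r) t"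
    if "poly q t \<noteq> 0" for t
    using f[OF that, symmetric] g[OF that, symmetric] by (simp add: power_add algebra_simps)
  then show ?thesis unfolding regular_off_def by blast
qed

lemma regular_off_sum:
  "(\<And>a. a \<in> A \<Longrightarrow> f a \<in> regular_off q) \<Longrightarrow> (\<lambda>t. \<Sum>a\<in>A. f a t) \<in> regular_off q"
  by (induction A rule: infinite_finite_induct) (auto intro: regular_off_const regular_off_add)

lemma regular_off_divide:
  assumes "h \<in> regular_off q" shows "(\<lambda>t. h t / poly q t) \<in> regular_off q"
proof -
  obtain n p where f: "\<And>t. poly q t \<noteq> 0 \<Longrightarrow> h t * poly q t ^ n = poly p t"
    using assms unfolding regular_off_def by blast
  then have "\<forall>t. poly q t \<noteq> 0 \<longrightarrow> h t / poly q t * poly q t ^ Suc n = poly p t" by auto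
  then show ?thesis unfolding regular_off_def by blast
qed

lemma regular_off_cong:
  assumes "h \<in> regular_off q" "\<And>t. poly q t \<noteq> 0 \<Longrightarrow> h t = h' t" shows "h' \<in> regular_off q"
  using assms unfolding regular_off_def by auto

lemma regular_off_poly_fun:
  assumes "f \<in> poly_fun" "\<And>i. (\<lambda>t. \<gamma> t i) \<in> regular_off q"
  shows "(\<lambda>t. f (\<gamma> t)) \<in> regular_off q"
  using assms
  by (induction f rule: poly_fun.induct) (auto intro: regular_off_const regular_off_add regular_off_mult)

text \<open>If \<open>p\<close> is the numerator of \<open>h\<close>, the polynomial
  \<open>p * q * r\<close> vanishes at every \<open>t\<close>, hence is zero; cancelling
  \<open>q\<close> and \<open>r\<close> leaves \<open>p = 0\<close>.\<close>

lemma regular_off_zero: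
  assumes h: "h \<in> regular_off q" and r: "r \<noteq> 0" and t0: "poly q t0 \<noteq> 0"
    and z: "\<And>t. poly q t \<noteq> 0 \<Longrightarrow> poly r t \<noteq> 0 \<Longrightarrow> h t = 0"
  shows "h t0 = 0"
proof -
  obtain n p where p: "\<And>t. poly q t \<noteq> 0 \<Longrightarrow> h t * poly q t ^ n = poly p t"
    using h unfolding regular_off_def by blast
  have "poly (p * q * r) t = 0" for t
    using p[of t, symmetric] z[of t] by (cases "poly q t = 0"; cases "poly r t = 0") auto
  then have "p * q * r = 0" using poly_all_0_iff_0 by blast
  moreover have "q \<noteq> 0" using t0 by auto
  ultimately have "p = 0" using r by simp
  then show ?thesis using p[OF t0] t0 by simp
qed

text \<open>Algebraic substitute for a limit: the curve may leave \<open>S\<close> at the finitely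
  many roots of \<open>r\<close>, and \<open>t0\<close> may be such a root.\<close>

lemma rational_curve_zclosure:
  assumes "\<And>i. (\<lambda>t. \<gamma> t i) \<in> regular_off q" "r \<noteq> 0" "poly q t0 \<noteq> 0"
    and "\<And>t. poly q t \<noteq> 0 \<Longrightarrow> poly r t \<noteq> 0 \<Longrightarrow> \<gamma> t \<in> S"
  shows "\<gamma> t0 \<in> zclosure S"
proof (rule zclosureI)
  fix f assume "f \<in> poly_fun" "\<And>y. y \<in> S \<Longrightarrow> f y = (0::complex)"
  then show "f (\<gamma> t0) = 0"
    using regular_off_zero[OF regular_off_poly_fun[of f \<gamma> q] assms(2,3)] assms(1,4) by blast
qed

lemma poly_fun_line:
  assumes "f \<in> poly_fun"
  obtains p where "\<And>t. f (\<lambda>i. x i + t * (y i - x i)) = poly p t"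
proof -
  have "\<exists>p. \<forall>t. f (\<lambda>i. x i + t * (y i - x i)) = poly p t"
    using assms
  proof (induction f rule: poly_fun.induct)
    case (pf_const c) show ?case by (rule exI[of _ "[:c:]"]) simp
  next
    case (pf_coord i) show ?case by (rule exI[of _ "[:x i, y i - x i:]"]) simp
  next
    case (pf_add f g) then show ?case by (metis poly_add)
  next
    case (pf_mult f g) then show ?case by (metis poly_mult)
  qed
  then show ?thesis using that by blast
qed

text \<open>The line is at \<open>x\<close> for \<open>t = 0\<close>, where \<open>G\<close> is
  nonzero, and at \<open>y\<close> for \<open>t = 1\<close>; so \<open>G\<close> has only finitely
  many zeros along it.\<close>

lemma line_zclosure:
  assumes G: "G \<in> poly_fun" "G x \<noteq> 0"
    and S: "\<And>t. G (\<lambda>i. x i + t * (y i - x i)) \<noteq> 0 \<Longrightarrow> (\<lambda>i. x i + t * (y i - x i)) \<in> S"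
  shows "y \<in> zclosure S"
proof -
  obtain r where r: "\<And>t. G (\<lambda>i. x i + t * (y i - x i)) = poly r t"
    using poly_fun_line[OF G(1)] by metis
  have "poly r 0 \<noteq> 0" using r[of 0] G(2) by simp
  then have "r \<noteq> 0" by auto
  have "(\<lambda>i. x i + 1 * (y i - x i)) \<in> zclosure S"
  proof (rule rational_curve_zclosure[where q = 1 and r = r])
    show "(\<lambda>t. x i + t * (y i - x i)) \<in> regular_off 1" for i
      by (intro regular_off_add regular_off_mult regular_off_const regular_off_id)
  qed (use S r \<open>r \<noteq> 0\<close> in auto)
  then show ?thesis by simp
qed

text \<open>Restriction to the line through a nonzero of \<open>f\<close> and a nonzero of
  \<open>g\<close> reduces the claim to polynomials in one variable, which have no zero
  divisors.\<close>

lemma poly_fun_mult_eq_zero: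
  assumes "f \<in> poly_fun" "g \<in> poly_fun" "\<And>x. f x * g x = 0"
  shows "(\<forall>x. f x = 0) \<or> (\<forall>x. g x = 0)"
proof (rule ccontr)
  assume "\<not> ?thesis"
  then obtain x y where xy: "f x \<noteq> 0" "g y \<noteq> 0" by auto
  obtain p where p: "\<And>t. f (\<lambda>i. x i + t * (y i - x i)) = poly p t"
    using poly_fun_line[OF assms(1)] by metis
  obtain r where r: "\<And>t. g (\<lambda>i. x i + t * (y i - x i)) = poly r t"
    using poly_fun_line[OF assms(2)] by metis
  have "poly p 0 \<noteq> 0" "poly r 1 \<noteq> 0" using p[of 0] r[of 1] xy by auto
  then have "p * r \<noteq> 0" by auto
  moreover have "poly (p * r) t = 0" for t
    using p[of t] r[of t] assms(3) by (metis poly_mult)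
  ultimately show False by (metis poly_all_0_iff_0)
qed

section \<open>Polynomial maps and images of affine space\<close>

lemma poly_fun_compose:
  "f \<in> poly_fun \<Longrightarrow> (\<And>i. (\<lambda>x. \<phi> x i) \<in> poly_fun) \<Longrightarrow> (\<lambda>x. f (\<phi> x)) \<in> poly_fun"
  by (induction f rule: poly_fun.induct) (auto intro: poly_fun.intros)

lemma zirreducible_range:
  assumes "\<And>i. (\<lambda>x. \<phi> x i) \<in> poly_fun"
  shows "zirreducible (range \<phi>)"
  unfolding zirreducible_iff
proof (intro conjI ballI impI)
  fix f g assume "f \<in> poly_fun" "g \<in> poly_fun" "\<forall>x\<in>range \<phi>. f x * g x = 0"
  then show "(\<forall>x\<in>range \<phi>. f x = 0) \<or> (\<forall>x\<in>range \<phi>. g x = 0)"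
    using poly_fun_mult_eq_zero[OF poly_fun_compose[of f \<phi>] poly_fun_compose[of g \<phi>]] assms
    by simp
qed simp

lemma zclosure_poly_image:
  assumes "\<And>i. (\<lambda>x. \<phi> x i) \<in> poly_fun"
  shows "\<phi> ` zclosure S \<subseteq> zclosure (\<phi> ` S)"
proof (clarify, rule zclosureI)
  fix x f assume "x \<in> zclosure S" "f \<in> poly_fun" "\<And>y. y \<in> \<phi> ` S \<Longrightarrow> f y = (0::complex)"
  then show "f (\<phi> x) = 0"
    using zclosureD[of x S "\<lambda>x. f (\<phi> x)"] poly_fun_compose[of f \<phi>] assms by auto
qed

section \<open>Dimension\<close>

text \<open>A homogeneous linear system with more unknowns than equations, solved by Gaussian
  elimination: each equation \<open>a\<close> removes one unknown \<open>k\<close>.\<close>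

lemma exists_nontrivial_relation:
  fixes v :: "'j \<Rightarrow> 'e \<Rightarrow> complex"
  assumes "finite E" "finite J" "card E < card J"
  shows "\<exists>c. (\<exists>j\<in>J. c j \<noteq> 0) \<and> (\<forall>e\<in>E. (\<Sum>j\<in>J. c j * v j e) = 0)"
  using assms
proof (induction E arbitrary: J v rule: finite_induct)
  case empty
  then have "J \<noteq> {}" by auto
  then show ?case by (intro exI[of _ "\<lambda>_. 1"]) auto
next
  case (insert a E)
  show ?case
  proof (cases "\<forall>j\<in>J. v j a = 0")
    case True
    then show ?thesis
      using insert.IH[of J v] insert.prems insert.hyps by auto
  next
    case False
    then obtain k where k: "k \<in> J" "v k a \<noteq> 0" by auto
    \<comment> \<open>Subtracting multiples of row \<open>k\<close> makes every entry in column
      \<open>a\<close> zero; \<open>d\<close> below restores the coefficient of row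
      \<open>k\<close>.\<close>
    define w where "w j e = v j e - v j a / v k a * v k e" for j e
    have "card E < card (J - {k})"
      using insert k by simp
    then obtain c where c: "\<exists>j\<in>J - {k}. c j \<noteq> 0" "\<forall>e\<in>E. (\<Sum>j\<in>J-{k}. c j * w j e) = 0"
      using insert.IH[of "J - {k}" w] insert.prems by auto
    define d where "d j = (if j = k then - (\<Sum>j\<in>J-{k}. c j * (v j a / v k a)) else c j)" for j
    have eq: "(\<Sum>j\<in>J. d j * v j e) = (\<Sum>j\<in>J-{k}. c j * w j e)" for e
    proof -
      have "(\<Sum>j\<in>J. d j * v j e) = d k * v k e + (\<Sum>j\<in>J-{k}. d j * v j e)"
        using insert.prems k by (simp add: sum.remove)
      also have "(\<Sum>j\<in>J-{k}. d j * v j e) = (\<Sum>j\<in>J-{k}. c j * v j e)"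
        by (intro sum.cong) (auto simp: d_def)
      finally show ?thesis
        by (simp add: d_def w_def algebra_simps sum_subtractf sum_distrib_left)
    qed
    have "w j a = 0" for j using k by (simp add: w_def)
    then have "\<forall>e\<in>insert a E. (\<Sum>j\<in>J. d j * v j e) = 0"
      using c(2) by (auto simp: eq)
    moreover have "\<exists>j\<in>J. d j \<noteq> 0" using c(1) by (auto simp: d_def)
    ultimately show ?thesis by blast
  qed
qed

subsection \<open>Polynomial functions of bounded degree in finitely many coordinates\<close>

text \<open>The bound \<open>d\<close> applies to each variable separately, not to the total degree,
  so that the number of monomials is exactly \<open>(d + 1) ^ card I\<close>.\<close>

definition bounded_poly :: "'i set \<Rightarrow> nat \<Rightarrow> (('i \<Rightarrow> complex) \<Rightarrow> complex) set" where
  "bounded_poly I d = {f. \<exists>c. \<forall>x. f x = (\<Sum>e\<in>I \<rightarrow>\<^sub>E {..d}. c e * (\<Prod>i\<in>I. x i ^ e i))}"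

lemma bounded_poly_monomial:
  assumes "finite I" "\<And>i. i \<in> I \<Longrightarrow> m i \<le> d"
  shows "(\<lambda>x. a * (\<Prod>i\<in>I. x i ^ m i)) \<in> bounded_poly I d"
  unfolding bounded_poly_def
proof (rule CollectI, rule exI, rule allI)
  fix x
  have m: "restrict m I \<in> I \<rightarrow>\<^sub>E {..d}" using assms by auto
  have "(\<Sum>e\<in>I \<rightarrow>\<^sub>E {..d}. (if e = restrict m I then a else 0) * (\<Prod>i\<in>I. x i ^ e i))
    = (\<Sum>e\<in>I \<rightarrow>\<^sub>E {..d}. if e = restrict m I then a * (\<Prod>i\<in>I. x i ^ e i) else 0)"
    by (intro sum.cong) auto
  also have "\<dots> = a * (\<Prod>i\<in>I. x i ^ restrict m I i)"
    using m assms(1) by (simp add: finite_PiE)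
  also have "\<dots> = a * (\<Prod>i\<in>I. x i ^ m i)" by simp
  finally show "a * (\<Prod>i\<in>I. x i ^ m i) =
    (\<Sum>e\<in>I \<rightarrow>\<^sub>E {..d}. (if e = restrict m I then a else 0) * (\<Prod>i\<in>I. x i ^ e i))" ..
qed

lemma bounded_poly_const: "finite I \<Longrightarrow> (\<lambda>x. a) \<in> bounded_poly I d"
  using bounded_poly_monomial[of I "\<lambda>_. 0" d a] by simp

lemma bounded_poly_coord:
  assumes "finite I" "i \<in> I" shows "(\<lambda>x. x i) \<in> bounded_poly I 1"
proof -
  have "(\<Prod>j\<in>I. x j ^ (if j = i then 1 else 0)) = x i" for x :: "'a \<Rightarrow> complex"
    using assms by (simp add: if_distrib[of "\<lambda>k. _ ^ k"] prod.delta cong: if_cong)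
  then show ?thesis
    using bounded_poly_monomial[OF assms(1), of "\<lambda>j. if j = i then 1 else 0" 1 1] by simp
qed

lemma bounded_poly_add:
  "f \<in> bounded_poly I d \<Longrightarrow> g \<in> bounded_poly I d \<Longrightarrow> (\<lambda>x. f x + g x) \<in> bounded_poly I d"
proof -
  assume "f \<in> bounded_poly I d" "g \<in> bounded_poly I d"
  then obtain a b where
    "\<And>x. f x = (\<Sum>e\<in>I \<rightarrow>\<^sub>E {..d}. a e * (\<Prod>i\<in>I. x i ^ e i))"
    "\<And>x. g x = (\<Sum>e\<in>I \<rightarrow>\<^sub>E {..d}. b e * (\<Prod>i\<in>I. x i ^ e i))"
    unfolding bounded_poly_def by blast
  then have "f x + g x = (\<Sum>e\<in>I \<rightarrow>\<^sub>E {..d}. (a e + b e) * (\<Prod>i\<in>I. x i ^ e i))" for x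
    by (simp add: sum.distrib algebra_simps)
  then show ?thesis
    unfolding bounded_poly_def by (intro CollectI exI[of _ "\<lambda>e. a e + b e"] allI)
qed

lemma bounded_poly_sum:
  "finite I \<Longrightarrow> (\<And>a. a \<in> A \<Longrightarrow> f a \<in> bounded_poly I d) \<Longrightarrow> (\<lambda>x. \<Sum>a\<in>A. f a x) \<in> bounded_poly I d"
  by (induction A rule: infinite_finite_induct) (auto intro: bounded_poly_const bounded_poly_add)

lemma bounded_poly_mult:
  assumes I: "finite I" and "f \<in> bounded_poly I d" "g \<in> bounded_poly I d'"
  shows "(\<lambda>x. f x * g x) \<in> bounded_poly I (d + d')"
proof -
  obtain a b where ab:
    "\<And>x. f x = (\<Sum>e\<in>I \<rightarrow>\<^sub>E {..d}. a e * (\<Prod>i\<in>I. x i ^ e i))"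
    "\<And>x. g x = (\<Sum>e\<in>I \<rightarrow>\<^sub>E {..d'}. b e * (\<Prod>i\<in>I. x i ^ e i))"
    using assms(2,3) unfolding bounded_poly_def by blast
  have "f x * g x = (\<Sum>e\<in>I \<rightarrow>\<^sub>E {..d}. \<Sum>e'\<in>I \<rightarrow>\<^sub>E {..d'}. (a e * b e') * (\<Prod>i\<in>I. x i ^ (e i + e' i)))" for x
    unfolding ab sum_product by (simp add: power_add prod.distrib algebra_simps)
  moreover have "(\<lambda>x. \<Sum>e\<in>I \<rightarrow>\<^sub>E {..d}. \<Sum>e'\<in>I \<rightarrow>\<^sub>E {..d'}. (a e * b e') * (\<Prod>i\<in>I. x i ^ (e i + e' i)))
      \<in> bounded_poly I (d + d')"
    using I by (intro bounded_poly_sum bounded_poly_monomial add_mono) auto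
  ultimately show ?thesis by simp
qed

lemma bounded_poly_mono:
  assumes I: "finite I" and "f \<in> bounded_poly I d" "d \<le> d'"
  shows "f \<in> bounded_poly I d'"
  using bounded_poly_mult[OF I assms(2) bounded_poly_const[OF I, of 1 "d' - d"]] assms(3) by simp

lemma bounded_poly_power:
  assumes I: "finite I" and "f \<in> bounded_poly I d"
  shows "(\<lambda>x. f x ^ n) \<in> bounded_poly I (n * d)"
  by (induction n) (use assms in \<open>auto intro: bounded_poly_const bounded_poly_mult\<close>)

lemma bounded_poly_prod_power:
  assumes I: "finite I" and "finite K" and "\<And>k. k \<in> K \<Longrightarrow> f k \<in> bounded_poly I d"
    and "\<And>k. k \<in> K \<Longrightarrow> e k \<le> N"
  shows "(\<lambda>x. \<Prod>k\<in>K. f k x ^ e k) \<in> bounded_poly I (card K * (N * d))"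
  using assms(2-)
proof (induction K rule: finite_induct)
  case empty
  then show ?case using I by (simp add: bounded_poly_const)
next
  case (insert k K)
  have "(\<lambda>x. f k x ^ e k) \<in> bounded_poly I (N * d)"
    using insert.prems by (intro bounded_poly_mono[OF I bounded_poly_power[OF I, of "f k" d "e k"]]) auto
  then have "(\<lambda>x. f k x ^ e k * (\<Prod>k\<in>K. f k x ^ e k)) \<in> bounded_poly I (N * d + card K * (N * d))"
    using insert by (intro bounded_poly_mult I) auto
  then show ?case using insert.hyps by simp
qed

definition poly_in :: "'i set \<Rightarrow> (('i \<Rightarrow> complex) \<Rightarrow> complex) set" where
  "poly_in I = (\<Union>d. bounded_poly I d)"

lemma poly_in_const: "finite I \<Longrightarrow> (\<lambda>x. a) \<in> poly_in I"
  using bounded_poly_const[of I a 0] by (auto simp: poly_in_def)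

lemma poly_in_coord: "finite I \<Longrightarrow> i \<in> I \<Longrightarrow> (\<lambda>x. x i) \<in> poly_in I"
  using bounded_poly_coord[of I i] by (auto simp: poly_in_def)

lemma poly_in_add:
  assumes "finite I" "f \<in> poly_in I" "g \<in> poly_in I" shows "(\<lambda>x. f x + g x) \<in> poly_in I"
proof -
  obtain d d' where "f \<in> bounded_poly I d" "g \<in> bounded_poly I d'"
    using assms by (auto simp: poly_in_def)
  then have "f \<in> bounded_poly I (max d d')" "g \<in> bounded_poly I (max d d')"
    using bounded_poly_mono[OF assms(1)] by (meson max.cobounded1 max.cobounded2)+
  then show ?thesis using bounded_poly_add[of f I "max d d'" g] by (auto simp: poly_in_def)
qed

lemma poly_in_mult:
  assumes "finite I" "f \<in> poly_in I" "g \<in> poly_in I" shows "(\<lambda>x. f x * g x) \<in> poly_in I"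
  using assms bounded_poly_mult[OF assms(1)] unfolding poly_in_def by blast

lemma poly_in_minus: "finite I \<Longrightarrow> f \<in> poly_in I \<Longrightarrow> (\<lambda>x. - f x) \<in> poly_in I"
  using poly_in_mult[OF _ poly_in_const[of I "-1"], of f] by simp

lemma poly_in_diff:
  "finite I \<Longrightarrow> f \<in> poly_in I \<Longrightarrow> g \<in> poly_in I \<Longrightarrow> (\<lambda>x. f x - g x) \<in> poly_in I"
  using poly_in_add[OF _ _ poly_in_minus, of I f g] by simp

lemma poly_in_sum:
  "finite I \<Longrightarrow> (\<And>a. a \<in> A \<Longrightarrow> f a \<in> poly_in I) \<Longrightarrow> (\<lambda>x. \<Sum>a\<in>A. f a x) \<in> poly_in I"
  by (induction A rule: infinite_finite_induct) (auto intro: poly_in_const poly_in_add)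

lemma poly_in_subset_poly_fun: "poly_in I \<subseteq> poly_fun"
proof
  fix f :: "('a \<Rightarrow> complex) \<Rightarrow> complex" assume "f \<in> poly_in I"
  then obtain d c where "\<And>x. f x = (\<Sum>e\<in>I \<rightarrow>\<^sub>E {..d}. c e * (\<Prod>i\<in>I. x i ^ e i))"
    unfolding poly_in_def bounded_poly_def by blast
  then have "f = (\<lambda>x. \<Sum>e\<in>I \<rightarrow>\<^sub>E {..d}. c e * (\<Prod>i\<in>I. x i ^ e i))" by (rule ext)
  also have "\<dots> \<in> poly_fun" by (intro poly_fun_intros)
  finally show "f \<in> poly_fun" .
qed

lemma poly_in_compose:
  assumes "finite I" "f \<in> poly_fun" "\<And>i. (\<lambda>x. \<phi> x i) \<in> poly_in I"
  shows "(\<lambda>x. f (\<phi> x)) \<in> poly_in I"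
  using assms(2,1,3)
  by (induction f rule: poly_fun.induct) (auto intro: poly_in_const poly_in_add poly_in_mult)

subsection \<open>Algebraic independence\<close>

text \<open>Algebraic independence of the restrictions to \<open>Z\<close>, with each exponent
  bounded by some \<open>N\<close>. For \<open>k = 0\<close> only a constant is left and the
  condition says that \<open>Z\<close> is nonempty, which starts the induction along a
  chain.\<close>

definition alg_independent :: "('i \<Rightarrow> complex) set \<Rightarrow> nat \<Rightarrow> (nat \<Rightarrow> ('i \<Rightarrow> complex) \<Rightarrow> complex) \<Rightarrow> bool" where
  "alg_independent Z k f \<longleftrightarrow> (\<forall>N c.
     (\<forall>x\<in>Z. (\<Sum>e\<in>{..<k} \<rightarrow>\<^sub>E {..N}. c e * (\<Prod>i<k. f i x ^ e i)) = 0) \<longrightarrow>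
     (\<forall>e\<in>{..<k} \<rightarrow>\<^sub>E {..N::nat}. c e = 0))"

text \<open>Counting: the \<open>(N + 1) ^ k\<close> monomials in the \<open>f i\<close> pull back
  to combinations of \<open>(k * (N * D) + 1) ^ card I\<close> monomials in the parameters. If
  \<open>k > card I\<close>, the former outnumber the latter for large \<open>N\<close>, and the
  resulting linear relation vanishes on the image and hence on its closure.\<close>

lemma alg_independent_le_card:
  assumes I: "finite I" and \<phi>: "\<And>i. (\<lambda>x. \<phi> x i) \<in> poly_in I"
    and Z: "Z \<subseteq> zclosure (range \<phi>)" and f: "\<And>i. i < k \<Longrightarrow> f i \<in> poly_fun"
    and ind: "alg_independent Z k f"
  shows "k \<le> card I"
proof (rule ccontr)
  assume "\<not> k \<le> card I"
  then have k: "card I < k" by simp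
  have "\<forall>i\<in>{..<k}. \<exists>d. (\<lambda>x. f i (\<phi> x)) \<in> bounded_poly I d"
    using poly_in_compose[OF I f \<phi>] by (auto simp: poly_in_def)
  then obtain d where d: "\<And>i. i < k \<Longrightarrow> (\<lambda>x. f i (\<phi> x)) \<in> bounded_poly I (d i)"
    by (metis lessThan_iff)
  define D where "D = (\<Sum>i<k. d i)"
  have D: "(\<lambda>x. f i (\<phi> x)) \<in> bounded_poly I D" if "i < k" for i
    using that by (intro bounded_poly_mono[OF I d[OF that]]) (auto simp: D_def intro!: member_le_sum)
  \<comment> \<open>With this \<open>N\<close>, \<open>((k * D + 1) * (N + 1)) ^ card I\<close>
    equals \<open>N * (N + 1) ^ card I\<close>, which is just below
    \<open>(N + 1) ^ Suc (card I)\<close>.\<close>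
  define N where "N = (k * D + 1) ^ card I"
  define J where "J = {..<k} \<rightarrow>\<^sub>E {..N}"
  define E where "E = I \<rightarrow>\<^sub>E {..k * (N * D)}"
  have "\<forall>e\<in>J. \<exists>v. \<forall>x. (\<Prod>i<k. f i (\<phi> x) ^ e i) = (\<Sum>m\<in>E. v m * (\<Prod>i\<in>I. x i ^ m i))"
  proof
    fix e assume "e \<in> J"
    then have "(\<lambda>x. \<Prod>i<k. f i (\<phi> x) ^ e i) \<in> bounded_poly I (card {..<k} * (N * D))"
      using D by (intro bounded_poly_prod_power I) (auto simp: J_def PiE_iff)
    then show "\<exists>v. \<forall>x. (\<Prod>i<k. f i (\<phi> x) ^ e i) = (\<Sum>m\<in>E. v m * (\<Prod>i\<in>I. x i ^ m i))"
      by (simp add: bounded_poly_def E_def)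
  qed
  then obtain v where v:
    "\<forall>e\<in>J. \<forall>x. (\<Prod>i<k. f i (\<phi> x) ^ e i) = (\<Sum>m\<in>E. v e m * (\<Prod>i\<in>I. x i ^ m i))"
    by (rule bchoice[THEN exE])
  have "card E = (k * (N * D) + 1) ^ card I"
    using I by (simp add: E_def card_PiE)
  also have "\<dots> \<le> ((k * D + 1) * (N + 1)) ^ card I"
    by (intro power_mono) (auto simp: algebra_simps)
  also have "\<dots> = N * (N + 1) ^ card I"
    by (simp only: power_mult_distrib N_def)
  also have "\<dots> < (N + 1) ^ Suc (card I)" by simp
  also have "\<dots> \<le> (N + 1) ^ k" using k by (intro power_increasing) auto
  also have "\<dots> = card J" by (simp add: J_def card_PiE)
  finally have "card E < card J" .
  then obtain c where c: "\<exists>j\<in>J. c j \<noteq> 0" "\<forall>m\<in>E. (\<Sum>j\<in>J. c j * v j m) = 0"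
    using exists_nontrivial_relation[of E J v] I by (auto simp: E_def J_def finite_PiE)
  define F where "F x = (\<Sum>e\<in>J. c e * (\<Prod>i<k. f i x ^ e i))" for x
  have "F (\<phi> x) = 0" for x
  proof -
    have "F (\<phi> x) = (\<Sum>e\<in>J. \<Sum>m\<in>E. c e * v e m * (\<Prod>i\<in>I. x i ^ m i))"
      unfolding F_def using v by (intro sum.cong refl) (simp add: sum_distrib_left mult.assoc)
    also have "\<dots> = (\<Sum>m\<in>E. (\<Sum>e\<in>J. c e * v e m) * (\<Prod>i\<in>I. x i ^ m i))"
      by (subst sum.swap) (simp add: sum_distrib_right)
    also have "\<dots> = 0" using c(2) by simp
    finally show ?thesis .
  qed
  moreover have "F \<in> poly_fun"
    unfolding F_def using f by (intro poly_fun_intros) auto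
  ultimately have "\<forall>x\<in>Z. F x = 0"
    using Z zclosureD[of _ "range \<phi>" F] by blast
  then have "\<forall>e\<in>J. c e = 0"
    using ind unfolding alg_independent_def F_def J_def by blast
  then show False using c(1) by blast
qed

lemma sum_PiE_lessThan_Suc:
  "(\<Sum>e\<in>{..<Suc k} \<rightarrow>\<^sub>E B. g e) = (\<Sum>j\<in>B. \<Sum>e\<in>{..<k} \<rightarrow>\<^sub>E B. g (e(k := j)))"
proof -
  have "(\<Sum>e\<in>{..<Suc k} \<rightarrow>\<^sub>E B. g e) = (\<Sum>e\<in>(\<lambda>(j, e). e(k := j)) ` (B \<times> ({..<k} \<rightarrow>\<^sub>E B)). g e)"
    by (simp add: lessThan_Suc PiE_insert_eq)
  also have "\<dots> = (\<Sum>(j, e)\<in>B \<times> ({..<k} \<rightarrow>\<^sub>E B). g (e(k := j)))"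
    by (subst sum.reindex[OF inj_combinator]) (auto simp: case_prod_unfold)
  finally show ?thesis by (simp add: sum.cartesian_product)
qed

text \<open>A function vanishing on the smaller set but not on the larger irreducible one is
  transcendental over functions that are independent on the smaller set: a relation of minimal
  degree in it would restrict to a relation of the others.\<close>

lemma alg_independent_Suc:
  assumes ind: "alg_independent Z k f" and f: "\<And>i. i < k \<Longrightarrow> f i \<in> poly_fun"
    and ZZ: "Z \<subseteq> Z'" and irr: "zirreducible Z'"
    and g: "g \<in> poly_fun" "\<And>x. x \<in> Z \<Longrightarrow> g x = 0" "y \<in> Z'" "g y \<noteq> 0"
  shows "alg_independent Z' (Suc k) (f(k := g))"
  unfolding alg_independent_def
proof (intro allI impI)
  fix N :: nat and c
  let ?f = "f(k := g)"
  let ?P = "{..<k} \<rightarrow>\<^sub>E {..N}"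
  assume z: "\<forall>x\<in>Z'. (\<Sum>e\<in>{..<Suc k} \<rightarrow>\<^sub>E {..N}. c e * (\<Prod>i<Suc k. ?f i x ^ e i)) = 0"
  define Q where "Q j x = (\<Sum>e\<in>?P. c (e(k := j)) * (\<Prod>i<k. f i x ^ e i))" for j x
  have Qp: "Q j \<in> poly_fun" for j
    unfolding Q_def using f by (intro poly_fun_intros) auto
  have rel: "(\<Sum>j\<le>N. g x ^ j * Q j x) = 0" if "x \<in> Z'" for x
  proof -
    have "(\<Sum>e\<in>{..<Suc k} \<rightarrow>\<^sub>E {..N}. c e * (\<Prod>i<Suc k. ?f i x ^ e i))
      = (\<Sum>j\<le>N. \<Sum>e\<in>?P. c (e(k := j)) * (\<Prod>i<Suc k. ?f i x ^ (e(k := j)) i))"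
      by (rule sum_PiE_lessThan_Suc)
    also have "\<dots> = (\<Sum>j\<le>N. g x ^ j * Q j x)"
      unfolding Q_def sum_distrib_left by (intro sum.cong refl) (simp add: algebra_simps)
    finally show ?thesis using z that by simp
  qed
  have Q0: "\<forall>e\<in>?P. c (e(k := j)) = 0" if "\<And>x. x \<in> Z \<Longrightarrow> Q j x = 0" for j
    using ind[unfolded alg_independent_def, THEN spec[of _ N], THEN spec[of _ "\<lambda>e. c (e(k := j))"]] that
    by (simp only: Q_def) blast
  have "\<forall>e\<in>?P. c (e(k := j)) = 0" if "j \<le> N" for j
    using that
  proof (induction j rule: less_induct)
    case (less j)
    \<comment> \<open>The coefficients \<open>Q l\<close> with \<open>l < j\<close> vanish by
      induction, so the relation is \<open>g ^ j * R\<close>. Irreducibility cancels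
      \<open>g ^ j\<close>, and on \<open>Z\<close>, where \<open>g\<close> is zero,
      \<open>R\<close> reduces to \<open>Q j\<close>.\<close>
    define R where "R x = (\<Sum>l\<in>{j..N}. g x ^ (l - j) * Q l x)" for x
    have R: "R \<in> poly_fun"
      unfolding R_def using g(1) Qp by (intro poly_fun_intros) auto
    have "g x ^ j * R x = 0" if "x \<in> Z'" for x
    proof -
      have "g x ^ j * R x = (\<Sum>l\<in>{j..N}. g x ^ l * Q l x)"
        unfolding R_def sum_distrib_left
        by (intro sum.cong refl) (simp add: mult.assoc[symmetric] power_add[symmetric])
      also have "\<dots> = (\<Sum>l\<le>N. g x ^ l * Q l x)"
      proof (rule sum.mono_neutral_left)
        show "\<forall>l\<in>{..N} - {j..N}. g x ^ l * Q l x = 0"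
        proof
          fix l assume l: "l \<in> {..N} - {j..N}"
          then have "\<forall>e\<in>?P. c (e(k := l)) = 0" using l by (intro less.IH) auto
          then have "Q l x = 0" by (simp add: Q_def del: fun_upd_apply)
          then show "g x ^ l * Q l x = 0" by simp
        qed
      qed auto
      finally show ?thesis using rel[OF that] by simp
    qed
    then have "(\<forall>x\<in>Z'. g x ^ j = 0) \<or> (\<forall>x\<in>Z'. R x = 0)"
      using zirreducibleD[OF irr poly_fun_power[OF g(1)] R] by blast
    then have R0: "\<forall>x\<in>Z'. R x = 0" using g(3,4) by auto
    have "Q j x = 0" if "x \<in> Z" for x
    proof -
      have "R x = (\<Sum>l\<in>{j..N}. if l = j then Q l x else 0)"
        unfolding R_def using g(2)[OF that] by (intro sum.cong refl) auto
      then have "R x = Q j x" using less.prems by simp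
      then show ?thesis using R0 ZZ that by auto
    qed
    then show ?case by (rule Q0)
  qed
  then show "\<forall>e\<in>{..<Suc k} \<rightarrow>\<^sub>E {..N}. c e = 0"
    by (auto simp: lessThan_Suc PiE_insert_eq)
qed

text \<open>A point of \<open>Z (Suc j)\<close> outside \<open>Z j\<close> still lies in
  \<open>X\<close>, hence outside the closed set that cuts out \<open>Z j\<close>; a polynomial
  separating it is the next independent function.\<close>

lemma zchain_alg_independent:
  assumes "zchain X k Z" "j \<le> k"
  shows "\<exists>f. (\<forall>i<j. f i \<in> poly_fun) \<and> alg_independent (Z j) j f"
  using assms(2)
proof (induction j)
  case 0
  have "Z 0 \<noteq> {}" using assms(1) by (simp add: zchain_def zirreducible_def)
  then show ?case by (auto simp: alg_independent_def)
next
  case (Suc j)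
  then obtain f where f: "\<forall>i<j. f i \<in> poly_fun" "alg_independent (Z j) j f" by auto
  have ch: "Z j \<subset> Z (Suc j)" "zirreducible (Z (Suc j))"
    using assms(1) Suc.prems by (auto simp: zchain_def)
  obtain C where C: "zclosed C" "Z j = X \<inter> C"
    using assms(1) Suc.prems unfolding zchain_def by (meson Suc_leD)
  obtain C' where "Z (Suc j) = X \<inter> C'"
    using assms(1) Suc.prems unfolding zchain_def by meson
  then obtain y where y: "y \<in> Z (Suc j)" "y \<notin> C" using ch(1) C(2) by auto
  obtain g where g: "g \<in> poly_fun" "g y \<noteq> 0" "\<And>x. x \<in> C \<Longrightarrow> g x = 0"
    using zclosed_separate[OF C(1) y(2)] by blast
  have "alg_independent (Z (Suc j)) (Suc j) (f(j := g))"
    using alg_independent_Suc[OF f(2), of "Z (Suc j)" g y] f(1) ch y g C by auto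
  moreover have "\<forall>i<Suc j. (f(j := g)) i \<in> poly_fun" using f(1) g(1) by auto
  ultimately show ?case by blast
qed

lemma zchain_le_card:
  assumes "zchain X k Z" "finite I" "\<And>i. (\<lambda>x. \<phi> x i) \<in> poly_in I" "Z k \<subseteq> zclosure (range \<phi>)"
  shows "k \<le> card I"
  using zchain_alg_independent[OF assms(1) order_refl] alg_independent_le_card[OF assms(2-4)] by blast

section \<open>Algebra structures on a four-dimensional space\<close>

lemma sum_idx: "(\<Sum>i\<in>UNIV. f i) = f E1 + f E2 + f E3 + f E4"
  by (simp add: UNIV_idx add.assoc)

lemma all_idx: "(\<forall>i. P i) \<longleftrightarrow> P E1 \<and> P E2 \<and> P E3 \<and> P E4"
  by (metis idx.exhaust)

definition vec4 :: "complex \<Rightarrow> complex \<Rightarrow> complex \<Rightarrow> complex \<Rightarrow> vec" where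
  "vec4 a b c d = (\<chi> k. case k of E1 \<Rightarrow> a | E2 \<Rightarrow> b | E3 \<Rightarrow> c | E4 \<Rightarrow> d)"

lemma vec4_nth [simp]:
  "vec4 a b c d $ E1 = a" "vec4 a b c d $ E2 = b" "vec4 a b c d $ E3 = c" "vec4 a b c d $ E4 = d"
  by (simp_all add: vec4_def)

lemma vec_eq_idx: "(x::vec) = y \<longleftrightarrow> x$E1 = y$E1 \<and> x$E2 = y$E2 \<and> x$E3 = y$E3 \<and> x$E4 = y$E4"
  by (auto simp: vec_eq_iff all_idx)

lemma mult_nth: "mult \<mu> x y $ k = (\<Sum>i\<in>UNIV. \<Sum>j\<in>UNIV. x$i * y$j * \<mu> (i, j, k))"
  by (simp add: mult_def)

lemma mult_add_left: "mult \<mu> (x + y) z = mult \<mu> x z + mult \<mu> y z"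
  by (simp add: vec_eq_iff mult_nth sum.distrib algebra_simps)

lemma mult_add_right: "mult \<mu> z (x + y) = mult \<mu> z x + mult \<mu> z y"
  by (simp add: vec_eq_iff mult_nth sum.distrib algebra_simps)

lemma mult_scale_left: "mult \<mu> (c *s x) z = c *s mult \<mu> x z"
  by (simp add: vec_eq_iff mult_nth sum_distrib_left algebra_simps)

lemma mult_scale_right: "mult \<mu> z (c *s x) = c *s mult \<mu> z x"
  by (simp add: vec_eq_iff mult_nth sum_distrib_left algebra_simps)

lemma mult_zero_left [simp]: "mult \<mu> 0 z = 0"
  by (simp add: vec_eq_iff mult_nth)

lemma mult_zero_right [simp]: "mult \<mu> z 0 = 0"
  by (simp add: vec_eq_iff mult_nth)

lemma mult_sum_left: "mult \<mu> (\<Sum>a\<in>A. f a) z = (\<Sum>a\<in>A. mult \<mu> (f a) z)"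
  by (induction A rule: infinite_finite_induct) (auto simp: mult_add_left)

lemma mult_sum_right: "mult \<mu> z (\<Sum>a\<in>A. f a) = (\<Sum>a\<in>A. mult \<mu> z (f a))"
  by (induction A rule: infinite_finite_induct) (auto simp: mult_add_right)

lemma mult_sum_scale:
  "mult \<mu> (\<Sum>i\<in>A. a i *s u i) (\<Sum>j\<in>B. b j *s w j) = (\<Sum>i\<in>A. \<Sum>j\<in>B. (a i * b j) *s mult \<mu> (u i) (w j))"
  unfolding mult_sum_left
  by (intro sum.cong refl)
    (simp add: mult_sum_right mult_scale_left mult_scale_right vector_smult_assoc mult.commute)

lemma mult_axis: "mult \<mu> (axis i 1) (axis j 1) = (\<chi> k. \<mu> (i, j, k))"
  by (cases i; cases j) (simp_all add: vec_eq_iff mult_nth sum_idx axis_def)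

lemma mult_expand:
  "mult \<mu> x y = (\<Sum>i\<in>UNIV. \<Sum>j\<in>UNIV. (x$i * y$j) *s mult \<mu> (axis i 1) (axis j 1))"
  by (simp add: vec_eq_iff mult_nth mult_axis)

lemma struct_eqI:
  assumes "\<And>x y. mult \<mu> x y = mult \<nu> x y" shows "\<mu> = \<nu>"
proof
  fix ijk :: "idx \<times> idx \<times> idx"
  obtain i j k where "ijk = (i, j, k)" by (cases ijk)
  then show "\<mu> ijk = \<nu> ijk"
    using assms[of "axis i 1" "axis j 1"] by (simp add: mult_axis vec_eq_iff)
qed

subsection \<open>The action of the general linear group\<close>

lemma matrix_inv_vec:
  assumes "invertible (g :: complex^'n^'n)"
  shows "g *v (matrix_inv g *v x) = x" "matrix_inv g *v (g *v x) = x"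
proof -
  have "g ** matrix_inv g = mat 1 \<and> matrix_inv g ** g = mat 1"
    unfolding matrix_inv_def by (rule someI_ex) (use assms in \<open>simp add: invertible_def\<close>)
  then show "g *v (matrix_inv g *v x) = x" "matrix_inv g *v (g *v x) = x"
    by (simp_all add: matrix_vector_mul_assoc)
qed

lemma invertibleI_inverse:
  assumes "\<And>x. g *v (h *v x) = x" "\<And>x. h *v (g *v x) = x"
  shows "invertible (g :: complex^'n^'n)"
  using assms unfolding invertible_def by (metis matrix_eq matrix_vector_mul_assoc matrix_vector_mul_lid)

lemma invertible_matrix_inv: "invertible (g :: complex^'n^'n) \<Longrightarrow> invertible (matrix_inv g)"
  using invertibleI_inverse[of "matrix_inv g" g] by (simp add: matrix_inv_vec)

lemma invertibleI_ker: "(\<And>x. (g :: complex^'n^'n) *v x = 0 \<Longrightarrow> x = 0) \<Longrightarrow> invertible g"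
  by (simp add: invertible_left_inverse matrix_left_invertible_ker)

lemma matrix_vector_expand: "(h :: complex^'n^'m) *v x = (\<Sum>i\<in>UNIV. x$i *s (h *v axis i 1))"
proof -
  have "h *v x = h *v (\<Sum>i\<in>UNIV. x$i *s axis i 1)" by (simp only: basis_expansion)
  then show ?thesis by (simp only: vec.sum vec.scale)
qed

text \<open>\<open>act\<close> prescribes only the products of basis vectors; both sides are
  bilinear, so the transport formula extends to all vectors.\<close>

lemma mult_act: "mult (act g \<mu>) x y = g *v mult \<mu> (matrix_inv g *v x) (matrix_inv g *v y)"
proof -
  let ?h = "matrix_inv g"
  have "mult (act g \<mu>) (axis i 1) (axis j 1) = g *v mult \<mu> (?h *v axis i 1) (?h *v axis j 1)" for i j
    unfolding mult_axis by (simp add: act_def vec_eq_iff)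
  then have "mult (act g \<mu>) x y
      = (\<Sum>i\<in>UNIV. \<Sum>j\<in>UNIV. (x$i * y$j) *s (g *v mult \<mu> (?h *v axis i 1) (?h *v axis j 1)))"
    using mult_expand[of "act g \<mu>" x y] by simp
  also have "\<dots> = g *v (\<Sum>i\<in>UNIV. \<Sum>j\<in>UNIV. (x$i * y$j) *s mult \<mu> (?h *v axis i 1) (?h *v axis j 1))"
    by (simp only: vec.sum vec.scale)
  also have "\<dots> = g *v mult \<mu> (?h *v x) (?h *v y)"
    by (simp only: matrix_vector_expand[of ?h x] matrix_vector_expand[of ?h y] mult_sum_scale)
  finally show ?thesis .
qed

lemma mult_act_apply:
  "invertible g \<Longrightarrow> mult (act g \<mu>) (g *v x) (g *v y) = g *v mult \<mu> x y"
  by (simp add: mult_act matrix_inv_vec)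

lemma act_eqI:
  assumes "invertible g" "\<And>x y. mult \<nu> (g *v x) (g *v y) = g *v mult \<mu> x y"
  shows "\<nu> = act g \<mu>"
proof (rule struct_eqI)
  fix x y show "mult \<nu> x y = mult (act g \<mu>) x y"
    using assms(2)[of "matrix_inv g *v x" "matrix_inv g *v y"]
    by (simp add: mult_act matrix_inv_vec assms(1))
qed

lemma act_eqI_axis:
  assumes g: "invertible g"
    and eq: "\<And>i j. mult \<nu> (g *v axis i 1) (g *v axis j 1) = g *v (\<chi> k. \<mu> (i, j, k))"
  shows "\<nu> = act g \<mu>"
proof (rule act_eqI[OF g])
  fix x y
  have "mult \<nu> (g *v x) (g *v y)
      = (\<Sum>i\<in>UNIV. \<Sum>j\<in>UNIV. (x$i * y$j) *s (g *v mult \<mu> (axis i 1) (axis j 1)))"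
    by (simp only: matrix_vector_expand[of g x] matrix_vector_expand[of g y] mult_sum_scale eq mult_axis)
  also have "\<dots> = g *v mult \<mu> x y"
    unfolding mult_expand[of \<mu> x y] by (simp only: vec.sum vec.scale)
  finally show "mult \<nu> (g *v x) (g *v y) = g *v mult \<mu> x y" .
qed

lemma act_act: "invertible g \<Longrightarrow> invertible h \<Longrightarrow> act g (act h \<mu>) = act (g ** h) \<mu>"
  by (rule act_eqI) (simp_all add: invertible_mult mult_act_apply matrix_vector_mul_assoc[symmetric])

lemma act_mat_1: "act (mat 1) \<mu> = \<mu>"
proof -
  have "invertible (mat 1 :: complex^idx^idx)"
    by (rule invertibleI_inverse[of _ "mat 1"]) simp_all
  then show ?thesis by (intro act_eqI[symmetric]) simp_all
qed

lemma act_matrix_inv: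
  assumes "invertible g" shows "act (matrix_inv g) (act g \<mu>) = \<mu>" "act g (act (matrix_inv g) \<mu>) = \<mu>"
  using assms by (auto intro!: act_eqI[symmetric] struct_eqI
      simp: mult_act mult_act_apply matrix_inv_vec invertible_matrix_inv)

lemma orbit_refl: "\<mu> \<in> orbit \<mu>"
proof -
  have "invertible (mat 1 :: complex^idx^idx)"
    by (rule invertibleI_inverse[of _ "mat 1"]) simp_all
  then show ?thesis unfolding orbit_def using act_mat_1[of \<mu>] by force
qed

lemma orbit_trans: "\<nu> \<in> orbit \<mu> \<Longrightarrow> \<kappa> \<in> orbit \<nu> \<Longrightarrow> \<kappa> \<in> orbit \<mu>"
  unfolding orbit_def using act_act invertible_mult by fastforce

lemma orbit_sym: "\<nu> \<in> orbit \<mu> \<Longrightarrow> \<mu> \<in> orbit \<nu>"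
proof -
  assume "\<nu> \<in> orbit \<mu>"
  then obtain g where g: "invertible g" "\<nu> = act g \<mu>" by (auto simp: orbit_def)
  then have "\<mu> = act (matrix_inv g) \<nu>" by (simp add: act_matrix_inv)
  then show ?thesis using invertible_matrix_inv[OF g(1)] by (auto simp: orbit_def)
qed

definition GL_saturation :: "struct set \<Rightarrow> struct set" where
  "GL_saturation T = (\<Union>\<mu>\<in>T. orbit \<mu>)"

lemma GL_saturation_iff:
  "\<mu> \<in> GL_saturation T \<longleftrightarrow> (\<exists>g \<tau>. invertible g \<and> \<tau> \<in> T \<and> \<mu> = act g \<tau>)"
  by (auto simp: GL_saturation_def orbit_def)

lemma subset_GL_saturation: "T \<subseteq> GL_saturation T"
  using orbit_refl by (auto simp: GL_saturation_def)

lemma poly_fun_act: "(\<lambda>\<mu>. act g \<mu> i) \<in> poly_fun"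
proof -
  obtain a b c where "i = (a, b, c)" by (cases i)
  then show ?thesis
    unfolding act_def matrix_vector_mult_def mult_def
    by (simp, intro poly_fun_intros)
qed

text \<open>For fixed \<open>g\<close> the action is a polynomial map of \<open>S\<close> into
  itself, and such a map carries closures into closures.\<close>

lemma act_zclosure:
  assumes "\<mu> \<in> zclosure S" "invertible g" "\<And>\<nu>. \<nu> \<in> S \<Longrightarrow> orbit \<nu> \<subseteq> S"
  shows "act g \<mu> \<in> zclosure S"
proof -
  have "act g ` S \<subseteq> S"
    using assms(2,3) by (auto simp: orbit_def)
  then show ?thesis
    using zclosure_poly_image[of "act g" S, OF poly_fun_act] zclosure_mono[of "act g ` S" S] assms(1) by blast
qed

subsection \<open>Mono Leibniz structures\<close>

primrec left_power :: "struct \<Rightarrow> vec \<Rightarrow> nat \<Rightarrow> vec" where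
  "left_power \<mu> x 0 = x"
| "left_power \<mu> x (Suc n) = mult \<mu> (left_power \<mu> x n) x"

text \<open>The index is shifted: \<open>left_power \<mu> x n\<close> has \<open>n + 1\<close>
  factors. So right multiplication by a left-normed power with at least two factors kills all
  left-normed powers of \<open>x\<close>. Unlike the condition on generated subalgebras, these are
  polynomial equations in the structure constants.\<close>

definition power_identities :: "struct \<Rightarrow> bool" where
  "power_identities \<mu> \<longleftrightarrow> (\<forall>x i j. mult \<mu> (left_power \<mu> x i) (left_power \<mu> x (Suc j)) = 0)"

lemma gen_subalg_self: "x \<in> gen_subalg \<mu> x"
  by (simp add: gen_subalg_def)

lemma gen_subalg_mult: "a \<in> gen_subalg \<mu> x \<Longrightarrow> b \<in> gen_subalg \<mu> x \<Longrightarrow> mult \<mu> a b \<in> gen_subalg \<mu> x"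
  by (auto simp: gen_subalg_def is_subalgebra_def)

text \<open>Instances of the Leibniz identity: the triple \<open>x, x, x\<close> gives the first,
  and the triple \<open>x, x, xx\<close> then gives the second.\<close>

lemma mono_leibniz_identities:
  assumes "mono_leibniz \<mu>"
  shows "mult \<mu> x (mult \<mu> x x) = 0"
    and "mult \<mu> (mult \<mu> x x) (mult \<mu> x x) = 0"
proof -
  let ?S = "gen_subalg \<mu> x"
  have L: "mult \<mu> (mult \<mu> a b) c = mult \<mu> (mult \<mu> a c) b + mult \<mu> a (mult \<mu> b c)"
    if "a \<in> ?S" "b \<in> ?S" "c \<in> ?S" for a b c
    using assms that unfolding mono_leibniz_def leibniz_on_def by blast
  note S = gen_subalg_self[of x \<mu>] gen_subalg_mult[OF gen_subalg_self gen_subalg_self, of \<mu> x]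
  show x: "mult \<mu> x (mult \<mu> x x) = 0"
    using L[OF S(1) S(1) S(1)] by simp
  show "mult \<mu> (mult \<mu> x x) (mult \<mu> x x) = 0"
    using L[OF S(1) S(1) S(2)] by (simp add: x)
qed

text \<open>The span \<open>S\<close> of the left powers is a subalgebra on which right
  multiplication by any \<open>q\<close> is a scalar multiple of right multiplication by
  \<open>x\<close>. Hence \<open>(pq)r\<close> is symmetric in \<open>q\<close> and
  \<open>r\<close>, while \<open>p(qr)\<close> is a multiple of \<open>p(qx) = 0\<close>.\<close>

lemma mono_leibnizI:
  assumes id: "power_identities \<mu>" shows "mono_leibniz \<mu>"
  unfolding mono_leibniz_def
proof
  fix x
  define S where "S = vec.span (range (left_power \<mu> x))"
  note sp = vec.span_add vec.span_scale vec.span_zero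
  have base: "left_power \<mu> x i \<in> S" for i
    unfolding S_def by (intro vec.span_base) simp
  have right: "mult \<mu> p x \<in> S" if "p \<in> S" for p
    using that unfolding S_def
  proof (induction p rule: vec.span_induct_alt)
    case (step c y z)
    then show ?case
      using base[of "Suc _"] by (auto simp: mult_add_left mult_scale_left S_def intro!: sp)
  qed (simp add: vec.span_zero)
  have zero: "mult \<mu> p (left_power \<mu> x (Suc j)) = 0" if "p \<in> S" for p j
    using that unfolding S_def
  proof (induction p rule: vec.span_induct_alt)
    case (step c y z)
    then show ?case
      using id by (auto simp: mult_add_left mult_scale_left power_identities_def simp del: left_power.simps)
  qed simp
  have zero': "mult \<mu> p (mult \<mu> q x) = 0" if "p \<in> S" "q \<in> S" for p q
    using that(2) unfolding S_def
  proof (induction q rule: vec.span_induct_alt)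
    case (step c y z)
    then show ?case
      using zero[OF that(1)] by (auto simp: mult_add_left mult_add_right mult_scale_left mult_scale_right)
  qed simp
  \<comment> \<open>The scalar is the coefficient of \<open>x\<close> in an expression of
    \<open>q\<close> by left powers; all higher powers act as zero from the right.\<close>
  have coord: "\<exists>c. \<forall>p\<in>S. mult \<mu> p q = c *s mult \<mu> p x" if "q \<in> S" for q
    using that unfolding S_def
  proof (induction q rule: vec.span_induct_alt)
    case base
    show ?case by (intro exI[of _ 0]) simp
  next
    case (step c y z)
    then obtain i where i: "y = left_power \<mu> x i" by auto
    from step obtain d where d: "\<forall>p\<in>S. mult \<mu> p z = d *s mult \<mu> p x" unfolding S_def by auto
    show ?case
    proof (cases i)
      case 0
      then show ?thesis
        using d unfolding S_def[symmetric]
        by (intro exI[of _ "c + d"])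
          (auto simp: i mult_add_right mult_scale_right vector_sadd_rdistrib)
    next
      case (Suc j)
      then show ?thesis
        using d zero[of _ j] unfolding S_def[symmetric]
        by (intro exI[of _ d]) (simp add: i mult_add_right mult_scale_right del: left_power.simps)
    qed
  qed
  have "mult \<mu> p q \<in> S" if pq: "p \<in> S" "q \<in> S" for p q
  proof -
    obtain c where "mult \<mu> p q = c *s mult \<mu> p x"
      using coord[OF pq(2)] pq(1) by blast
    then show ?thesis using right[OF pq(1)] by (simp add: S_def vec.span_scale)
  qed
  then have sub: "is_subalgebra \<mu> S"
    by (auto simp: is_subalgebra_def S_def sp)
  have "leibniz_on \<mu> S"
    unfolding leibniz_on_def
  proof (intro ballI)
    fix p q r assume pqr: "p \<in> S" "q \<in> S" "r \<in> S"
    obtain c where c: "\<forall>p\<in>S. mult \<mu> p q = c *s mult \<mu> p x" using coord pqr by blast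
    obtain d where d: "\<forall>p\<in>S. mult \<mu> p r = d *s mult \<mu> p x" using coord pqr by blast
    show "mult \<mu> (mult \<mu> p q) r = mult \<mu> (mult \<mu> p r) q + mult \<mu> p (mult \<mu> q r)"
      using c d pqr right zero' by (simp add: mult_scale_left mult_scale_right vector_smult_assoc mult.commute)
  qed
  moreover have "gen_subalg \<mu> x \<subseteq> S"
    using sub base[of 0] by (auto simp: gen_subalg_def)
  ultimately show "leibniz_on \<mu> (gen_subalg \<mu> x)"
    by (auto simp: leibniz_on_def)
qed

subsection \<open>Nilpotent structures\<close>

fun position :: "idx \<Rightarrow> nat" where
  "position E1 = 1" | "position E2 = 2" | "position E3 = 3" | "position E4 = 4"

text \<open>A decreasing flag: \<open>level n\<close> is spanned by the basis vectors after the
  first \<open>n\<close>, from the whole space at 0 to zero at 4.\<close>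

definition level :: "nat \<Rightarrow> vec set" where
  "level n = {x. \<forall>k. position k \<le> n \<longrightarrow> x$k = 0}"

lemma mem_level:
  "x \<in> level 0" "x \<in> level (Suc 0) \<longleftrightarrow> x$E1 = 0" "x \<in> level 1 \<longleftrightarrow> x$E1 = 0"
  "x \<in> level 2 \<longleftrightarrow> x$E1 = 0 \<and> x$E2 = 0"
  "x \<in> level 3 \<longleftrightarrow> x$E1 = 0 \<and> x$E2 = 0 \<and> x$E3 = 0"
  "x \<in> level 4 \<longleftrightarrow> x = 0"
  by (simp_all add: level_def all_idx vec_eq_idx)

lemma zero_in_level: "0 \<in> level n"
  by (simp add: level_def)

lemma level_add: "x \<in> level n \<Longrightarrow> y \<in> level n \<Longrightarrow> x + y \<in> level n"
  by (simp add: level_def)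

lemma level_scale: "x \<in> level n \<Longrightarrow> c *s x \<in> level n"
  by (simp add: level_def)

lemma axis_level: "axis i 1 \<in> level n \<longleftrightarrow> n < position i"
  by (auto simp: level_def axis_def)

definition triangular :: "struct \<Rightarrow> bool" where
  "triangular \<mu> \<longleftrightarrow> (\<forall>n x y. x \<in> level n \<longrightarrow> mult \<mu> x y \<in> level (Suc n) \<and> mult \<mu> y x \<in> level (Suc n))"

lemma triangularD:
  assumes "triangular \<mu>" "x \<in> level n" shows "mult \<mu> x y \<in> level (Suc n)" "mult \<mu> y x \<in> level (Suc n)"
  using assms by (auto simp: triangular_def)

lemma triangular_iff:
  "triangular \<mu> \<longleftrightarrow> (\<forall>i j k. position k \<le> position i \<or> position k \<le> position j \<longrightarrow> \<mu> (i, j, k) = 0)"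
proof
  assume t: "triangular \<mu>"
  show "\<forall>i j k. position k \<le> position i \<or> position k \<le> position j \<longrightarrow> \<mu> (i, j, k) = 0"
  proof (intro allI impI)
    fix i j k
    have p: "position l > 0" for l by (cases l) auto
    have "mult \<mu> (axis i 1) (axis j 1) \<in> level (position i)" "mult \<mu> (axis i 1) (axis j 1) \<in> level (position j)"
      using triangularD(1)[OF t, of "axis i 1" "position i - 1" "axis j 1"]
        triangularD(2)[OF t, of "axis j 1" "position j - 1" "axis i 1"] p[of i] p[of j]
      by (simp_all add: axis_level)
    moreover assume "position k \<le> position i \<or> position k \<le> position j"
    ultimately show "\<mu> (i, j, k) = 0"
      by (auto simp: mult_axis level_def)
  qed
next
  assume c: "\<forall>i j k. position k \<le> position i \<or> position k \<le> position j \<longrightarrow> \<mu> (i, j, k) = 0"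
  have "x$i * y$j * \<mu> (i, j, k) = 0 \<and> y$i * x$j * \<mu> (i, j, k) = 0"
    if "x \<in> level n" "position k \<le> Suc n" for n x y i j k
  proof -
    have "x$i = 0 \<or> position k \<le> position i" "x$j = 0 \<or> position k \<le> position j"
      using that by (auto simp: level_def not_less_eq_eq)
    then show ?thesis using c by auto
  qed
  then show "triangular \<mu>"
    unfolding triangular_def level_def by (auto simp: mult_nth level_def intro!: sum.neutral)
qed

text \<open>Multiplication raises the level by one, and one of the two factors of a product takes at
  least half of the letters. So each threshold is twice the previous one minus one: 2, 3, 5,
  9.\<close>

lemma triangular_prod_of:
  assumes t: "triangular \<mu>" and "prod_of \<mu> n x"
  shows "n \<ge> 1 \<and> (n \<ge> 2 \<longrightarrow> x \<in> level 1) \<and> (n \<ge> 3 \<longrightarrow> x \<in> level 2) \<and>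
    (n \<ge> 5 \<longrightarrow> x \<in> level 3) \<and> (n \<ge> 9 \<longrightarrow> x \<in> level 4)"
  using assms(2)
proof (induction rule: prod_of.induct)
  case (prod_mult a x b y)
  note L = triangularD[OF t]
  have s: "Suc 1 = 2" "Suc 2 = 3" "Suc 3 = (4::nat)" by auto
  have "mult \<mu> x y \<in> level 1"
    using L(1)[of x 0 y] by (simp add: mem_level)
  moreover have "mult \<mu> x y \<in> level 2" if "a + b \<ge> 3"
  proof -
    have "a \<ge> 2 \<or> b \<ge> 2" using that by linarith
    then show ?thesis using prod_mult.IH L(1)[of x 1 y] L(2)[of y 1 x] unfolding s by blast
  qed
  moreover have "mult \<mu> x y \<in> level 3" if "a + b \<ge> 5"
  proof -
    have "a \<ge> 3 \<or> b \<ge> 3" using that by linarith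
    then show ?thesis using prod_mult.IH L(1)[of x 2 y] L(2)[of y 2 x] unfolding s by blast
  qed
  moreover have "mult \<mu> x y \<in> level 4" if "a + b \<ge> 9"
  proof -
    have "a \<ge> 5 \<or> b \<ge> 5" using that by linarith
    then show ?thesis using prod_mult.IH L(1)[of x 3 y] L(2)[of y 3 x] unfolding s by blast
  qed
  ultimately show ?case using prod_mult.IH by auto
qed simp

definition nilpotent9 :: "struct \<Rightarrow> bool" where
  "nilpotent9 \<mu> \<longleftrightarrow> (\<forall>x. prod_of \<mu> 9 x \<longrightarrow> x = 0)"

lemma triangular_nilpotent9: "triangular \<mu> \<Longrightarrow> nilpotent9 \<mu>"
  using triangular_prod_of[of \<mu> 9] by (auto simp: nilpotent9_def mem_level)

text \<open>If \<open>n\<close> is minimal such that all products of \<open>n\<close> factors lie in \<open>W\<close>, then any product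
  of \<open>n - 1\<close> factors outside \<open>W\<close> will do.\<close>

lemma nilpotent_step:
  assumes "nilpotent_alg \<mu>" "0 \<in> W" "W \<noteq> UNIV"
  obtains v where "v \<notin> W" "\<And>y. mult \<mu> v y \<in> W" "\<And>y. mult \<mu> y v \<in> W"
proof -
  let ?P = "\<lambda>n. n \<ge> 1 \<and> (\<forall>x. prod_of \<mu> n x \<longrightarrow> x \<in> W)"
  define n where "n = (LEAST n. ?P n)"
  have "\<exists>n. ?P n" using assms(1,2) by (auto simp: nilpotent_alg_def)
  then have n: "?P n" unfolding n_def by (rule LeastI_ex)
  have "n \<noteq> 1"
  proof
    assume "n = 1"
    then have "x \<in> W" for x using n prod_of.prod_single[of \<mu> x] by blast
    then show False using assms(3) by auto
  qed
  with n have n2: "n - 1 \<ge> 1" "n - 1 < n" "n - 1 + 1 = n" "1 + (n - 1) = n" by auto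
  then have "\<not> ?P (n - 1)"
    unfolding n_def using not_less_Least by blast
  then obtain v where v: "prod_of \<mu> (n - 1) v" "v \<notin> W" using n2(1) by blast
  show ?thesis
  proof (rule that[OF v(2)])
    fix y
    show "mult \<mu> v y \<in> W" "mult \<mu> y v \<in> W"
      using prod_of.prod_mult[OF v(1) prod_of.prod_single[of \<mu> y]]
        prod_of.prod_mult[OF prod_of.prod_single[of \<mu> y] v(1)] n n2 by auto
  qed
qed

lemma matrix_of_columns:
  fixes v :: "idx \<Rightarrow> vec"
  shows "(\<chi> i j. v j $ i) *v axis j 1 = v j"
    and "(\<chi> i j. v j $ i) *v x = x$E1 *s v E1 + x$E2 *s v E2 + x$E3 *s v E3 + x$E4 *s v E4"
  by (cases j; simp add: vec_eq_iff matrix_vector_mult_def sum_idx axis_def)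
    (simp add: vec_eq_iff matrix_vector_mult_def sum_idx mult.commute)

text \<open>\<open>nilpotent_step\<close> is applied to the span of the vectors already found,
  beginning with zero. Each new vector lies outside that span and multiplies everything into it, so
  the basis is built from its last vector upwards.\<close>

lemma nilpotent_triangular:
  assumes nil: "nilpotent_alg \<mu>"
  obtains g \<tau> where "invertible g" "triangular \<tau>" "\<mu> = act g \<tau>"
proof -
  have ne: "vec.span B \<noteq> UNIV" if "finite B" "card B < 4" for B :: "vec set"
  proof
    assume "vec.span B = UNIV"
    then have "vec.dim (UNIV :: vec set) \<le> card B"
      using vec.dim_le_card[of UNIV B] that by simp
    then have "CARD(idx) \<le> card B" by (simp only: vec_dim_card)
    then show False using that by (simp add: UNIV_idx)
  qed
  note step = nilpotent_step[OF nil vec.span_zero ne]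
  obtain v4 where v4: "v4 \<notin> vec.span {}" "\<And>y. mult \<mu> v4 y \<in> vec.span {}" "\<And>y. mult \<mu> y v4 \<in> vec.span {}"
    by (rule step[of "{}"]) auto
  obtain v3 where v3: "v3 \<notin> vec.span {v4}" "\<And>y. mult \<mu> v3 y \<in> vec.span {v4}" "\<And>y. mult \<mu> y v3 \<in> vec.span {v4}"
    by (rule step[of "{v4}"]) auto
  obtain v2 where v2: "v2 \<notin> vec.span {v3, v4}" "\<And>y. mult \<mu> v2 y \<in> vec.span {v3, v4}"
      "\<And>y. mult \<mu> y v2 \<in> vec.span {v3, v4}"
    by (rule step[of "{v3, v4}"]) (auto simp: card_insert_if)
  obtain v1 where v1: "v1 \<notin> vec.span {v2, v3, v4}" "\<And>y. mult \<mu> v1 y \<in> vec.span {v2, v3, v4}"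
      "\<And>y. mult \<mu> y v1 \<in> vec.span {v2, v3, v4}"
    by (rule step[of "{v2, v3, v4}"]) (auto simp: card_insert_if)
  define v where "v j = (case j of E1 \<Rightarrow> v1 | E2 \<Rightarrow> v2 | E3 \<Rightarrow> v3 | E4 \<Rightarrow> v4)" for j
  define g where "g = (\<chi> i j. v j $ i)"
  have g: "g *v x = x$E1 *s v1 + x$E2 *s v2 + x$E3 *s v3 + x$E4 *s v4" for x
    unfolding g_def matrix_of_columns by (simp add: v_def)
  have nz: "c = 0" if "c *s w + z = 0" "z \<in> vec.span B" "w \<notin> vec.span B" for c w z and B :: "vec set"
  proof (rule ccontr)
    assume c: "c \<noteq> 0"
    have "c *s w = - z" using that(1) by (simp add: eq_neg_iff_add_eq_0)
    then have "w = (- inverse c) *s z"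
      using c by (metis vector_smult_assoc vector_smult_lid left_inverse vector_smult_rneg vector_smult_lneg)
    then show False using that by (metis vec.span_scale)
  qed
  have sp: "x$E1 = 0 \<Longrightarrow> g *v x \<in> vec.span {v2, v3, v4}"
    "x$E1 = 0 \<Longrightarrow> x$E2 = 0 \<Longrightarrow> g *v x \<in> vec.span {v3, v4}"
    "x$E1 = 0 \<Longrightarrow> x$E2 = 0 \<Longrightarrow> x$E3 = 0 \<Longrightarrow> g *v x \<in> vec.span {v4}" for x
    by (auto simp: g intro!: vec.span_add vec.span_scale intro: vec.span_base)
  have coord: "g *v x \<in> vec.span {v2, v3, v4} \<Longrightarrow> x$E1 = 0"
    "g *v x \<in> vec.span {v3, v4} \<Longrightarrow> x$E1 = 0 \<and> x$E2 = 0"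
    "g *v x \<in> vec.span {v4} \<Longrightarrow> x$E1 = 0 \<and> x$E2 = 0 \<and> x$E3 = 0"
    "g *v x = 0 \<Longrightarrow> x = 0" for x
  proof -
    have mono: "vec.span {v3, v4} \<subseteq> vec.span {v2, v3, v4}" "vec.span {v4} \<subseteq> vec.span {v3, v4}"
      "0 \<in> vec.span {v4}"
      by (auto intro!: vec.span_mono vec.span_zero)
    have 1: "x$E1 = 0" if "g *v x \<in> vec.span {v2, v3, v4}" for x
    proof (rule nz[OF _ _ v1(1)])
      show "x$E1 *s v1 + (g *v (x - vec4 (x$E1) 0 0 0) - g *v x) = 0"
        by (simp add: g vec_eq_iff)
      show "g *v (x - vec4 (x$E1) 0 0 0) - g *v x \<in> vec.span {v2, v3, v4}"
        by (intro vec.span_diff sp that) simp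
    qed
    have 2: "x$E2 = 0" if "g *v x \<in> vec.span {v3, v4}" "x$E1 = 0" for x
    proof (rule nz[OF _ _ v2(1)])
      show "x$E2 *s v2 + (g *v (x - vec4 (x$E1) (x$E2) 0 0) - g *v x) = 0"
        using that by (simp add: g vec_eq_iff)
      show "g *v (x - vec4 (x$E1) (x$E2) 0 0) - g *v x \<in> vec.span {v3, v4}"
        by (intro vec.span_diff sp that) simp_all
    qed
    have 3: "x$E3 = 0" if "g *v x \<in> vec.span {v4}" "x$E1 = 0" "x$E2 = 0" for x
    proof (rule nz[OF _ _ v3(1)])
      show "x$E3 *s v3 + (g *v (x - vec4 (x$E1) (x$E2) (x$E3) 0) - g *v x) = 0"
        using that by (simp add: g vec_eq_iff)
      show "g *v (x - vec4 (x$E1) (x$E2) (x$E3) 0) - g *v x \<in> vec.span {v4}"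
        by (intro vec.span_diff sp that) simp_all
    qed
    show i: "g *v x \<in> vec.span {v2, v3, v4} \<Longrightarrow> x$E1 = 0" by (rule 1)
    show ii: "g *v x \<in> vec.span {v3, v4} \<Longrightarrow> x$E1 = 0 \<and> x$E2 = 0" using 1 2 mono by blast
    show iii: "g *v x \<in> vec.span {v4} \<Longrightarrow> x$E1 = 0 \<and> x$E2 = 0 \<and> x$E3 = 0" using 3 ii mono by blast
    show "x = 0" if z: "g *v x = 0"
    proof -
      have 0: "x$E1 = 0" "x$E2 = 0" "x$E3 = 0" using iii mono(3) z by simp_all
      then have "x$E4 *s v4 = 0" using g[of x] z by simp
      moreover have "v4 \<noteq> 0" using v4(1) by simp
      ultimately show ?thesis using 0 by (simp add: vec_eq_idx[of x])
    qed
  qed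
  have inv: "invertible g" by (rule invertibleI_ker) (rule coord(4))
  define \<tau> where "\<tau> = act (matrix_inv g) \<mu>"
  have \<mu>: "\<mu> = act g \<tau>" by (simp add: \<tau>_def act_matrix_inv inv)
  have gm: "g *v mult \<tau> x y = mult \<mu> (g *v x) (g *v y)" for x y
    unfolding \<mu> by (simp add: mult_act_apply inv)
  have ax: "g *v axis j 1 = v j" for j unfolding g_def by (rule matrix_of_columns)
  have "position k \<le> position i \<or> position k \<le> position j \<longrightarrow> \<tau> (i, j, k) = 0" for i j k
  proof -
    have *: "mult \<tau> (axis i 1) (axis j 1) \<in> level (position i) \<inter> level (position j)"
    proof -
      have "g *v mult \<tau> (axis i 1) (axis j 1) = mult \<mu> (v i) (v j)" by (simp add: gm ax)
      note coord[of "mult \<tau> (axis i 1) (axis j 1)", unfolded this]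
      note c = this
      have "mult \<tau> (axis i 1) (axis j 1) \<in> level (position i)"
        using c v1(2)[of "v j"] v2(2)[of "v j"] v3(2)[of "v j"] v4(2)[of "v j"]
        by (cases i) (simp_all add: v_def mem_level)
      moreover have "mult \<tau> (axis i 1) (axis j 1) \<in> level (position j)"
        using c v1(3)[of "v i"] v2(3)[of "v i"] v3(3)[of "v i"] v4(3)[of "v i"]
        by (cases j) (simp_all add: v_def mem_level)
      ultimately show ?thesis by blast
    qed
    then show ?thesis by (auto simp: mult_axis level_def)
  qed
  then have "triangular \<tau>" by (simp add: triangular_iff)
  then show ?thesis using that inv \<mu> by blast
qed

section \<open>Three linear families of triangular structures\<close>

definition mask :: "'i set \<Rightarrow> ('i \<Rightarrow> complex) \<Rightarrow> 'i \<Rightarrow> complex" where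
  "mask A x = (\<lambda>t. if t \<in> A then x t else 0)"

text \<open>Each family is the range of a linear projection of the space of all structures. An
  arbitrary structure then serves as a parameter, and membership is the fixed-point
  equation.\<close>

definition proj1 :: "struct \<Rightarrow> struct" where
  "proj1 = mask {(E1,E1,E2), (E1,E1,E3), (E1,E1,E4), (E2,E1,E3), (E2,E1,E4), (E3,E1,E4)}"

definition proj12 :: "struct \<Rightarrow> struct" where
  "proj12 x = (\<lambda>t. if t = (E2,E1,E3) then - x (E1,E2,E3) else mask
     {(E1,E2,E3), (E1,E1,E4), (E1,E2,E4), (E1,E3,E4), (E2,E1,E4), (E2,E2,E4), (E2,E3,E4),
      (E3,E1,E4), (E3,E2,E4), (E3,E3,E4)} x t)"

definition proj14 :: "struct \<Rightarrow> struct" where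
  "proj14 = mask
     {(E1,E1,E3), (E1,E2,E3), (E2,E1,E3), (E2,E2,E3), (E1,E1,E4), (E1,E2,E4), (E2,E1,E4),
      (E2,E2,E4), (E3,E1,E4), (E3,E2,E4)}"

lemma mult_proj1: "mult (proj1 \<tau>) x y = vec4 0 (x$E1 * y$E1 * \<tau> (E1,E1,E2))
    (y$E1 * (x$E1 * \<tau> (E1,E1,E3) + x$E2 * \<tau> (E2,E1,E3)))
    (y$E1 * (x$E1 * \<tau> (E1,E1,E4) + x$E2 * \<tau> (E2,E1,E4) + x$E3 * \<tau> (E3,E1,E4)))"
  by (simp add: vec_eq_idx mult_nth sum_idx proj1_def mask_def algebra_simps)

lemma mult_proj12: "mult (proj12 \<tau>) x y = vec4 0 0 ((x$E1 * y$E2 - x$E2 * y$E1) * \<tau> (E1,E2,E3))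
    (x$E1 * y$E1 * \<tau> (E1,E1,E4) + x$E1 * y$E2 * \<tau> (E1,E2,E4) + x$E1 * y$E3 * \<tau> (E1,E3,E4) +
     x$E2 * y$E1 * \<tau> (E2,E1,E4) + x$E2 * y$E2 * \<tau> (E2,E2,E4) + x$E2 * y$E3 * \<tau> (E2,E3,E4) +
     x$E3 * y$E1 * \<tau> (E3,E1,E4) + x$E3 * y$E2 * \<tau> (E3,E2,E4) + x$E3 * y$E3 * \<tau> (E3,E3,E4))"
  by (simp add: vec_eq_idx mult_nth sum_idx proj12_def mask_def algebra_simps)

lemma mult_proj14: "mult (proj14 \<tau>) x y = vec4 0 0
    (x$E1 * y$E1 * \<tau> (E1,E1,E3) + x$E1 * y$E2 * \<tau> (E1,E2,E3) +
     x$E2 * y$E1 * \<tau> (E2,E1,E3) + x$E2 * y$E2 * \<tau> (E2,E2,E3))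
    (x$E1 * y$E1 * \<tau> (E1,E1,E4) + x$E1 * y$E2 * \<tau> (E1,E2,E4) +
     x$E2 * y$E1 * \<tau> (E2,E1,E4) + x$E2 * y$E2 * \<tau> (E2,E2,E4) +
     x$E3 * y$E1 * \<tau> (E3,E1,E4) + x$E3 * y$E2 * \<tau> (E3,E2,E4))"
  by (simp add: vec_eq_idx mult_nth sum_idx proj14_def mask_def algebra_simps)

text \<open>Descriptions of the families that depend only on the flag of the subspaces \<^term>\<open>level n\<close>,
  and are therefore stable under the stabilizer of that flag.\<close>

lemma range_proj1_iff:
  "\<tau> \<in> range proj1 \<longleftrightarrow> triangular \<tau> \<and> (\<forall>x. \<forall>y\<in>level 1. mult \<tau> x y = 0)" (is "_ \<longleftrightarrow> ?R")
proof
  assume "\<tau> \<in> range proj1"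
  then obtain \<sigma> where \<sigma>: "\<tau> = proj1 \<sigma>" by auto
  have "triangular \<tau>"
    unfolding triangular_iff by (simp add: all_idx \<sigma> proj1_def mask_def)
  then show ?R by (simp add: \<sigma> mult_proj1 mem_level vec_eq_idx)
next
  assume R: ?R
  then have "mult \<tau> (axis i 1) (axis j 1) = 0" if "j \<noteq> E1" for i j
    using that by (cases j) (auto simp: axis_level)
  then have "\<tau> (i, j, k) = 0" if "j \<noteq> E1" for i j k
    using that by (auto simp: mult_axis vec_eq_iff)
  moreover have "\<tau> (i, j, k) = 0" if "position k \<le> position i \<or> position k \<le> position j" for i j k
    using R that unfolding triangular_iff by blast
  ultimately have "\<tau> (i, j, k) = proj1 \<tau> (i, j, k)" for i j k
    by (cases i; cases j; cases k; simp add: proj1_def mask_def)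
  then have "\<tau> = proj1 \<tau>" by auto
  then show "\<tau> \<in> range proj1" by blast
qed

lemma range_proj12_iff:
  "\<tau> \<in> range proj12 \<longleftrightarrow> (\<forall>x y. mult \<tau> x y \<in> level 2) \<and>
     (\<forall>x\<in>level 2. \<forall>y. mult \<tau> x y \<in> level 3 \<and> mult \<tau> y x \<in> level 3) \<and>
     (\<forall>x\<in>level 3. \<forall>y. mult \<tau> x y = 0 \<and> mult \<tau> y x = 0) \<and> (\<forall>x. mult \<tau> x x \<in> level 3)"
  (is "_ \<longleftrightarrow> ?R")
proof
  assume "\<tau> \<in> range proj12"
  then obtain \<sigma> where \<sigma>: "\<tau> = proj12 \<sigma>" by auto
  show ?R by (simp add: \<sigma> mult_proj12 mem_level vec_eq_idx)
next
  assume R: ?R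
  have m: "\<tau> (i, j, k) = mult \<tau> (axis i 1) (axis j 1) $ k" for i j k
    by (simp add: mult_axis)
  have 1: "\<tau> (i, j, k) = 0" if "k = E1 \<or> k = E2" for i j k
    unfolding m[of i j k] using R that by (auto simp: mem_level)
  have ax: "axis E3 1 \<in> level 2" "axis E4 1 \<in> level 2" "axis E4 1 \<in> level 3" by (simp_all add: axis_level)
  have 2: "\<tau> (i, j, E3) = 0" if "i = E3 \<or> i = E4 \<or> j = E3 \<or> j = E4" for i j
    unfolding m[of i j E3] using R that ax by (auto simp: mem_level)
  have 3: "\<tau> (i, j, k) = 0" if "i = E4 \<or> j = E4" for i j k
    unfolding m[of i j k] using R that ax(3) by force
  have sq: "mult \<tau> x x $ E3 = 0" for x using R by (auto simp: mem_level)
  have 4: "\<tau> (i, i, E3) = 0" for i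
    unfolding m[of i i E3] by (rule sq)
  \<comment> \<open>Polarization: the squares of \<open>e1\<close>, \<open>e2\<close> and
    \<open>e1 + e2\<close> have no \<open>e3\<close>-component.\<close>
  have 5: "\<tau> (E2, E1, E3) = - \<tau> (E1, E2, E3)"
    using sq[of "axis E1 1 + axis E2 1"] 4 unfolding m[of _ _ E3]
    by (simp add: mult_add_left mult_add_right add_eq_0_iff)
  have "\<tau> (i, j, k) = proj12 \<tau> (i, j, k)" for i j k
    using 1 2 3 4 5 by (cases i; cases j; cases k; simp add: proj12_def mask_def)
  then have "\<tau> = proj12 \<tau>" by auto
  then show "\<tau> \<in> range proj12" by blast
qed

lemma range_proj14_iff:
  "\<tau> \<in> range proj14 \<longleftrightarrow> (\<forall>x y. mult \<tau> x y \<in> level 2) \<and>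
     (\<forall>x\<in>level 2. \<forall>y. mult \<tau> x y \<in> level 3 \<and> mult \<tau> y x = 0) \<and>
     (\<forall>x\<in>level 3. \<forall>y. mult \<tau> x y = 0)"
  (is "_ \<longleftrightarrow> ?R")
proof
  assume "\<tau> \<in> range proj14"
  then obtain \<sigma> where \<sigma>: "\<tau> = proj14 \<sigma>" by auto
  show ?R by (simp add: \<sigma> mult_proj14 mem_level vec_eq_idx)
next
  assume R: ?R
  have m: "\<tau> (i, j, k) = mult \<tau> (axis i 1) (axis j 1) $ k" for i j k
    by (simp add: mult_axis)
  have ax: "axis E3 1 \<in> level 2" "axis E4 1 \<in> level 2" "axis E4 1 \<in> level 3" by (simp_all add: axis_level)
  have 1: "\<tau> (i, j, k) = 0" if "k = E1 \<or> k = E2" for i j k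
    unfolding m[of i j k] using R that by (auto simp: mem_level)
  have 2: "\<tau> (i, j, E3) = 0" if "i = E3 \<or> i = E4" for i j
    unfolding m[of i j E3] using R that ax by (auto simp: mem_level)
  have 3: "\<tau> (i, j, k) = 0" if "j = E3 \<or> j = E4" for i j k
    unfolding m[of i j k] using R that ax by force
  have 4: "\<tau> (i, j, k) = 0" if "i = E4" for i j k
    unfolding m[of i j k] using R that ax(3) by force
  have "\<tau> (i, j, k) = proj14 \<tau> (i, j, k)" for i j k
    using 1 2 3 4 by (cases i; cases j; cases k; simp add: proj14_def mask_def)
  then have "\<tau> = proj14 \<tau>" by auto
  then show "\<tau> \<in> range proj14" by blast
qed

definition families :: "struct set" where
  "families = range proj1 \<union> range proj12 \<union> range proj14"

lemma families_triangular: "\<tau> \<in> families \<Longrightarrow> triangular \<tau>"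
  unfolding families_def triangular_iff
  by (auto simp: all_idx proj1_def proj12_def proj14_def mask_def)

text \<open>In the first family all products lie in \<open>level 1\<close>, which annihilates from
  the right. In the second, squares lie in \<open>level 3\<close>, which annihilates on both sides.
  In the third, products lie in \<open>level 2\<close>, which annihilates from the right.\<close>

lemma families_power_identities:
  assumes "\<tau> \<in> families" shows "power_identities \<tau>"
proof -
  have "mult \<tau> (left_power \<tau> x i) (left_power \<tau> x (Suc j)) = 0" for x i j
  proof -
    consider "\<tau> \<in> range proj1" | "\<tau> \<in> range proj12" | "\<tau> \<in> range proj14"
      using assms unfolding families_def by blast
    then show ?thesis
    proof cases
      case 1
      then have *: "triangular \<tau>" "\<forall>x. \<forall>y\<in>level 1. mult \<tau> x y = 0" unfolding range_proj1_iff by auto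
      have "left_power \<tau> x (Suc j) \<in> level 1"
        using triangularD(1)[OF *(1) mem_level(1)] by simp
      then show ?thesis using *(2) by blast
    next
      case 2
      then have *: "\<forall>x\<in>level 3. \<forall>y. mult \<tau> x y = 0 \<and> mult \<tau> y x = 0" "\<forall>x. mult \<tau> x x \<in> level 3"
        unfolding range_proj12_iff by auto
      have "left_power \<tau> x (Suc j) \<in> level 3"
      proof (induction j)
        case (Suc j)
        then have "left_power \<tau> x (Suc (Suc j)) = 0" using *(1) left_power.simps(2) by metis
        then show ?case by (simp only: zero_in_level)
      qed (use * in simp)
      then show ?thesis using *(1) by blast
    next
      case 3
      then have *: "\<forall>x y. mult \<tau> x y \<in> level 2" "\<forall>x\<in>level 2. \<forall>y. mult \<tau> y x = 0"
        unfolding range_proj14_iff by auto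
      then show ?thesis by simp
    qed
  qed
  then show ?thesis by (simp add: power_identities_def)
qed

subsection \<open>Every structure lies in the saturation of a family\<close>

lemma mult_triangular:
  assumes "triangular \<tau>"
  shows "mult \<tau> x y = vec4 0 (x$E1 * y$E1 * \<tau> (E1,E1,E2))
    (x$E1 * y$E1 * \<tau> (E1,E1,E3) + x$E1 * y$E2 * \<tau> (E1,E2,E3) +
     x$E2 * y$E1 * \<tau> (E2,E1,E3) + x$E2 * y$E2 * \<tau> (E2,E2,E3))
    (x$E1 * y$E1 * \<tau> (E1,E1,E4) + x$E1 * y$E2 * \<tau> (E1,E2,E4) + x$E1 * y$E3 * \<tau> (E1,E3,E4) +
     x$E2 * y$E1 * \<tau> (E2,E1,E4) + x$E2 * y$E2 * \<tau> (E2,E2,E4) + x$E2 * y$E3 * \<tau> (E2,E3,E4) +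
     x$E3 * y$E1 * \<tau> (E3,E1,E4) + x$E3 * y$E2 * \<tau> (E3,E2,E4) + x$E3 * y$E3 * \<tau> (E3,E3,E4))"
  using assms unfolding triangular_iff by (simp add: vec_eq_idx mult_nth sum_idx all_idx algebra_simps)

text \<open>Case split on \<open>a2\<close>, the \<open>e2\<close>-coefficient of
  \<open>e1e1\<close>. If it is zero, \<open>x(xx) = 0\<close> says that a quadratic form times a
  linear form vanishes: a vanishing linear form gives the third family, a vanishing quadratic form
  the second. If \<open>a2\<close> is nonzero, then \<open>c3\<close> decides between the first
  family and, after a change of basis, the third.\<close>

lemma triangular_mono_leibniz:
  assumes t: "triangular \<tau>"
    and id1: "\<And>x. mult \<tau> x (mult \<tau> x x) = 0" and id2: "\<And>x. mult \<tau> (mult \<tau> x x) (mult \<tau> x x) = 0"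
  shows "\<tau> \<in> GL_saturation families"
proof -
  note M = mult_triangular[OF t]
  define a2 a3 a4 where a: "a2 = \<tau> (E1,E1,E2)" "a3 = \<tau> (E1,E1,E3)" "a4 = \<tau> (E1,E1,E4)"
  define b3 b4 c3 c4 d3 d4 where bcd: "b3 = \<tau> (E1,E2,E3)" "b4 = \<tau> (E1,E2,E4)"
    "c3 = \<tau> (E2,E1,E3)" "c4 = \<tau> (E2,E1,E4)" "d3 = \<tau> (E2,E2,E3)" "d4 = \<tau> (E2,E2,E4)"
  define f1 f2 g1 g2 h where fgh: "f1 = \<tau> (E1,E3,E4)" "f2 = \<tau> (E2,E3,E4)"
    "g1 = \<tau> (E3,E1,E4)" "g2 = \<tau> (E3,E2,E4)" "h = \<tau> (E3,E3,E4)"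
  note defs = a bcd fgh
  have tri: "\<tau> (i, j, k) = 0" if "position k \<le> position i \<or> position k \<le> position j" for i j k
    using t that unfolding triangular_iff by blast
  have inI: "\<tau> \<in> GL_saturation families"
    if "p \<in> {proj1, proj12, proj14}" "\<And>i j k. \<tau> (i, j, k) = p \<tau> (i, j, k)" for p
  proof -
    have "\<tau> = p \<tau>" using that(2) by auto
    then have "\<tau> \<in> range p" using rangeI[of p \<tau>] by metis
    then have "\<tau> \<in> families" using that(1) by (auto simp: families_def)
    then show ?thesis using subset_GL_saturation by blast
  qed
  \<comment> \<open>\<open>Q\<close> is the \<open>e3\<close>-coefficient of \<open>xx\<close>;
    \<open>E3\<close> and \<open>E4\<close> below are the last two coordinates of
    \<open>x(xx) = 0\<close>.\<close>
  define Q where "Q x1 x2 = x1 * x1 * a3 + x1 * x2 * (b3 + c3) + x2 * x2 * d3" for x1 x2 :: complex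
  have E3: "x1 * (x1 * x1 * a2) * b3 + x2 * (x1 * x1 * a2) * d3 = 0" for x1 x2
    using arg_cong[OF id1[of "vec4 x1 x2 0 0"], of "\<lambda>v. v $ E3"] by (simp add: M defs)
  have E4: "(x1 * x1 * a2) * (x1 * b4 + x2 * d4 + x3 * g2) + Q x1 x2 * (x1 * f1 + x2 * f2 + x3 * h) = 0"
    for x1 x2 x3
    using arg_cong[OF id1[of "vec4 x1 x2 x3 0"], of "\<lambda>v. v $ E4"] by (simp add: M defs Q_def algebra_simps)
  show ?thesis
  proof (cases "a2 = 0")
    case True
    show ?thesis
    proof (cases "f1 = 0 \<and> f2 = 0 \<and> h = 0")
      case True
      then have "\<tau> (i, j, k) = proj14 \<tau> (i, j, k)" for i j k
        using \<open>a2 = 0\<close> tri by (cases i; cases j; cases k; simp add: proj14_def mask_def defs)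
      then show ?thesis by (intro inI[of proj14]) blast+
    next
      case False
      have E: "Q x1 x2 * (x1 * f1 + x2 * f2 + x3 * h) = 0" for x1 x2 x3
        using E4[of x1 x2 x3] True by simp
      \<comment> \<open>The linear form is not zero, so \<open>Q\<close> must be. For nonzero
        \<open>h\<close> the values \<open>x3 = 0\<close> and \<open>x3 = 1\<close> are compared;
        otherwise four points determine the coefficients of the cubic.\<close>
      have "a3 = 0 \<and> d3 = 0 \<and> b3 + c3 = 0"
      proof (cases "h = 0")
        case True
        define s where "s = b3 + c3"
        have e: "a3 * f1 = 0" "d3 * f2 = 0" "(a3 + s + d3) * (f1 + f2) = 0" "(a3 - s + d3) * (f1 - f2) = 0"
          using E[of 1 0 0] E[of 0 1 0] E[of 1 1 0] E[of 1 "-1" 0] unfolding Q_def s_def by algebra+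
        have "a3 * f2 + s * f1 = 0" "s * f2 + d3 * f1 = 0"
          using e by algebra+
        then show ?thesis
          using e False True unfolding s_def[symmetric] by (cases "f1 = 0") auto
      next
        case h: False
        have "Q x1 x2 = 0" for x1 x2
          using E[of x1 x2 0] E[of x1 x2 1] h by (simp add: algebra_simps)
        from this[of 1 0] this[of 0 1] this[of 1 1] show ?thesis by (simp add: Q_def)
      qed
      then have "a3 = 0" "d3 = 0" "c3 = - b3" by (auto simp: add_eq_0_iff)
      then have "\<tau> (i, j, k) = proj12 \<tau> (i, j, k)" for i j k
        using \<open>a2 = 0\<close> tri by (cases i; cases j; cases k; simp add: proj12_def mask_def defs)
      then show ?thesis by (intro inI[of proj12]) blast+
    qed
  next
    case a2: False
    have b3: "b3 = 0" using E3[of 1 0] a2 by simp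
    have d3: "d3 = 0" using E3[of 1 1] a2 b3 by simp
    have A: "a2 * b4 + a3 * f1 = 0" using E4[of 1 0 0] by (simp add: Q_def)
    have B: "a2 * (b4 + d4) + (a3 + c3) * (f1 + f2) = 0" "a2 * (b4 - d4) + (a3 - c3) * (f1 - f2) = 0"
      using E4[of 1 1 0] E4[of 1 "-1" 0] by (simp_all add: Q_def b3 d3)
    have C: "a2 * g2 + a3 * h = 0"
      using E4[of 1 0 1] A by (simp add: Q_def algebra_simps) algebra
    have D: "c3 * f2 = 0" using A B by algebra
    have B': "a2 * d4 + c3 * f1 + a3 * f2 = 0" using A B by algebra
    have E: "c3 * h = 0"
      using E4[of 1 1 1] B(1) C by (simp add: Q_def b3 d3) algebra
    show ?thesis
    proof (cases "c3 = 0")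
      case False
      then have z: "f2 = 0" "h = 0" using D E by auto
      then have g2: "g2 = 0" using C a2 by simp
      \<comment> \<open>Here \<open>(xx)(xx) = 0\<close> enters: evaluated at \<open>e1\<close> it
        kills \<open>d4\<close>.\<close>
      have "mult \<tau> (mult \<tau> (axis E1 1) (axis E1 1)) (mult \<tau> (axis E1 1) (axis E1 1)) $ E4
        = a2 * a2 * d4 + a2 * a3 * (f2 + g2) + a3 * a3 * h"
        by (simp add: M defs axis_def algebra_simps)
      then have d4: "d4 = 0" using id2[of "axis E1 1"] z g2 a2 by simp
      have f1: "f1 = 0" using B' z d4 False by simp
      have b4: "b4 = 0" using A f1 a2 by simp
      have "\<tau> (i, j, k) = proj1 \<tau> (i, j, k)" for i j k
        using tri[of k i j] b3[unfolded defs] d3[unfolded defs] z[unfolded defs] g2[unfolded defs]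
          d4[unfolded defs] f1[unfolded defs] b4[unfolded defs]
        by (cases i; cases j; cases k; simp add: proj1_def mask_def)
      then show ?thesis by (intro inI[of proj1]) blast+
    next
      case c3: True
      \<comment> \<open>The old \<open>e3\<close> becomes the second basis vector, and the third is
        \<open>e1e1\<close> without its \<open>e4\<close>-part. All products lie in the span of the
        last two, and the equations \<open>A\<close>, \<open>C\<close>, \<open>z\<close> and
        \<open>ww\<close> say that the third annihilates from the right, as the third family
        requires.\<close>
      define v where "v j = (case j of E1 \<Rightarrow> axis E1 1 | E2 \<Rightarrow> axis E3 1 | E3 \<Rightarrow> vec4 0 a2 a3 0 | E4 \<Rightarrow> axis E4 1)"
        for j :: idx
      define P where "P = (\<chi> i j. v j $ i)"
      have P: "P *v x = x$E1 *s v E1 + x$E2 *s v E2 + x$E3 *s v E3 + x$E4 *s v E4" for x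
        unfolding P_def by (rule matrix_of_columns)
      have Pa: "P *v axis j 1 = v j" for j unfolding P_def by (rule matrix_of_columns)
      have inv: "invertible P"
        by (rule invertibleI_ker) (use a2 in \<open>auto simp: P v_def vec_eq_idx axis_def\<close>)
      define \<nu> :: struct where "\<nu> = (\<lambda>t. if t = (E1,E1,E3) then 1 else if t = (E1,E1,E4) then a4
        else if t = (E1,E2,E4) then f1 else if t = (E2,E1,E4) then g1 else if t = (E2,E2,E4) then h
        else if t = (E3,E1,E4) then a2 * c4 + a3 * g1 else if t = (E3,E2,E4) then a2 * f2 + a3 * h
        else 0)"
      have Pv: "P *v (\<chi> k. \<nu> (i, j, k)) = \<nu> (i,j,E1) *s v E1 + \<nu> (i,j,E2) *s v E2
          + \<nu> (i,j,E3) *s v E3 + \<nu> (i,j,E4) *s v E4" for i j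
        by (simp add: P)
      have z: "a2 * d4 + a3 * f2 = 0" using B' c3 by simp
      have ww: "a2 * a2 * d4 + a2 * a3 * f2 + a3 * a2 * g2 + a3 * a3 * h = 0"
        using z C by algebra
      have "mult \<tau> (v i) (v j) = P *v (\<chi> k. \<nu> (i, j, k))" for i j
        unfolding M Pv unfolding \<nu>_def defs[symmetric] b3 d3 c3
        by (cases i; cases j; simp add: v_def vec_eq_idx axis_def A C z ww)
      then have "\<tau> = act P \<nu>" by (intro act_eqI_axis inv) (simp add: Pa)
      moreover have "\<nu> = proj14 \<nu>" by (rule ext) (auto simp: \<nu>_def proj14_def mask_def)
      ultimately show ?thesis
        unfolding GL_saturation_iff families_def using inv by blast
    qed
  qed
qed

lemma NML_subset_GL_saturation: "NML \<subseteq> GL_saturation families"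
proof
  fix \<mu> assume "\<mu> \<in> NML"
  then have \<mu>: "nilpotent_alg \<mu>" "mono_leibniz \<mu>" by (auto simp: NML_def)
  obtain g \<tau> where g: "invertible g" "triangular \<tau>" "\<mu> = act g \<tau>"
    using nilpotent_triangular[OF \<mu>(1)] by blast
  have \<tau>: "\<tau> = act (matrix_inv g) \<mu>" using g by (simp add: act_matrix_inv)
  have inv: "matrix_inv (matrix_inv g) *v (matrix_inv g *v x) = x" for x
    by (simp add: matrix_inv_vec invertible_matrix_inv g(1))
  have "mult \<tau> x (mult \<tau> x x) = 0" "mult \<tau> (mult \<tau> x x) (mult \<tau> x x) = 0" for x
    unfolding \<tau> mult_act inv by (simp_all add: mono_leibniz_identities[OF \<mu>(2)])
  then have "\<tau> \<in> GL_saturation families" using triangular_mono_leibniz g(2) by blast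
  then show "\<mu> \<in> GL_saturation families"
    unfolding GL_saturation_iff using g(1,3) act_act invertible_mult by metis
qed

subsection \<open>Closed conditions satisfied by the families\<close>

text \<open>A bracketed product of fixed vectors as a function of the structure. This turns the
  vanishing of all products of a given length into polynomial equations in \<mu>.\<close>

inductive product_map :: "nat \<Rightarrow> (struct \<Rightarrow> vec) \<Rightarrow> bool" where
  "product_map 1 (\<lambda>\<mu>. x)"
| "product_map a f \<Longrightarrow> product_map b g \<Longrightarrow> product_map (a + b) (\<lambda>\<mu>. mult \<mu> (f \<mu>) (g \<mu>))"

lemma prod_of_iff_product_map: "prod_of \<mu> n x \<longleftrightarrow> (\<exists>f. product_map n f \<and> f \<mu> = x)"
proof
  show "prod_of \<mu> n x \<Longrightarrow> \<exists>f. product_map n f \<and> f \<mu> = x"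
  proof (induction rule: prod_of.induct)
    case (prod_single x) then show ?case by (intro exI[of _ "\<lambda>_. x"]) (simp add: product_map.intros(1)[simplified])
  next
    case (prod_mult a x b y) then show ?case using product_map.intros(2) by blast
  qed
  have "product_map n f \<Longrightarrow> prod_of \<mu> n (f \<mu>)" for f
    by (induction rule: product_map.induct) (auto intro: prod_of.intros[simplified])
  then show "\<exists>f. product_map n f \<and> f \<mu> = x \<Longrightarrow> prod_of \<mu> n x" by blast
qed

definition vec_poly :: "(struct \<Rightarrow> vec) \<Rightarrow> bool" where
  "vec_poly f \<longleftrightarrow> (\<forall>k. (\<lambda>\<mu>. f \<mu> $ k) \<in> poly_fun)"

lemma vec_poly_const: "vec_poly (\<lambda>\<mu>. x)"
  by (simp add: vec_poly_def poly_fun_intros)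

lemma vec_poly_mult: "vec_poly f \<Longrightarrow> vec_poly g \<Longrightarrow> vec_poly (\<lambda>\<mu>. mult \<mu> (f \<mu>) (g \<mu>))"
  unfolding vec_poly_def mult_nth by (intro allI poly_fun_intros) auto

lemma vec_poly_diff: "vec_poly f \<Longrightarrow> vec_poly g \<Longrightarrow> vec_poly (\<lambda>\<mu>. f \<mu> - g \<mu>)"
  unfolding vec_poly_def by (auto intro: poly_fun_intros)

lemma zclosed_vec_poly: "vec_poly f \<Longrightarrow> zclosed {\<mu>. f \<mu> = 0}"
  unfolding vec_poly_def vec_eq_iff by (intro zclosed_Collect_all) (simp add: zclosed_zero)

lemmas vec_poly_intros = vec_poly_const vec_poly_mult vec_poly_diff

definition NML' :: "struct set" where
  "NML' = {\<mu>. nilpotent9 \<mu> \<and> power_identities \<mu>}"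

lemma NML'_subset_NML: "NML' \<subseteq> NML"
  by (auto simp: NML'_def NML_def nilpotent9_def nilpotent_alg_def intro: mono_leibnizI exI[of _ 9])

lemma zclosed_NML': "zclosed NML'"
proof -
  have p: "product_map n f \<Longrightarrow> vec_poly f" for n f
    by (induction rule: product_map.induct) (auto intro: vec_poly_intros)
  have "nilpotent9 \<mu> \<longleftrightarrow> (\<forall>f. product_map 9 f \<longrightarrow> f \<mu> = 0)" for \<mu>
    unfolding nilpotent9_def prod_of_iff_product_map by blast
  moreover have "zclosed {\<mu>. product_map 9 f \<longrightarrow> f \<mu> = 0}" for f
    by (rule zclosed_Collect_imp) (intro zclosed_vec_poly p)
  ultimately have 1: "zclosed {\<mu>. nilpotent9 \<mu>}"
    by (simp add: zclosed_Collect_all)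
  have "vec_poly (\<lambda>\<mu>. left_power \<mu> x n)" for x n
    by (induction n) (auto intro: vec_poly_intros)
  then have "zclosed {\<mu>. power_identities \<mu>}"
    unfolding power_identities_def by (intro zclosed_Collect_all zclosed_vec_poly vec_poly_intros)
  with 1 show ?thesis unfolding NML'_def by (rule zclosed_Collect_conj)
qed

lemma GL_saturation_families_subset_NML': "GL_saturation families \<subseteq> NML'"
proof
  fix \<mu> assume "\<mu> \<in> GL_saturation families"
  then obtain g \<tau> where g: "invertible g" "\<tau> \<in> families" "\<mu> = act g \<tau>"
    unfolding GL_saturation_iff by blast
  have m: "mult \<mu> (g *v x) (g *v y) = g *v mult \<tau> x y" for x y
    using g by (simp add: mult_act_apply)
  have surj: "\<exists>y. x = g *v y" for x using matrix_inv_vec(1)[OF g(1), of x] by metis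
  have lp: "left_power \<mu> (g *v x) n = g *v left_power \<tau> x n" for x n
    by (induction n) (simp_all add: m)
  have "mult \<mu> (left_power \<mu> x i) (left_power \<mu> x (Suc j)) = 0" for x i j
  proof -
    obtain y where "x = g *v y" using surj by blast
    then show ?thesis
      using families_power_identities[OF g(2)]
      by (simp only: lp m power_identities_def) (simp add: vec.zero)
  qed
  moreover have "\<exists>y. prod_of \<tau> n y \<and> x = g *v y" if "prod_of \<mu> n x" for n x
    using that
  proof (induction rule: prod_of.induct)
    case (prod_single x) then show ?case using surj prod_of.prod_single by blast
  next
    case (prod_mult a x b y) then show ?case using m prod_of.prod_mult by metis
  qed
  then have "nilpotent9 \<mu>"
    using triangular_nilpotent9[OF families_triangular[OF g(2)]]
    unfolding nilpotent9_def by (metis vec.zero)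
  ultimately show "\<mu> \<in> NML'" by (simp add: NML'_def power_identities_def)
qed

lemma NML_eq: "NML = GL_saturation families" "zclosed NML"
proof -
  have "NML = NML'" "NML = GL_saturation families"
    using NML_subset_GL_saturation GL_saturation_families_subset_NML' NML'_subset_NML by auto
  then show "NML = GL_saturation families" "zclosed NML" using zclosed_NML' by auto
qed

section \<open>Parametrizations by affine space\<close>

definition unip :: "struct \<Rightarrow> complex^idx^idx" where
  "unip x = (\<chi> i j. if i = j then 1 else if position i < position j then x (i, j, E1) else 0)"

text \<open>Back substitution for a unipotent upper triangular system. No division occurs, so acting
  by \<open>unip x\<close> is polynomial in the entries.\<close>

definition unip_inv :: "struct \<Rightarrow> vec \<Rightarrow> vec" where
  "unip_inv x y = (let c = y$E3 - x (E3,E4,E1) * y$E4;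
      b = y$E2 - x (E2,E3,E1) * c - x (E2,E4,E1) * y$E4;
      a = y$E1 - x (E1,E2,E1) * b - x (E1,E3,E1) * c - x (E1,E4,E1) * y$E4
    in vec4 a b c (y$E4))"

lemma unip_vec: "unip x *v y = vec4
    (y$E1 + x (E1,E2,E1) * y$E2 + x (E1,E3,E1) * y$E3 + x (E1,E4,E1) * y$E4)
    (y$E2 + x (E2,E3,E1) * y$E3 + x (E2,E4,E1) * y$E4) (y$E3 + x (E3,E4,E1) * y$E4) (y$E4)"
  by (simp add: unip_def vec_eq_idx matrix_vector_mult_def sum_idx)

lemma unip_unip_inv: "unip x *v unip_inv x y = y" "unip_inv x (unip x *v y) = y"
  by (simp_all add: unip_vec unip_inv_def Let_def vec_eq_idx)

lemma invertible_unip: "invertible (unip x)"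
  by (rule invertibleI_ker) (metis unip_unip_inv vec.zero)

lemma matrix_inv_unip: "matrix_inv (unip x) *v y = unip_inv x y"
  by (metis matrix_inv_vec(2) invertible_unip unip_unip_inv(1))

lemma act_nth:
  "act g \<mu> (i, j, k) = (\<Sum>l\<in>UNIV. g $ k $ l *
     mult \<mu> (matrix_inv g *v axis i 1) (matrix_inv g *v axis j 1) $ l)"
  unfolding act_def prod.case by (subst matrix_vector_mult_def) simp

text \<open>The parameters: a structure in a family, and the entries of a unipotent matrix, stored in the
  unused coefficients of \<open>e\<^sub>1\<close>. The last two families are stable under the stabilizer of the
  flag \<^term>\<open>level 2\<close>, \<^term>\<open>level 3\<close>, which makes the entry at \<open>(1,2)\<close> superfluous.\<close>

definition drop12 :: "struct \<Rightarrow> struct" where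
  "drop12 x = x((E1,E2,E1) := 0)"

definition param1 :: "struct \<Rightarrow> struct" where "param1 x = act (unip x) (proj1 x)"
definition param12 :: "struct \<Rightarrow> struct" where "param12 x = act (unip (drop12 x)) (proj12 x)"
definition param14 :: "struct \<Rightarrow> struct" where "param14 x = act (unip (drop12 x)) (proj14 x)"

definition vars1 :: "(idx \<times> idx \<times> idx) list" where
  "vars1 = [(E1,E1,E2), (E1,E1,E3), (E1,E1,E4), (E2,E1,E3), (E2,E1,E4), (E3,E1,E4),
     (E1,E2,E1), (E3,E4,E1), (E2,E4,E1), (E1,E4,E1), (E1,E3,E1), (E2,E3,E1)]"

text \<open>Ten coefficients of the structure and five unipotent entries. The order matters: the
  chain of length 15 switches the parameters on from left to right.\<close>

definition vars12 :: "(idx \<times> idx \<times> idx) list" where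
  "vars12 = [(E1,E2,E3), (E1,E1,E4), (E1,E2,E4), (E1,E3,E4), (E2,E1,E4), (E2,E2,E4), (E2,E3,E4),
      (E3,E1,E4), (E3,E2,E4), (E3,E3,E4),
      (E3,E4,E1), (E2,E4,E1), (E1,E4,E1), (E1,E3,E1), (E2,E3,E1)]"

definition vars14 :: "(idx \<times> idx \<times> idx) list" where
  "vars14 = [(E1,E1,E3), (E1,E2,E3), (E2,E1,E3), (E2,E2,E3), (E1,E1,E4), (E1,E2,E4), (E2,E1,E4),
      (E2,E2,E4), (E3,E1,E4), (E3,E2,E4),
      (E3,E4,E1), (E2,E4,E1), (E1,E4,E1), (E1,E3,E1), (E2,E3,E1)]"

lemma poly_in_act_unip:
  assumes I: "finite I" and p: "\<And>t. (\<lambda>x. p x t) \<in> poly_in I"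
    and q: "\<And>i j. position i < position j \<Longrightarrow> (\<lambda>x. q x (i, j, E1)) \<in> poly_in I"
  shows "(\<lambda>x. act (unip (q x)) (p x) t) \<in> poly_in I"
proof -
  obtain i j k where t: "t = (i, j, k)" by (cases t)
  note intros = poly_in_const[OF I] poly_in_add[OF I] poly_in_mult[OF I] poly_in_diff[OF I]
    poly_in_sum[OF I] p q
  have u: "(\<lambda>x. unip (q x) $ i $ j) \<in> poly_in I" for i j
    by (cases "i = j"; cases "position i < position j") (auto simp: unip_def intro: intros)
  have w: "(\<lambda>x. unip_inv (q x) y $ i) \<in> poly_in I" for y i
    by (cases i) (auto simp: unip_inv_def Let_def intro!: intros)
  show ?thesis
    unfolding t act_nth matrix_inv_unip mult_nth
    by (intro intros u w)
qed

lemma poly_in_proj: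
  "(\<lambda>x. proj1 x t) \<in> poly_in (set vars1)" "(\<lambda>x. proj12 x t) \<in> poly_in (set vars12)"
  "(\<lambda>x. proj14 x t) \<in> poly_in (set vars14)"
proof -
  have m: "(\<lambda>x. mask A x t) \<in> poly_in I" if "A \<subseteq> I" "finite I" for A I :: "(idx \<times> idx \<times> idx) set" and t
    using that by (cases "t \<in> A") (auto simp: mask_def intro: poly_in_const poly_in_coord)
  show "(\<lambda>x. proj1 x t) \<in> poly_in (set vars1)" "(\<lambda>x. proj14 x t) \<in> poly_in (set vars14)"
    unfolding proj1_def proj14_def by (intro m; simp add: vars1_def vars14_def)+
  show "(\<lambda>x. proj12 x t) \<in> poly_in (set vars12)"
    unfolding proj12_def
    by (cases "t = (E2,E1,E3)")
      (auto intro!: m poly_in_minus poly_in_coord simp: vars12_def)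
qed

lemma poly_in_param:
  "(\<lambda>x. param1 x t) \<in> poly_in (set vars1)" "(\<lambda>x. param12 x t) \<in> poly_in (set vars12)"
  "(\<lambda>x. param14 x t) \<in> poly_in (set vars14)"
proof -
  have 1: "(\<lambda>x. x (i, j, E1)) \<in> poly_in (set vars1)" if "position i < position j" for i j
    using that by (intro poly_in_coord) (cases i; cases j; simp add: vars1_def)+
  have 2: "(\<lambda>x. drop12 x (i, j, E1)) \<in> poly_in (set vars)"
    if "position i < position j" "vars = vars12 \<or> vars = vars14" for i j vars
  proof (cases "(i, j) = (E1, E2)")
    case True
    then show ?thesis by (auto simp: drop12_def intro: poly_in_const)
  next
    case False
    then have "drop12 x (i, j, E1) = x (i, j, E1)" for x by (auto simp: drop12_def)
    moreover have "(i, j, E1) \<in> set vars"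
      using False that by (cases i; cases j; auto simp: vars12_def vars14_def)
    ultimately show ?thesis by (simp add: poly_in_coord)
  qed
  show "(\<lambda>x. param1 x t) \<in> poly_in (set vars1)"
    unfolding param1_def by (intro poly_in_act_unip poly_in_proj 1) auto
  show "(\<lambda>x. param12 x t) \<in> poly_in (set vars12)" "(\<lambda>x. param14 x t) \<in> poly_in (set vars14)"
    unfolding param12_def param14_def by (intro poly_in_act_unip poly_in_proj 2; simp)+
qed

subsection \<open>The big cell\<close>

definition stabilizes :: "nat \<Rightarrow> complex^idx^idx \<Rightarrow> bool" where
  "stabilizes n l \<longleftrightarrow> (\<forall>x\<in>level n. l *v x \<in> level n \<and> matrix_inv l *v x \<in> level n)"

text \<open>An injective linear map of a finite-dimensional subspace into itself is onto, so the
  inverse preserves the subspace as well.\<close>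

lemma stabilizesI:
  assumes l: "invertible l" and sub: "\<And>x. x \<in> level n \<Longrightarrow> l *v x \<in> level n"
  shows "stabilizes n l"
proof -
  have inj: "inj ((*v) l)" by (metis injI l matrix_inv_vec(2))
  have S: "vec.subspace (level n)"
    by (auto simp: vec.subspace_def zero_in_level level_add level_scale)
  have "vec.dim ((*v) l ` level n) = vec.dim (level n)"
    by (rule vec.dim_image_eq) (use inj in \<open>auto intro: matrix_vector_mul_linear_gen inj_on_subset\<close>)
  then have "(*v) l ` level n = level n"
    using vec.subspace_dim_equal[OF vec.linear_subspace_image[OF matrix_vector_mul_linear_gen S] S, of l] sub
    by force
  then have "matrix_inv l *v x \<in> level n" if "x \<in> level n" for x
    using that matrix_inv_vec(2)[OF l] by (metis imageE)
  then show ?thesis using sub by (auto simp: stabilizes_def)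
qed

lemma act_stable_proj12:
  assumes "invertible l" "stabilizes 2 l" "stabilizes 3 l" "\<tau> \<in> range proj12"
  shows "act l \<tau> \<in> range proj12"
  using assms unfolding range_proj12_iff mult_act stabilizes_def by (auto simp: vec.zero)

lemma act_stable_proj14:
  assumes "invertible l" "stabilizes 2 l" "stabilizes 3 l" "\<tau> \<in> range proj14"
  shows "act l \<tau> \<in> range proj14"
  using assms unfolding range_proj14_iff mult_act stabilizes_def by (auto simp: vec.zero)

lemma act_stable_proj1:
  assumes l: "invertible l" "stabilizes 1 l" "stabilizes 2 l" "stabilizes 3 l" and \<tau>: "\<tau> \<in> range proj1"
  shows "act l \<tau> \<in> range proj1"
proof -
  have L: "stabilizes n l" for n
  proof -
    have "level n = {0}" if "n \<ge> 4"
    proof -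
      have "position k \<le> n" for k using that by (cases k) auto
      then show ?thesis by (auto simp: level_def vec_eq_iff)
    qed
    moreover have "n = 0 \<or> n = 1 \<or> n = 2 \<or> n = 3 \<or> n \<ge> 4" by linarith
    moreover have "stabilizes 0 l" by (simp add: stabilizes_def mem_level)
    ultimately show ?thesis using l by (auto simp: stabilizes_def vec.zero)
  qed
  have t: "triangular \<tau>" "\<forall>x. \<forall>y\<in>level 1. mult \<tau> x y = 0"
    using \<tau> unfolding range_proj1_iff by auto
  have "triangular (act l \<tau>)"
    using t(1) L unfolding triangular_def mult_act stabilizes_def by blast
  moreover have "mult (act l \<tau>) x y = 0" if "y \<in> level 1" for x y
    using t(2) L[of 1] that by (simp add: mult_act stabilizes_def vec.zero)
  ultimately show ?thesis unfolding range_proj1_iff by blast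
qed

text \<open>\<open>minor2\<close> and \<open>minor3\<close> are the lower right principal minors of
  sizes 2 and 3. They are stated over any commutative ring so that they also apply to matrices of
  polynomials.\<close>

definition minor2 :: "'a::comm_ring_1^idx^idx \<Rightarrow> 'a" where
  "minor2 g = g$E3$E3 * g$E4$E4 - g$E3$E4 * g$E4$E3"

definition minor3 :: "'a::comm_ring_1^idx^idx \<Rightarrow> 'a" where
  "minor3 g = g$E2$E2 * minor2 g - g$E2$E3 * (g$E3$E2 * g$E4$E4 - g$E3$E4 * g$E4$E2)
     + g$E2$E4 * (g$E3$E2 * g$E4$E3 - g$E3$E3 * g$E4$E2)"

text \<open>Elimination from the last column backwards: \<open>r, s, u\<close> clear the fourth
  column above the diagonal, \<open>p, q\<close> the third. Preserving \<open>level 2\<close> and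
  \<open>level 3\<close> needs no more, so the entry (1,2) may be zero; preserving
  \<open>level 1\<close> only requires resetting that entry, which is possible when the next pivot
  is nonzero.\<close>

lemma big_cell:
  assumes g: "invertible g" and m: "g$E4$E4 \<noteq> 0" "minor2 g \<noteq> 0"
  obtains x where "x (E1,E2,E1) = 0" "stabilizes 2 (matrix_inv (unip x) ** g)"
    "stabilizes 3 (matrix_inv (unip x) ** g)"
    "minor3 g \<noteq> 0 \<Longrightarrow> \<exists>a. \<forall>n\<in>{1,2,3}. stabilizes n (matrix_inv (unip (x((E1,E2,E1) := a))) ** g)"
proof -
  define r s u where rsu: "r = g$E1$E4 / g$E4$E4" "s = g$E2$E4 / g$E4$E4" "u = g$E3$E4 / g$E4$E4"
  define d where "d = g$E3$E3 - u * g$E4$E3"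
  \<comment> \<open>The pivots are \<open>g$E4$E4\<close>, \<open>d\<close> and \<open>e\<close>:
    \<open>minor2 g\<close> is \<open>d * g$E4$E4\<close>, and below \<open>minor3 g\<close> is
    \<open>e * d * g$E4$E4\<close>.\<close>
  have d: "d \<noteq> 0" using m by (auto simp: d_def minor2_def rsu field_simps)
  define p q where pq: "p = (g$E1$E3 - r * g$E4$E3) / d" "q = (g$E2$E3 - s * g$E4$E3) / d"
  define c where "c = g$E3$E2 - u * g$E4$E2"
  define e where "e = g$E2$E2 - q * c - s * g$E4$E2"
  define x :: "complex \<Rightarrow> struct" where "x a = (\<lambda>t. if t = (E1,E2,E1) then a else if t = (E1,E3,E1) then p
    else if t = (E2,E3,E1) then q else if t = (E1,E4,E1) then r else if t = (E2,E4,E1) then s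
    else if t = (E3,E4,E1) then u else 0)" for a
  have gE: "r * g$E4$E4 = g$E1$E4" "s * g$E4$E4 = g$E2$E4" "u * g$E4$E4 = g$E3$E4"
    using m by (simp_all add: rsu)
  have dE: "p * d = g$E1$E3 - r * g$E4$E3" "q * d = g$E2$E3 - s * g$E4$E3"
    using d by (simp_all add: pq)
  have col3: "p * d + r * g$E4$E3 = g$E1$E3" "q * d + s * g$E4$E3 = g$E2$E3" "d + u * g$E4$E3 = g$E3$E3"
    using dE by (simp_all add: d_def)
  let ?l = "\<lambda>a. matrix_inv (unip (x a)) ** g"
  have inv: "invertible (?l a)" for a
    by (intro invertible_mult invertible_matrix_inv invertible_unip g)
  have l: "?l a *v y = unip_inv (x a) (g *v y)" for a y
    by (simp add: matrix_vector_mul_assoc[symmetric] matrix_inv_unip)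
  have 4: "?l a *v y \<in> level 3" if "y \<in> level 3" for a y
  proof -
    have "g *v y = y$E4 *s vec4 (g$E1$E4) (g$E2$E4) (g$E3$E4) (g$E4$E4)"
      using that by (simp add: mem_level vec_eq_idx matrix_vector_mult_def sum_idx)
    then show ?thesis
      unfolding l by (simp add: unip_inv_def mem_level x_def gE[symmetric])
  qed
  have 3: "?l a *v y \<in> level 2" if "y \<in> level 2" for a y
  proof -
    have gy: "g *v y = y$E4 *s vec4 (g$E1$E4) (g$E2$E4) (g$E3$E4) (g$E4$E4)
        + y$E3 *s vec4 (p * d + r * g$E4$E3) (q * d + s * g$E4$E3) (d + u * g$E4$E3) (g$E4$E3)"
      using that by (simp add: mem_level vec_eq_idx matrix_vector_mult_def sum_idx col3)
    show ?thesis
      unfolding l gy by (simp add: unip_inv_def mem_level x_def gE[symmetric] algebra_simps)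
  qed
  have S: "stabilizes 2 (?l a)" "stabilizes 3 (?l a)" for a
    using 3 4 by (intro stabilizesI inv; blast)+
  have "\<forall>n\<in>{1,2,3}. stabilizes n (?l ((g$E1$E2 - p * c - r * g$E4$E2) / e))" if m3: "minor3 g \<noteq> 0"
  proof -
    have c2: "e + q * c + s * g$E4$E2 = g$E2$E2" "c + u * g$E4$E2 = g$E3$E2"
      by (simp_all add: e_def c_def)
    have "minor3 g = e * d * g$E4$E4"
      unfolding minor3_def minor2_def gE(2,3)[symmetric] col3(2,3)[symmetric] c2[symmetric]
      by (simp add: algebra_simps)
    then have e: "e \<noteq> 0" using m3 by auto
    define a where "a = (g$E1$E2 - p * c - r * g$E4$E2) / e"
    have col2: "a * e + p * c + r * g$E4$E2 = g$E1$E2" using e by (simp add: a_def)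
    have "?l a *v y \<in> level 1" if "y \<in> level 1" for y
    proof -
      have gy: "g *v y = y$E4 *s vec4 (g$E1$E4) (g$E2$E4) (g$E3$E4) (g$E4$E4)
        + y$E3 *s vec4 (p * d + r * g$E4$E3) (q * d + s * g$E4$E3) (d + u * g$E4$E3) (g$E4$E3)
        + y$E2 *s vec4 (a * e + p * c + r * g$E4$E2) (e + q * c + s * g$E4$E2) (c + u * g$E4$E2) (g$E4$E2)"
        using that by (simp add: mem_level vec_eq_idx matrix_vector_mult_def sum_idx col3 c2 col2)
      show ?thesis
        unfolding l gy by (simp add: unip_inv_def mem_level x_def gE[symmetric] algebra_simps)
    qed
    then show ?thesis
      unfolding a_def[symmetric] using S inv by (auto intro!: stabilizesI)
  qed
  moreover have "(x 0)((E1,E2,E1) := a) = x a" for a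
    by (auto simp: x_def)
  ultimately show ?thesis
    using that[of "x 0"] S by (auto simp: x_def)
qed

section \<open>Reaching all invertible matrices from the big cell along lines\<close>

lemma poly_det:
  fixes G :: "'a::comm_ring_1 poly^'n^'n"
  shows "poly (det G) t = det (\<chi> i j. poly (G$i$j) t)"
  by (simp add: det_def poly_sum poly_prod poly_mult)

lemma matrix_inv_axis:
  fixes g :: "complex^'n^'n"
  assumes "invertible g"
  shows "(matrix_inv g *v axis j 1) $ k = det (\<chi> i l. if l = k then axis j 1 $ i else g$i$l) / det g"
  using cramer[of g "matrix_inv g *v axis j 1" "axis j 1"] assms
  by (simp add: matrix_inv_vec invertible_det_nz)

text \<open>On the line from the identity to \<open>g\<close> the minors are nonzero at the
  identity, so they vanish at only finitely many points. Cramer's rule makes the transported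
  structure constants rational along the line, with powers of the determinant as
  denominators.\<close>

lemma act_big_cell_zclosure:
  assumes S: "\<And>g. invertible g \<Longrightarrow> g$E4$E4 \<noteq> 0 \<Longrightarrow> minor2 g \<noteq> 0 \<Longrightarrow> minor3 g \<noteq> 0 \<Longrightarrow> act g \<tau> \<in> S"
    and g: "invertible g"
  shows "act g \<tau> \<in> zclosure S"
proof -
  define G :: "complex poly^idx^idx" where "G = (\<chi> i j. [:mat 1 $ i $ j, g$i$j - mat 1 $ i $ j:])"
  define gt where "gt t = (\<chi> i j. poly (G$i$j) t)" for t
  have g1: "gt 1 = g" by (simp add: gt_def G_def vec_eq_iff)
  have g0: "gt 0 = mat 1" by (simp add: gt_def G_def vec_eq_iff)
  have det: "poly (det G) t = det (gt t)" for t by (simp add: poly_det gt_def)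
  have inv: "invertible (gt t) \<longleftrightarrow> poly (det G) t \<noteq> 0" for t
    by (simp add: det invertible_det_nz)
  define R where "R = G$E4$E4 * minor2 G * minor3 G"
  have R: "poly R t = gt t $E4$E4 * minor2 (gt t) * minor3 (gt t)" for t
    by (simp add: R_def minor2_def minor3_def gt_def)
  have "poly R 0 \<noteq> 0" unfolding R g0 by (simp add: minor2_def minor3_def mat_def)
  then have R0: "R \<noteq> 0" by auto
  have reg1: "(\<lambda>t. gt t $ i $ j) \<in> regular_off (det G)" for i j
    unfolding gt_def by (simp add: regular_off_poly)
  have reg2: "(\<lambda>t. (matrix_inv (gt t) *v axis j 1) $ k) \<in> regular_off (det G)" for j k
  proof (rule regular_off_cong[OF regular_off_divide[OF regular_off_poly]])
    fix t assume "poly (det G) t \<noteq> 0"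
    then have i: "invertible (gt t)" by (simp add: inv)
    have *: "(\<chi> i l. poly ((\<chi> i l. if l = k then axis j 1 $ i else G$i$l) $ i $ l) t)
      = (\<chi> i l. if l = k then axis j 1 $ i else gt t$i$l)"
      by (auto simp: vec_eq_iff gt_def axis_def)
    then show "poly (det (\<chi> i l. if l = k then axis j 1 $ i else G$i$l)) t / poly (det G) t
        = (matrix_inv (gt t) *v axis j 1) $ k"
      by (simp only: matrix_inv_axis[OF i] det[symmetric]) (simp only: poly_det *)
  qed
  have reg: "(\<lambda>t. act (gt t) \<tau> m) \<in> regular_off (det G)" for m
  proof -
    obtain i j k where m: "m = (i, j, k)" by (cases m)
    show ?thesis
      unfolding m act_nth mult_nth
      by (intro regular_off_sum regular_off_mult reg1 reg2 regular_off_const)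
  qed
  have "act (gt 1) \<tau> \<in> zclosure S"
  proof (rule rational_curve_zclosure[OF reg R0])
    show "poly (det G) 1 \<noteq> 0" using inv[of 1] g by (simp add: g1)
    show "act (gt t) \<tau> \<in> S" if "poly (det G) t \<noteq> 0" "poly R t \<noteq> 0" for t
      using S[of "gt t"] that inv by (simp add: R)
  qed
  then show ?thesis by (simp add: g1)
qed

text \<open>The unipotent entries and the structure occupy disjoint coordinates, since no product in
  a family has an \<open>e1\<close>-component; hence both fit into one parameter.\<close>

definition combine :: "struct \<Rightarrow> struct \<Rightarrow> struct" where
  "combine x \<sigma> = (\<lambda>(i, j, k). if k = E1 then x (i, j, k) else \<sigma> (i, j, k))"

lemma unip_combine: "unip (combine x \<sigma>) = unip x" "x (E1,E2,E1) = 0 \<Longrightarrow> unip (drop12 (combine x \<sigma>)) = unip x"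
  by (auto simp: unip_def combine_def drop12_def vec_eq_iff)

lemma proj_combine: "proj1 (combine x \<sigma>) = proj1 \<sigma>" "proj12 (combine x \<sigma>) = proj12 \<sigma>"
  "proj14 (combine x \<sigma>) = proj14 \<sigma>"
  by (auto simp: proj1_def proj12_def proj14_def mask_def combine_def)

text \<open>For \<open>g\<close> in the big cell, \<open>g\<close> is \<open>unip x\<close> times a
  stabilizer of the flag. The second factor moves \<tau> within its family, so
  \<open>act g \<tau>\<close> is a value of the parametrization.\<close>

lemma GL_saturation_subset_zclosure_param:
  "GL_saturation (range proj1) \<subseteq> zclosure (range param1)"
  "GL_saturation (range proj12) \<subseteq> zclosure (range param12)"
  "GL_saturation (range proj14) \<subseteq> zclosure (range param14)"
proof -
  have split: "act g \<tau> = act (unip x) (act (matrix_inv (unip x) ** g) \<tau>)" if "invertible g" for g \<tau> x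
    using that by (simp add: act_act[symmetric] act_matrix_inv invertible_unip invertible_matrix_inv)
  have inv: "invertible (matrix_inv (unip x) ** g)" if "invertible g" for x and g :: "complex^idx^idx"
    using that by (intro invertible_mult invertible_matrix_inv invertible_unip)
  have "act g \<tau> \<in> range param1"
    if g: "invertible g" "g$E4$E4 \<noteq> 0" "minor2 g \<noteq> 0" "minor3 g \<noteq> 0" and "\<tau> \<in> range proj1" for g \<tau>
  proof -
    obtain x where "\<forall>n\<in>{1,2,3}. stabilizes n (matrix_inv (unip x) ** g)"
      by (rule big_cell[OF g(1-3)]) (use g(4) in blast)
    then have "act (matrix_inv (unip x) ** g) \<tau> \<in> range proj1"
      using act_stable_proj1 inv that by blast
    then obtain \<sigma> where "act (matrix_inv (unip x) ** g) \<tau> = proj1 \<sigma>" by blast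
    then have "act g \<tau> = param1 (combine x \<sigma>)"
      using split[OF that(1), of \<tau> x] by (simp add: param1_def unip_combine proj_combine)
    then show ?thesis by blast
  qed
  then show "GL_saturation (range proj1) \<subseteq> zclosure (range param1)"
    unfolding GL_saturation_iff subset_iff using act_big_cell_zclosure by blast
  have "act g \<tau> \<in> range param12"
    if g: "invertible g" "g$E4$E4 \<noteq> 0" "minor2 g \<noteq> 0" and "\<tau> \<in> range proj12" for g \<tau>
  proof -
    obtain x where x: "x (E1,E2,E1) = 0" "stabilizes 2 (matrix_inv (unip x) ** g)"
      "stabilizes 3 (matrix_inv (unip x) ** g)"
      by (rule big_cell[OF g]) blast
    then have "act (matrix_inv (unip x) ** g) \<tau> \<in> range proj12"
      using act_stable_proj12 inv that by blast
    then obtain \<sigma> where "act (matrix_inv (unip x) ** g) \<tau> = proj12 \<sigma>" by blast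
    then have "act g \<tau> = param12 (combine x \<sigma>)"
      using split[OF that(1), of \<tau> x] x by (simp add: param12_def unip_combine proj_combine)
    then show ?thesis by blast
  qed
  then show "GL_saturation (range proj12) \<subseteq> zclosure (range param12)"
    unfolding GL_saturation_iff subset_iff using act_big_cell_zclosure by blast
  have "act g \<tau> \<in> range param14"
    if g: "invertible g" "g$E4$E4 \<noteq> 0" "minor2 g \<noteq> 0" and "\<tau> \<in> range proj14" for g \<tau>
  proof -
    obtain x where x: "x (E1,E2,E1) = 0" "stabilizes 2 (matrix_inv (unip x) ** g)"
      "stabilizes 3 (matrix_inv (unip x) ** g)"
      by (rule big_cell[OF g]) blast
    then have "act (matrix_inv (unip x) ** g) \<tau> \<in> range proj14"
      using act_stable_proj14 inv that by blast
    then obtain \<sigma> where "act (matrix_inv (unip x) ** g) \<tau> = proj14 \<sigma>" by blast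
    then have "act g \<tau> = param14 (combine x \<sigma>)"
      using split[OF that(1), of \<tau> x] x by (simp add: param14_def unip_combine proj_combine)
    then show ?thesis by blast
  qed
  then show "GL_saturation (range proj14) \<subseteq> zclosure (range param14)"
    unfolding GL_saturation_iff subset_iff using act_big_cell_zclosure by blast
qed

lemma range_param_subset:
  "range param1 \<subseteq> GL_saturation (range proj1)" "range param12 \<subseteq> GL_saturation (range proj12)"
  "range param14 \<subseteq> GL_saturation (range proj14)"
  unfolding GL_saturation_iff subset_iff param1_def param12_def param14_def
  using invertible_unip by blast+

section \<open>The generic members of the families\<close>

lemma proj_idem: "proj1 (proj1 x) = proj1 x" "proj12 (proj12 x) = proj12 x" "proj14 (proj14 x) = proj14 x"
  by (auto simp: proj1_def proj12_def proj14_def mask_def fun_eq_iff)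

lemma mem_range_proj: "\<tau> \<in> range proj1 \<longleftrightarrow> proj1 \<tau> = \<tau>" "\<tau> \<in> range proj12 \<longleftrightarrow> proj12 \<tau> = \<tau>"
  "\<tau> \<in> range proj14 \<longleftrightarrow> proj14 \<tau> = \<tau>"
  by (auto simp: proj_idem intro: range_eqI[OF sym])

lemma proj_standard: "proj1 L2 = L2" "proj12 (M12 \<alpha>) = M12 \<alpha>" "proj14 (M14 \<alpha>) = M14 \<alpha>"
  by (auto simp: proj1_def proj12_def proj14_def mask_def L2_def M12_def M14_def fun_eq_iff)

lemma orbit_basisI:
  fixes v :: "idx \<Rightarrow> vec"
  assumes ker: "\<And>a b c d. a *s v E1 + b *s v E2 + c *s v E3 + d *s v E4 = 0 \<Longrightarrow> a = 0 \<and> b = 0 \<and> c = 0 \<and> d = 0"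
    and eq: "\<And>i j. mult \<tau> (v i) (v j) = \<nu> (i,j,E1) *s v E1 + \<nu> (i,j,E2) *s v E2
      + \<nu> (i,j,E3) *s v E3 + \<nu> (i,j,E4) *s v E4"
  shows "\<tau> \<in> orbit \<nu>"
proof -
  define P where "P = (\<chi> i j. v j $ i)"
  have P: "P *v x = x$E1 *s v E1 + x$E2 *s v E2 + x$E3 *s v E3 + x$E4 *s v E4" for x
    unfolding P_def by (rule matrix_of_columns)
  have Pa: "P *v axis j 1 = v j" for j unfolding P_def by (rule matrix_of_columns)
  have inv: "invertible P"
  proof (rule invertibleI_ker)
    fix x assume "P *v x = 0"
    then have "x$E1 = 0 \<and> x$E2 = 0 \<and> x$E3 = 0 \<and> x$E4 = 0" unfolding P by (rule ker)
    then show "x = 0" by (simp add: vec_eq_idx)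
  qed
  have "\<tau> = act P \<nu>"
    by (intro act_eqI_axis inv) (simp only: Pa, simp only: eq P vec_lambda_beta)
  then show ?thesis using inv by (auto simp: orbit_def)
qed

lemma orbit_L2I:
  assumes \<tau>: "proj1 \<tau> = \<tau>" and ne: "\<tau> (E1,E1,E2) \<noteq> 0" "\<tau> (E2,E1,E3) \<noteq> 0" "\<tau> (E3,E1,E4) \<noteq> 0"
  shows "\<tau> \<in> orbit L2"
proof -
  define a2 a3 a4 c3 c4 g where d: "a2 = \<tau> (E1,E1,E2)" "a3 = \<tau> (E1,E1,E3)" "a4 = \<tau> (E1,E1,E4)"
    "c3 = \<tau> (E2,E1,E3)" "c4 = \<tau> (E2,E1,E4)" "g = \<tau> (E3,E1,E4)"
  \<comment> \<open>The left powers of \<open>e1\<close>; the three nonvanishing coefficients make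
    them a basis.\<close>
  define v where "v j = (case j of E1 \<Rightarrow> vec4 1 0 0 0 | E2 \<Rightarrow> vec4 0 a2 a3 a4
    | E3 \<Rightarrow> vec4 0 0 (a2 * c3) (a2 * c4 + a3 * g) | E4 \<Rightarrow> vec4 0 0 0 (a2 * c3 * g))" for j
  note M = mult_proj1[of \<tau>, unfolded \<tau> d[symmetric]]
  show ?thesis
  proof (rule orbit_basisI[of v])
    show "mult \<tau> (v i) (v j) = L2 (i,j,E1) *s v E1 + L2 (i,j,E2) *s v E2
      + L2 (i,j,E3) *s v E3 + L2 (i,j,E4) *s v E4" for i j
      unfolding M by (cases i; cases j; simp add: v_def vec_eq_idx L2_def)
  qed (use ne[folded d] in \<open>auto simp: v_def vec_eq_idx\<close>)
qed

section \<open>Normal forms of generic members of the last two families\<close>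

definition form12 :: "struct \<Rightarrow> complex \<Rightarrow> complex \<Rightarrow> complex \<Rightarrow> complex \<Rightarrow> complex \<Rightarrow> complex \<Rightarrow> complex" where
  "form12 \<tau> p1 p2 p3 q1 q2 q3 =
     p1 * q1 * \<tau> (E1,E1,E4) + p1 * q2 * \<tau> (E1,E2,E4) + p1 * q3 * \<tau> (E1,E3,E4) +
     p2 * q1 * \<tau> (E2,E1,E4) + p2 * q2 * \<tau> (E2,E2,E4) + p2 * q3 * \<tau> (E2,E3,E4) +
     p3 * q1 * \<tau> (E3,E1,E4) + p3 * q2 * \<tau> (E3,E2,E4) + p3 * q3 * \<tau> (E3,E3,E4)"

definition form14_3 :: "struct \<Rightarrow> complex \<Rightarrow> complex \<Rightarrow> complex \<Rightarrow> complex \<Rightarrow> complex" where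
  "form14_3 \<tau> p1 p2 q1 q2 =
     p1 * q1 * \<tau> (E1,E1,E3) + p1 * q2 * \<tau> (E1,E2,E3) + p2 * q1 * \<tau> (E2,E1,E3) + p2 * q2 * \<tau> (E2,E2,E3)"

definition form14_4 :: "struct \<Rightarrow> complex \<Rightarrow> complex \<Rightarrow> complex \<Rightarrow> complex \<Rightarrow> complex" where
  "form14_4 \<tau> p1 p2 q1 q2 =
     p1 * q1 * \<tau> (E1,E1,E4) + p1 * q2 * \<tau> (E1,E2,E4) + p2 * q1 * \<tau> (E2,E1,E4) + p2 * q2 * \<tau> (E2,E2,E4)"

definition form14_l :: "struct \<Rightarrow> complex \<Rightarrow> complex \<Rightarrow> complex" where
  "form14_l \<tau> q1 q2 =
     q1 * \<tau> (E3,E1,E4) + q2 * \<tau> (E3,E2,E4)"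

lemmas form14_defs = form14_3_def form14_4_def form14_l_def

text \<open>The new basis is \<open>x\<close>, \<open>y\<close>, \<open>xy\<close>,
  \<open>s e4\<close>. The \<open>e4\<close>-part \<open>w\<close> of the third vector is dictated
  by \<open>xy\<close>, and the listed equations are the remaining entries of the multiplication
  table.\<close>

lemma orbit_M12I:
  fixes \<tau> :: struct and x1 x2 x3 y1 y2 y3 z s \<alpha> :: complex
  defines "B \<equiv> form12 \<tau>"
  assumes \<tau>: "proj12 \<tau> = \<tau>"
    and z: "z = (x1 * y2 - x2 * y1) * \<tau> (E1,E2,E3)" and ne: "z \<noteq> 0" "s \<noteq> 0"
    and e: "B y1 y2 y3 x1 x2 x3 = - B x1 x2 x3 y1 y2 y3" "B x1 x2 x3 x1 x2 x3 = \<alpha> * s"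
      "B y1 y2 y3 y1 y2 y3 = s" "B x1 x2 x3 0 0 z = s" "B 0 0 z x1 x2 x3 = - s"
      "B y1 y2 y3 0 0 z = 0" "B 0 0 z y1 y2 y3 = 0" "B 0 0 z 0 0 z = s"
  shows "\<tau> \<in> orbit (M12 \<alpha>)"
proof -
  define w where "w = B x1 x2 x3 y1 y2 y3"
  define v where "v j = (case j of E1 \<Rightarrow> vec4 x1 x2 x3 0 | E2 \<Rightarrow> vec4 y1 y2 y3 0
    | E3 \<Rightarrow> vec4 0 0 z w | E4 \<Rightarrow> vec4 0 0 0 s)" for j
  have M: "mult \<tau> x y = vec4 0 0 ((x$E1 * y$E2 - x$E2 * y$E1) * \<tau> (E1,E2,E3))
      (B (x$E1) (x$E2) (x$E3) (y$E1) (y$E2) (y$E3))" for x y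
    using mult_proj12[of \<tau> x y] unfolding \<tau> B_def form12_def by simp
  have B0: "B 0 0 0 a b c = 0" "B a b c 0 0 0 = 0" for a b c by (simp_all add: B_def form12_def)
  have z': "(y1 * x2 - y2 * x1) * \<tau> (E1,E2,E3) = - z" by (simp add: z algebra_simps)
  show ?thesis
  proof (rule orbit_basisI[of v])
    show "mult \<tau> (v i) (v j) = M12 \<alpha> (i,j,E1) *s v E1 + M12 \<alpha> (i,j,E2) *s v E2
      + M12 \<alpha> (i,j,E3) *s v E3 + M12 \<alpha> (i,j,E4) *s v E4" for i j
      unfolding M
      by (cases i; cases j; simp add: v_def vec_eq_idx M12_def e B0 z[symmetric] z' w_def)
  next
    fix a b c d assume "a *s v E1 + b *s v E2 + c *s v E3 + d *s v E4 = 0"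
    then have 1: "a * x1 + b * y1 = 0" "a * x2 + b * y2 = 0" "a * x3 + b * y3 + c * z = 0" "c * w + d * s = 0"
      by (simp_all add: v_def vec_eq_idx)
    have "a * (x1 * y2 - x2 * y1) = 0" "b * (x1 * y2 - x2 * y1) = 0" using 1(1,2) by algebra+
    then have "a = 0" "b = 0" using z ne by auto
    then show "a = 0 \<and> b = 0 \<and> c = 0 \<and> d = 0" using 1 ne by auto
  qed
qed

lemma orbit_M14I:
  fixes \<tau> :: struct and x1 x2 x3 y1 y2 y3 z w s \<alpha> :: complex
  defines "B \<equiv> form14_3 \<tau>"
  defines "C \<equiv> form14_4 \<tau>"
  defines "l \<equiv> form14_l \<tau>"
  assumes \<tau>: "proj14 \<tau> = \<tau>" and ne: "z \<noteq> 0" "s \<noteq> 0" "x1 * y2 - x2 * y1 \<noteq> 0"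
    and e: "B x1 x2 x1 x2 = z" "B x1 x2 y1 y2 = z" "B y1 y2 x1 x2 = 0" "B y1 y2 y1 y2 = \<alpha> * z"
      "C x1 x2 x1 x2 = w" "C x1 x2 y1 y2 + x3 * l y1 y2 = w" "C y1 y2 x1 x2 = s"
      "C y1 y2 y1 y2 + y3 * l y1 y2 = \<alpha> * w" "l x1 x2 = 0" "z * l y1 y2 = s"
  shows "\<tau> \<in> orbit (M14 \<alpha>)"
proof -
  define v where "v j = (case j of E1 \<Rightarrow> vec4 x1 x2 x3 0 | E2 \<Rightarrow> vec4 y1 y2 y3 0
    | E3 \<Rightarrow> vec4 0 0 z w | E4 \<Rightarrow> vec4 0 0 0 s)" for j
  have M: "mult \<tau> x y = vec4 0 0 (B (x$E1) (x$E2) (y$E1) (y$E2))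
      (C (x$E1) (x$E2) (y$E1) (y$E2) + x$E3 * l (y$E1) (y$E2))" for x y
    using mult_proj14[of \<tau> x y] unfolding \<tau> B_def C_def l_def form14_defs by (simp add: algebra_simps)
  have B0: "B 0 0 a b = 0" "B a b 0 0 = 0" "C 0 0 a b = 0" "C a b 0 0 = 0" "l 0 0 = 0" for a b
    by (simp_all add: B_def C_def l_def form14_defs)
  show ?thesis
  proof (rule orbit_basisI[of v])
    show "mult \<tau> (v i) (v j) = M14 \<alpha> (i,j,E1) *s v E1 + M14 \<alpha> (i,j,E2) *s v E2
      + M14 \<alpha> (i,j,E3) *s v E3 + M14 \<alpha> (i,j,E4) *s v E4" for i j
      unfolding M
      by (cases i; cases j; simp add: v_def vec_eq_idx M14_def e B0)
  next
    fix a b c d assume "a *s v E1 + b *s v E2 + c *s v E3 + d *s v E4 = 0"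
    then have 1: "a * x1 + b * y1 = 0" "a * x2 + b * y2 = 0" "a * x3 + b * y3 + c * z = 0" "c * w + d * s = 0"
      by (simp_all add: v_def vec_eq_idx)
    have "a * (x1 * y2 - x2 * y1) = 0" "b * (x1 * y2 - x2 * y1) = 0" using 1(1,2) by algebra+
    then have "a = 0" "b = 0" using ne by auto
    then show "a = 0 \<and> b = 0 \<and> c = 0 \<and> d = 0" using 1 ne by auto
  qed
qed

text \<open>The vector \<open>y\<close> spans the common kernel of \<open>C(\<cdot>, e\<^sub>3)\<close> and \<open>C(e\<^sub>3, \<cdot>)\<close>, where \<open>C\<close>
  is the \<open>e\<^sub>4\<close>-coefficient of the product, and \<open>x\<close> is orthogonal to \<open>y\<close> and \<open>e\<^sub>3\<close> for the
  symmetric part of \<open>C\<close>.\<close>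

definition M12_y :: "struct \<Rightarrow> complex \<times> complex \<times> complex" where
  "M12_y \<tau> = (\<tau> (E2,E3,E4) * \<tau> (E3,E3,E4) - \<tau> (E3,E3,E4) * \<tau> (E3,E2,E4),
     \<tau> (E3,E3,E4) * \<tau> (E3,E1,E4) - \<tau> (E1,E3,E4) * \<tau> (E3,E3,E4),
     \<tau> (E1,E3,E4) * \<tau> (E3,E2,E4) - \<tau> (E2,E3,E4) * \<tau> (E3,E1,E4))"

text \<open>\<open>y\<close> is the cross product of the coefficient vectors of the two forms it
  annihilates. Likewise \<open>x\<close> is the cross product of \<open>K\<close> and
  \<open>S\<close>, the symmetrized pairings with \<open>e3\<close> and with
  \<open>y\<close>.\<close>

definition M12_x :: "struct \<Rightarrow> complex \<times> complex \<times> complex" where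
  "M12_x \<tau> = (case M12_y \<tau> of (y1, y2, y3) \<Rightarrow>
     let S = (\<lambda>i. (\<tau> (i,E1,E4) + \<tau> (E1,i,E4)) * y1 + (\<tau> (i,E2,E4) + \<tau> (E2,i,E4)) * y2
           + (\<tau> (i,E3,E4) + \<tau> (E3,i,E4)) * y3);
       K = (\<lambda>i. \<tau> (i,E3,E4) + \<tau> (E3,i,E4))
     in (K E2 * S E3 - K E3 * S E2, K E3 * S E1 - K E1 * S E3, K E1 * S E2 - K E2 * S E1))"

definition M12_q :: "struct \<Rightarrow> complex" where
  "M12_q \<tau> = (case M12_y \<tau> of (y1, y2, y3) \<Rightarrow>
     y1 * y1 * \<tau> (E1,E1,E4) + y1 * y2 * \<tau> (E1,E2,E4) + y1 * y3 * \<tau> (E1,E3,E4) +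
     y2 * y1 * \<tau> (E2,E1,E4) + y2 * y2 * \<tau> (E2,E2,E4) + y2 * y3 * \<tau> (E2,E3,E4) +
     y3 * y1 * \<tau> (E3,E1,E4) + y3 * y2 * \<tau> (E3,E2,E4) + y3 * y3 * \<tau> (E3,E3,E4))"

definition M12_D :: "struct \<Rightarrow> complex" where
  "M12_D \<tau> = fst (M12_x \<tau>) * fst (snd (M12_y \<tau>)) - fst (snd (M12_x \<tau>)) * fst (M12_y \<tau>)"

definition M12_R :: "struct \<Rightarrow> complex" where
  "M12_R \<tau> = (case M12_x \<tau> of (x1, x2, x3) \<Rightarrow>
     x1 * \<tau> (E1,E3,E4) + x2 * \<tau> (E2,E3,E4) + x3 * \<tau> (E3,E3,E4))"

text \<open>Apart from the coefficient of \<open>e3\<close> in \<open>e1e2\<close>, the factors are: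
  the determinant of \<open>x\<close> and \<open>y\<close> in the first two coordinates,
  \<open>C(y,y)\<close>, \<open>C(e3,e3)\<close> and \<open>C(x,e3)\<close>. One product is formed
  so that \<open>line_zclosure\<close> applies.\<close>

definition M12_generic :: "struct \<Rightarrow> complex" where
  "M12_generic \<tau> = \<tau> (E1,E2,E3) * M12_D \<tau> * M12_q \<tau> * \<tau> (E3,E3,E4) * M12_R \<tau>"

lemma poly_fun_M12_generic: "M12_generic \<in> poly_fun"
  unfolding M12_generic_def M12_D_def M12_q_def M12_R_def M12_x_def M12_y_def Let_def prod.case fst_conv snd_conv
  by (intro poly_fun_intros)

lemma M12_generic_M12: "M12_generic (M12 0) \<noteq> 0"
  by (simp add: M12_generic_def M12_D_def M12_q_def M12_R_def M12_x_def M12_y_def Let_def M12_def)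

lemma generic_orbit_M12:
  assumes \<tau>: "proj12 \<tau> = \<tau>" and G: "M12_generic \<tau> \<noteq> 0"
  shows "\<exists>\<alpha>. \<tau> \<in> orbit (M12 \<alpha>)"
proof -
  define B where "B = form12 \<tau>"
  obtain y1 y2 y3 where y: "M12_y \<tau> = (y1, y2, y3)" by (cases "M12_y \<tau>")
  obtain x1 x2 x3 where x: "M12_x \<tau> = (x1, x2, x3)" by (cases "M12_x \<tau>")
  define D q R b c where d: "D = M12_D \<tau>" "q = M12_q \<tau>" "R = M12_R \<tau>" "b = \<tau> (E1,E2,E3)" "c = \<tau> (E3,E3,E4)"
  have ne: "D \<noteq> 0" "q \<noteq> 0" "R \<noteq> 0" "b \<noteq> 0" "c \<noteq> 0"
    using G by (auto simp: M12_generic_def d)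
  have Dxy: "D = x1 * y2 - x2 * y1" by (simp add: d M12_D_def x y)
  have q: "B y1 y2 y3 y1 y2 y3 = q" by (simp add: d M12_q_def y B_def form12_def)
  have R: "B x1 x2 x3 0 0 1 = R" by (simp add: d M12_R_def x B_def form12_def)
  have c: "B 0 0 1 0 0 1 = c" by (simp add: d B_def form12_def)
  have k: "B y1 y2 y3 0 0 1 = 0" "B 0 0 1 y1 y2 y3 = 0"
  proof -
    have ys: "y1 = \<tau> (E2,E3,E4) * \<tau> (E3,E3,E4) - \<tau> (E3,E3,E4) * \<tau> (E3,E2,E4)"
      "y2 = \<tau> (E3,E3,E4) * \<tau> (E3,E1,E4) - \<tau> (E1,E3,E4) * \<tau> (E3,E3,E4)"
      "y3 = \<tau> (E1,E3,E4) * \<tau> (E3,E2,E4) - \<tau> (E2,E3,E4) * \<tau> (E3,E1,E4)"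
      using y unfolding M12_y_def by simp_all
    show "B y1 y2 y3 0 0 1 = 0" "B 0 0 1 y1 y2 y3 = 0"
      unfolding B_def form12_def ys by (simp_all add: algebra_simps)
  qed
  define S where "S = (\<lambda>i. (\<tau> (i,E1,E4) + \<tau> (E1,i,E4)) * y1 + (\<tau> (i,E2,E4) + \<tau> (E2,i,E4)) * y2
           + (\<tau> (i,E3,E4) + \<tau> (E3,i,E4)) * y3)"
  define K where "K = (\<lambda>i. \<tau> (i,E3,E4) + \<tau> (E3,i,E4))"
  have xs: "x1 = K E2 * S E3 - K E3 * S E2" "x2 = K E3 * S E1 - K E1 * S E3" "x3 = K E1 * S E2 - K E2 * S E1"
    using x unfolding M12_x_def y by (auto simp: Let_def S_def K_def)
  have "x1 * S E1 + x2 * S E2 + x3 * S E3 = 0" "x1 * K E1 + x2 * K E2 + x3 * K E3 = 0"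
    by (simp_all add: xs algebra_simps)
  then have o: "B y1 y2 y3 x1 x2 x3 = - B x1 x2 x3 y1 y2 y3" "B 0 0 1 x1 x2 x3 = - R"
    unfolding R[symmetric] S_def K_def B_def form12_def by (simp_all add: eq_neg_iff_add_eq_0 algebra_simps)
  \<comment> \<open>With basis \<open>lam x\<close>, \<open>eta y\<close> and
    \<open>z = lam eta D b\<close>, the table requires \<open>lam z R = z z c = eta eta q\<close>.
    The first equation determines \<open>eta\<close>, the second \<open>lam\<close> up to sign,
    hence the square root; what remains of \<open>C(x,x)\<close> is the parameter \<alpha>.\<close>
  define lam where "lam = csqrt (q / (b\<^sup>2 * D\<^sup>2 * c))"
  define eta where "eta = R / (b * D * c)"
  have lam: "lam * lam * (b * b * D * D * c) = q"
    using ne power2_csqrt[of "q / (b\<^sup>2 * D\<^sup>2 * c)"] by (simp add: lam_def power2_eq_square field_simps)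
  have eta: "eta * (b * D * c) = R" using ne by (simp add: eta_def)
  have ne': "lam \<noteq> 0" "eta \<noteq> 0" using lam eta ne by auto
  define z s where zs: "z = lam * eta * D * b" "s = eta * eta * q"
  have sc: "B (a * p1) (a * p2) (a * p3) (a' * q1) (a' * q2) (a' * q3) = a * a' * B p1 p2 p3 q1 q2 q3"
    for a a' p1 p2 p3 q1 q2 q3 by (simp add: B_def form12_def algebra_simps)
  have sc1: "B (a * p1) (a * p2) (a * p3) 0 0 a' = a * a' * B p1 p2 p3 0 0 1"
    "B 0 0 a' (a * p1) (a * p2) (a * p3) = a * a' * B 0 0 1 p1 p2 p3"
    "B 0 0 a 0 0 a' = a * a' * B 0 0 1 0 0 1" for a a' p1 p2 p3
    by (simp_all add: B_def form12_def algebra_simps)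
  have s: "lam * z * R = s" "z * z * c = s"
    unfolding zs lam[symmetric] eta[symmetric] by (simp_all add: algebra_simps)
  have "\<tau> \<in> orbit (M12 (lam * lam * B x1 x2 x3 x1 x2 x3 / s))"
  proof (rule orbit_M12I[where z = z and s = s and ?x1.0 = "lam * x1" and ?x2.0 = "lam * x2" and
      ?x3.0 = "lam * x3" and ?y1.0 = "eta * y1" and ?y2.0 = "eta * y2" and ?y3.0 = "eta * y3",
      OF \<tau>, folded B_def])
    show "z = (lam * x1 * (eta * y2) - lam * x2 * (eta * y1)) * \<tau> (E1, E2, E3)"
      by (simp add: zs Dxy d algebra_simps)
    show "z \<noteq> 0" and s0: "s \<noteq> 0" using ne ne' by (simp_all add: zs)
    show "B (eta * y1) (eta * y2) (eta * y3) (lam * x1) (lam * x2) (lam * x3)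
        = - B (lam * x1) (lam * x2) (lam * x3) (eta * y1) (eta * y2) (eta * y3)"
      unfolding sc o(1) by simp
    show "B (lam * x1) (lam * x2) (lam * x3) (lam * x1) (lam * x2) (lam * x3)
        = lam * lam * B x1 x2 x3 x1 x2 x3 / s * s"
      unfolding sc using s0 by simp
    show "B (eta * y1) (eta * y2) (eta * y3) (eta * y1) (eta * y2) (eta * y3) = s"
      unfolding sc q zs ..
    show "B (lam * x1) (lam * x2) (lam * x3) 0 0 z = s" "B 0 0 z (lam * x1) (lam * x2) (lam * x3) = - s"
      unfolding sc1 R o(2) s(1)[symmetric] by simp_all
    show "B (eta * y1) (eta * y2) (eta * y3) 0 0 z = 0" "B 0 0 z (eta * y1) (eta * y2) (eta * y3) = 0"
      unfolding sc1 k by simp_all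
    show "B 0 0 z 0 0 z = s" unfolding sc1(3)[of z z] c by (rule s(2))
  qed
  then show ?thesis by blast
qed

text \<open>This is \<open>B(x,x) * B(x,y) * C(y,x)\<close> expanded, where \<open>B\<close> and
  \<open>C\<close> are the \<open>e3\<close>- and \<open>e4\<close>-forms on the first two
  coordinates, \<open>x = (l2, -l1)\<close> is killed by left multiplication with \<open>e3\<close>,
  and \<open>y = (b2, -b1)\<close> satisfies \<open>B(y,x) = 0\<close>.\<close>

definition M14_generic :: "struct \<Rightarrow> complex" where
  "M14_generic \<tau> = (let l1 = \<tau> (E3,E1,E4); l2 = \<tau> (E3,E2,E4);
     b1 = \<tau> (E1,E1,E3) * l2 - \<tau> (E1,E2,E3) * l1; b2 = \<tau> (E2,E1,E3) * l2 - \<tau> (E2,E2,E3) * l1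
   in (l2 * b1 - l1 * b2) *
      (l2 * (b2 * \<tau> (E1,E1,E3) - b1 * \<tau> (E1,E2,E3)) - l1 * (b2 * \<tau> (E2,E1,E3) - b1 * \<tau> (E2,E2,E3))) *
      (b2 * (l2 * \<tau> (E1,E1,E4) - l1 * \<tau> (E1,E2,E4)) - b1 * (l2 * \<tau> (E2,E1,E4) - l1 * \<tau> (E2,E2,E4))))"

lemma poly_fun_M14_generic: "M14_generic \<in> poly_fun"
  unfolding M14_generic_def Let_def by (intro poly_fun_intros)

lemma M14_generic_M14: "M14_generic (M14 0) \<noteq> 0"
  by (simp add: M14_generic_def Let_def M14_def)

lemma generic_orbit_M14:
  assumes \<tau>: "proj14 \<tau> = \<tau>" and G: "M14_generic \<tau> \<noteq> 0"
  shows "\<exists>\<alpha>. \<tau> \<in> orbit (M14 \<alpha>)"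
proof -
  define B where "B = form14_3 \<tau>"
  define C where "C = form14_4 \<tau>"
  define l where "l = form14_l \<tau>"
  define x1 x2 where x: "x1 = \<tau> (E3,E2,E4)" "x2 = - \<tau> (E3,E1,E4)"
  define y1 y2 where y: "y1 = B 0 1 x1 x2" "y2 = - B 1 0 x1 x2"
  define p t m where d: "p = B x1 x2 x1 x2" "t = B x1 x2 y1 y2" "m = C y1 y2 x1 x2"
  have "M14_generic \<tau> = p * t * m"
    unfolding M14_generic_def Let_def d x y B_def C_def form14_defs by (simp add: algebra_simps)
  then have ne: "p \<noteq> 0" "t \<noteq> 0" "m \<noteq> 0" using G by auto
  have lx: "l x1 x2 = 0" by (simp add: l_def form14_defs x)
  have ly: "l y1 y2 = - p" by (simp add: l_def x y d B_def form14_defs algebra_simps)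
  have det: "x1 * y2 - x2 * y1 = - p" by (simp add: y d B_def form14_defs algebra_simps)
  have Byx: "B y1 y2 x1 x2 = 0" by (simp add: y B_def form14_defs algebra_simps)
  \<comment> \<open>Scaling \<open>x\<close> by \<open>lam\<close> and \<open>y\<close> by
    \<open>eta\<close> must satisfy \<open>B(x,x) = B(x,y)\<close>, giving
    \<open>eta t = lam p\<close>, and \<open>z l(y) = C(y,x)\<close>, giving
    \<open>lam p p = - m\<close>.\<close>
  define lam where "lam = - m / (p * p)"
  define eta where "eta = lam * p / t"
  have ne': "lam \<noteq> 0" "eta \<noteq> 0" using ne by (simp_all add: lam_def eta_def)
  have lam: "lam * (p * p) = - m" using ne by (simp add: lam_def)
  have eta: "eta * t = lam * p" using ne by (simp add: eta_def)
  define z where "z = lam * lam * p"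
  define s where "s = lam * eta * m"
  define w where "w = lam * lam * C x1 x2 x1 x2"
  define \<alpha> where "\<alpha> = eta * eta * B y1 y2 y1 y2 / z"
  \<comment> \<open>Right multiplication by \<open>y\<close> does not kill \<open>e3\<close>, so the
    \<open>e3\<close>-components of the two generators can be adjusted to meet the two
    \<open>e4\<close>-equations involving it.\<close>
  define x3 where "x3 = (w - lam * eta * C x1 x2 y1 y2) / (- eta * p)"
  define y3 where "y3 = (\<alpha> * w - eta * eta * C y1 y2 y1 y2) / (- eta * p)"
  have sc: "B (a * p1) (a * p2) (a' * q1) (a' * q2) = a * a' * B p1 p2 q1 q2"
    "C (a * p1) (a * p2) (a' * q1) (a' * q2) = a * a' * C p1 p2 q1 q2"
    "l (a * p1) (a * p2) = a * l p1 p2"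
    for a a' p1 p2 q1 q2 by (simp_all add: B_def C_def l_def form14_defs algebra_simps)
  have z: "z \<noteq> 0" using ne ne' by (simp add: z_def)
  have "\<tau> \<in> orbit (M14 \<alpha>)"
  proof (rule orbit_M14I[where z = z and w = w and s = s and ?x1.0 = "lam * x1" and ?x2.0 = "lam * x2" and
      ?x3.0 = x3 and ?y1.0 = "eta * y1" and ?y2.0 = "eta * y2" and ?y3.0 = y3,
      OF \<tau>, folded B_def C_def l_def])
    show "z \<noteq> 0" "s \<noteq> 0" using ne ne' by (simp_all add: z_def s_def)
    have "lam * x1 * (eta * y2) - lam * x2 * (eta * y1) = lam * eta * (x1 * y2 - x2 * y1)"
      by (simp add: algebra_simps)
    then show "lam * x1 * (eta * y2) - lam * x2 * (eta * y1) \<noteq> 0" using ne ne' by (simp add: det)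
    show "B (lam * x1) (lam * x2) (lam * x1) (lam * x2) = z" by (simp add: sc z_def d)
    show "B (lam * x1) (lam * x2) (eta * y1) (eta * y2) = z"
      using eta by (simp add: sc z_def d[symmetric] algebra_simps)
    show "B (eta * y1) (eta * y2) (lam * x1) (lam * x2) = 0" by (simp add: sc Byx)
    show "B (eta * y1) (eta * y2) (eta * y1) (eta * y2) = \<alpha> * z" using z by (simp add: sc \<alpha>_def)
    show "C (lam * x1) (lam * x2) (lam * x1) (lam * x2) = w" by (simp add: sc w_def)
    show "C (lam * x1) (lam * x2) (eta * y1) (eta * y2) + x3 * l (eta * y1) (eta * y2) = w"
      using ne ne' by (simp add: sc ly x3_def)
    show "C (eta * y1) (eta * y2) (lam * x1) (lam * x2) = s" by (simp add: sc s_def d)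
    show "C (eta * y1) (eta * y2) (eta * y1) (eta * y2) + y3 * l (eta * y1) (eta * y2) = \<alpha> * w"
      using ne ne' by (simp add: sc ly y3_def)
    show "l (lam * x1) (lam * x2) = 0" by (simp add: sc lx)
    have "z * l (eta * y1) (eta * y2) = - (lam * eta * (lam * (p * p)))"
      by (simp add: sc ly z_def algebra_simps)
    then show "z * l (eta * y1) (eta * y2) = s" by (simp add: lam s_def)
  qed
  then show ?thesis by blast
qed

subsection \<open>The closures\<close>

lemma orbit_subset_GL_saturation: "\<mu> \<in> T \<Longrightarrow> orbit \<mu> \<subseteq> GL_saturation T"
  by (auto simp: GL_saturation_def)

lemma GL_saturation_subset_zclosure:
  assumes "T \<subseteq> zclosure S" "\<And>\<nu>. \<nu> \<in> S \<Longrightarrow> orbit \<nu> \<subseteq> S"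
  shows "GL_saturation T \<subseteq> zclosure S"
  unfolding GL_saturation_iff subset_iff using assms act_zclosure by blast

lemma line_in_range_proj:
  "proj1 x = x \<Longrightarrow> proj1 y = y \<Longrightarrow> proj1 (\<lambda>i. x i + t * (y i - x i)) = (\<lambda>i. x i + t * (y i - x i))"
  "proj12 x = x \<Longrightarrow> proj12 y = y \<Longrightarrow> proj12 (\<lambda>i. x i + t * (y i - x i)) = (\<lambda>i. x i + t * (y i - x i))"
  "proj14 x = x \<Longrightarrow> proj14 y = y \<Longrightarrow> proj14 (\<lambda>i. x i + t * (y i - x i)) = (\<lambda>i. x i + t * (y i - x i))"
proof -
  have lin: "p (\<lambda>i. x i + t * (y i - x i)) = (\<lambda>i. p x i + t * (p y i - p x i))"
    if "p = proj1 \<or> p = proj12 \<or> p = proj14" for p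
    using that by (auto simp: proj1_def proj12_def proj14_def mask_def fun_eq_iff algebra_simps)
  show "proj1 x = x \<Longrightarrow> proj1 y = y \<Longrightarrow> proj1 (\<lambda>i. x i + t * (y i - x i)) = (\<lambda>i. x i + t * (y i - x i))"
    "proj12 x = x \<Longrightarrow> proj12 y = y \<Longrightarrow> proj12 (\<lambda>i. x i + t * (y i - x i)) = (\<lambda>i. x i + t * (y i - x i))"
    "proj14 x = x \<Longrightarrow> proj14 y = y \<Longrightarrow> proj14 (\<lambda>i. x i + t * (y i - x i)) = (\<lambda>i. x i + t * (y i - x i))"
    using lin by simp_all
qed

lemma orbit_orbit_subset: "\<nu> \<in> (\<Union>a. orbit (f a)) \<Longrightarrow> orbit \<nu> \<subseteq> (\<Union>a. orbit (f a))"
  using orbit_trans by blast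

lemma zclosure_eq_sandwich:
  "G \<subseteq> zclosure S \<Longrightarrow> S \<subseteq> G \<Longrightarrow> G \<subseteq> zclosure P \<Longrightarrow> P \<subseteq> G \<Longrightarrow> zclosure S = zclosure P"
  by (meson order_trans zclosure_eqI)

text \<open>Lines starting at \<open>L2\<close>, \<open>M12 0\<close> and \<open>M14 0\<close> show
  that the generic members are dense in their linear family, and invariance of closures extends this
  to the saturation. The standard orbits and the parametrization are thus both dense subsets of the
  same saturation.\<close>

lemma zclosure_orbits:
  "zclosure (orbit L2) = zclosure (range param1)"
  "zclosure (\<Union>\<alpha>. orbit (M12 \<alpha>)) = zclosure (range param12)"
  "zclosure (\<Union>\<alpha>. orbit (M14 \<alpha>)) = zclosure (range param14)"
proof -
  have "range proj1 \<subseteq> zclosure (orbit L2)"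
  proof
    fix \<tau> assume \<tau>: "\<tau> \<in> range proj1"
    show "\<tau> \<in> zclosure (orbit L2)"
    proof (rule line_zclosure[of "\<lambda>\<tau>. \<tau> (E1,E1,E2) * \<tau> (E2,E1,E3) * \<tau> (E3,E1,E4)" L2])
      show "(\<lambda>\<tau>. \<tau> (E1,E1,E2) * \<tau> (E2,E1,E3) * \<tau> (E3,E1,E4)) \<in> poly_fun" by (intro poly_fun_intros)
      show "L2 (E1,E1,E2) * L2 (E2,E1,E3) * L2 (E3,E1,E4) \<noteq> 0" by (simp add: L2_def)
    qed (intro orbit_L2I, use \<tau> in \<open>auto simp: mem_range_proj line_in_range_proj proj_standard\<close>)
  qed
  then have "GL_saturation (range proj1) \<subseteq> zclosure (orbit L2)"
    by (rule GL_saturation_subset_zclosure) (use orbit_trans in blast)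
  moreover have "orbit L2 \<subseteq> GL_saturation (range proj1)"
    by (rule orbit_subset_GL_saturation) (simp add: mem_range_proj proj_standard)
  ultimately show "zclosure (orbit L2) = zclosure (range param1)"
    by (rule zclosure_eq_sandwich[OF _ _ GL_saturation_subset_zclosure_param(1) range_param_subset(1)])
  have "range proj12 \<subseteq> zclosure (\<Union>\<alpha>. orbit (M12 \<alpha>))"
  proof
    fix \<tau> assume \<tau>: "\<tau> \<in> range proj12"
    show "\<tau> \<in> zclosure (\<Union>\<alpha>. orbit (M12 \<alpha>))"
    proof (rule line_zclosure[of M12_generic "M12 0"])
      show "M12_generic \<in> poly_fun" by (rule poly_fun_M12_generic)
      show "M12_generic (M12 0) \<noteq> 0" by (rule M12_generic_M12)
    next
      fix t assume "M12_generic (\<lambda>i. M12 0 i + t * (\<tau> i - M12 0 i)) \<noteq> 0"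
      moreover have "proj12 (\<lambda>i. M12 0 i + t * (\<tau> i - M12 0 i)) = (\<lambda>i. M12 0 i + t * (\<tau> i - M12 0 i))"
        by (rule line_in_range_proj(2)) (use \<tau> in \<open>simp_all add: mem_range_proj proj_standard\<close>)
      ultimately show "(\<lambda>i. M12 0 i + t * (\<tau> i - M12 0 i)) \<in> (\<Union>\<alpha>. orbit (M12 \<alpha>))"
        using generic_orbit_M12 by blast
    qed
  qed
  then have "GL_saturation (range proj12) \<subseteq> zclosure (\<Union>\<alpha>. orbit (M12 \<alpha>))"
    by (rule GL_saturation_subset_zclosure) (rule orbit_orbit_subset)
  moreover have "(\<Union>\<alpha>. orbit (M12 \<alpha>)) \<subseteq> GL_saturation (range proj12)"
    by (intro UN_least orbit_subset_GL_saturation) (simp add: mem_range_proj proj_standard)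
  ultimately show "zclosure (\<Union>\<alpha>. orbit (M12 \<alpha>)) = zclosure (range param12)"
    by (rule zclosure_eq_sandwich[OF _ _ GL_saturation_subset_zclosure_param(2) range_param_subset(2)])
  have "range proj14 \<subseteq> zclosure (\<Union>\<alpha>. orbit (M14 \<alpha>))"
  proof
    fix \<tau> assume \<tau>: "\<tau> \<in> range proj14"
    show "\<tau> \<in> zclosure (\<Union>\<alpha>. orbit (M14 \<alpha>))"
    proof (rule line_zclosure[of M14_generic "M14 0"])
      show "M14_generic \<in> poly_fun" by (rule poly_fun_M14_generic)
      show "M14_generic (M14 0) \<noteq> 0" by (rule M14_generic_M14)
    next
      fix t assume "M14_generic (\<lambda>i. M14 0 i + t * (\<tau> i - M14 0 i)) \<noteq> 0"
      moreover have "proj14 (\<lambda>i. M14 0 i + t * (\<tau> i - M14 0 i)) = (\<lambda>i. M14 0 i + t * (\<tau> i - M14 0 i))"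
        by (rule line_in_range_proj(3)) (use \<tau> in \<open>simp_all add: mem_range_proj proj_standard\<close>)
      ultimately show "(\<lambda>i. M14 0 i + t * (\<tau> i - M14 0 i)) \<in> (\<Union>\<alpha>. orbit (M14 \<alpha>))"
        using generic_orbit_M14 by blast
    qed
  qed
  then have "GL_saturation (range proj14) \<subseteq> zclosure (\<Union>\<alpha>. orbit (M14 \<alpha>))"
    by (rule GL_saturation_subset_zclosure) (rule orbit_orbit_subset)
  moreover have "(\<Union>\<alpha>. orbit (M14 \<alpha>)) \<subseteq> GL_saturation (range proj14)"
    by (intro UN_least orbit_subset_GL_saturation) (simp add: mem_range_proj proj_standard)
  ultimately show "zclosure (\<Union>\<alpha>. orbit (M14 \<alpha>)) = zclosure (range param14)"
    by (rule zclosure_eq_sandwich[OF _ _ GL_saturation_subset_zclosure_param(3) range_param_subset(3)])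
qed

section \<open>The irreducible components\<close>

lemma poly_fun_param:
  "(\<lambda>x. param1 x t) \<in> poly_fun" "(\<lambda>x. param12 x t) \<in> poly_fun" "(\<lambda>x. param14 x t) \<in> poly_fun"
  using poly_in_param poly_in_subset_poly_fun by blast+

lemma zirreducible_param:
  "zirreducible (zclosure (range param1))" "zirreducible (zclosure (range param12))"
  "zirreducible (zclosure (range param14))"
  by (intro zirreducible_zclosure zirreducible_range poly_fun_param)+

lemma GL_saturation_mono: "S \<subseteq> T \<Longrightarrow> GL_saturation S \<subseteq> GL_saturation T"
  by (auto simp: GL_saturation_def)

lemma range_param_subset_NML: "range param1 \<subseteq> NML" "range param12 \<subseteq> NML" "range param14 \<subseteq> NML"
proof -
  have "GL_saturation (range proj1) \<subseteq> NML" "GL_saturation (range proj12) \<subseteq> NML"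
    "GL_saturation (range proj14) \<subseteq> NML"
    unfolding NML_eq(1) by (rule GL_saturation_mono; auto simp: families_def)+
  then show "range param1 \<subseteq> NML" "range param12 \<subseteq> NML" "range param14 \<subseteq> NML"
    using range_param_subset by (meson order_trans)+
qed

lemma NML_decomposition:
  "NML = zclosure (range param1) \<union> zclosure (range param12) \<union> zclosure (range param14)"
proof
  have "GL_saturation families \<subseteq> GL_saturation (range proj1) \<union> GL_saturation (range proj12)
      \<union> GL_saturation (range proj14)"
    by (auto simp: GL_saturation_def families_def)
  then show "NML \<subseteq> zclosure (range param1) \<union> zclosure (range param12) \<union> zclosure (range param14)"
    unfolding NML_eq(1) using GL_saturation_subset_zclosure_param by blast
  show "zclosure (range param1) \<union> zclosure (range param12) \<union> zclosure (range param14) \<subseteq> NML"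
    by (intro Un_least zclosure_minimal range_param_subset_NML NML_eq(2))
qed

section \<open>Identities that tell the three components apart\<close>

lemma mult_mult_act:
  assumes "invertible g"
  shows "mult (act g \<tau>) (mult (act g \<tau>) x y) z
      = g *v mult \<tau> (mult \<tau> (matrix_inv g *v x) (matrix_inv g *v y)) (matrix_inv g *v z)"
    and "mult (act g \<tau>) z (mult (act g \<tau>) x y)
      = g *v mult \<tau> (matrix_inv g *v z) (mult \<tau> (matrix_inv g *v x) (matrix_inv g *v y))"
  by (simp_all add: mult_act matrix_inv_vec assms)

definition left_nilpotent4 :: "struct set" where
  "left_nilpotent4 = {\<mu>. \<forall>x y z w. mult \<mu> (mult \<mu> (mult \<mu> x y) z) w = 0}"

definition right_trivial :: "struct set" where
  "right_trivial = {\<mu>. \<forall>x y z. mult \<mu> x (mult \<mu> y z) = 0}"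

definition square_left_trivial :: "struct set" where
  "square_left_trivial = {\<mu>. \<forall>x y. mult \<mu> (mult \<mu> x x) y = 0}"

definition right_commutative :: "struct set" where
  "right_commutative = {\<mu>. \<forall>x y z. mult \<mu> (mult \<mu> x y) z - mult \<mu> (mult \<mu> x z) y = 0}"

lemma zclosed_conditions:
  "zclosed left_nilpotent4" "zclosed right_trivial" "zclosed square_left_trivial" "zclosed right_commutative"
  unfolding left_nilpotent4_def right_trivial_def square_left_trivial_def right_commutative_def
  by (intro zclosed_Collect_all zclosed_vec_poly vec_poly_intros)+

text \<open>With \<open>standard_conditions\<close> these give all six non-inclusions:
  \<open>L2\<close> violates an identity of the other two components, \<open>M12\<close> another
  such identity, and \<open>M14\<close> one identity of each of the others.\<close>

lemma param_conditions:
  "zclosure (range param1) \<subseteq> right_trivial" "zclosure (range param1) \<subseteq> right_commutative"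
  "zclosure (range param12) \<subseteq> left_nilpotent4" "zclosure (range param12) \<subseteq> square_left_trivial"
  "zclosure (range param14) \<subseteq> left_nilpotent4" "zclosure (range param14) \<subseteq> right_trivial"
proof -
  note inv = invertible_unip
  have "mult (proj1 \<tau>) a (mult (proj1 \<tau>) b c) = 0"
    "mult (proj1 \<tau>) (mult (proj1 \<tau>) a b) c = mult (proj1 \<tau>) (mult (proj1 \<tau>) a c) b" for \<tau> a b c
    by (simp_all add: mult_proj1 vec_eq_idx algebra_simps)
  then have "param1 x \<in> right_trivial" "param1 x \<in> right_commutative" for x
    by (simp_all add: param1_def right_trivial_def right_commutative_def mult_mult_act inv vec.zero)
  then show "zclosure (range param1) \<subseteq> right_trivial" "zclosure (range param1) \<subseteq> right_commutative"
    by (simp_all add: zclosure_minimal zclosed_conditions image_subset_iff)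
  have "mult (proj12 \<tau>) (mult (proj12 \<tau>) (mult (proj12 \<tau>) a b) c) d = 0"
    "mult (proj12 \<tau>) (mult (proj12 \<tau>) a a) b = 0" for \<tau> a b c d
    using range_proj12_iff[of "proj12 \<tau>"] by blast+
  then have "param12 x \<in> left_nilpotent4" "param12 x \<in> square_left_trivial" for x
    by (simp_all add: param12_def left_nilpotent4_def square_left_trivial_def
        mult_act matrix_inv_vec inv vec.zero)
  then show "zclosure (range param12) \<subseteq> left_nilpotent4" "zclosure (range param12) \<subseteq> square_left_trivial"
    by (simp_all add: zclosure_minimal zclosed_conditions image_subset_iff)
  have "mult (proj14 \<tau>) (mult (proj14 \<tau>) (mult (proj14 \<tau>) a b) c) d = 0"
    "mult (proj14 \<tau>) a (mult (proj14 \<tau>) b c) = 0" for \<tau> a b c d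
    using range_proj14_iff[of "proj14 \<tau>"] by blast+
  then have "param14 x \<in> left_nilpotent4" "param14 x \<in> right_trivial" for x
    by (simp_all add: param14_def left_nilpotent4_def right_trivial_def
        mult_act matrix_inv_vec inv vec.zero)
  then show "zclosure (range param14) \<subseteq> left_nilpotent4" "zclosure (range param14) \<subseteq> right_trivial"
    by (simp_all add: zclosure_minimal zclosed_conditions image_subset_iff)
qed

lemma standard_mem_param:
  "L2 \<in> zclosure (range param1)" "M12 \<alpha> \<in> zclosure (range param12)" "M14 \<alpha> \<in> zclosure (range param14)"
proof -
  show "L2 \<in> zclosure (range param1)"
    unfolding zclosure_orbits(1)[symmetric] by (rule subsetD[OF subset_zclosure orbit_refl])
  show "M12 \<alpha> \<in> zclosure (range param12)"
    unfolding zclosure_orbits(2)[symmetric] by (rule subsetD[OF subset_zclosure]) (auto intro: orbit_refl)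
  show "M14 \<alpha> \<in> zclosure (range param14)"
    unfolding zclosure_orbits(3)[symmetric] by (rule subsetD[OF subset_zclosure]) (auto intro: orbit_refl)
qed

lemma mult_standard:
  "mult L2 x y = vec4 0 (x$E1 * y$E1) (x$E2 * y$E1) (x$E3 * y$E1)"
  "mult (M12 \<alpha>) x y = vec4 0 0 (x$E1 * y$E2 - x$E2 * y$E1)
     (\<alpha> * x$E1 * y$E1 + x$E2 * y$E2 + x$E1 * y$E3 - x$E3 * y$E1 + x$E3 * y$E3)"
  "mult (M14 \<alpha>) x y = vec4 0 0 (x$E1 * y$E1 + x$E1 * y$E2 + \<alpha> * x$E2 * y$E2)
     (x$E2 * y$E1 + x$E3 * y$E2)"
  by (simp_all add: vec_eq_idx mult_nth sum_idx L2_def M12_def M14_def algebra_simps)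

lemma standard_conditions:
  "L2 \<notin> left_nilpotent4" "M12 \<alpha> \<notin> right_trivial" "M14 \<alpha> \<notin> right_commutative"
  "M14 \<alpha> \<notin> square_left_trivial"
proof -
  let ?e1 = "vec4 1 0 0 0" and ?e2 = "vec4 0 1 0 0"
  have "mult L2 (mult L2 (mult L2 ?e1 ?e1) ?e1) ?e1 \<noteq> 0" by (simp add: mult_standard vec_eq_idx)
  then show "L2 \<notin> left_nilpotent4" unfolding left_nilpotent4_def by blast
  have "mult (M12 \<alpha>) ?e1 (mult (M12 \<alpha>) ?e1 ?e2) \<noteq> 0" by (simp add: mult_standard vec_eq_idx)
  then show "M12 \<alpha> \<notin> right_trivial" unfolding right_trivial_def by blast
  have "mult (M14 \<alpha>) (mult (M14 \<alpha>) ?e1 ?e1) ?e2 - mult (M14 \<alpha>) (mult (M14 \<alpha>) ?e1 ?e2) ?e1 \<noteq> 0"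
    by (simp add: mult_standard vec_eq_idx)
  then show "M14 \<alpha> \<notin> right_commutative" unfolding right_commutative_def by blast
  have "mult (M14 \<alpha>) (mult (M14 \<alpha>) ?e1 ?e1) ?e2 \<noteq> 0" by (simp add: mult_standard vec_eq_idx)
  then show "M14 \<alpha> \<notin> square_left_trivial" unfolding square_left_trivial_def by blast
qed

lemma zcomponents_NML:
  "zcomponents NML = {zclosure (range param1), zclosure (range param12), zclosure (range param14)}"
  "card (zcomponents NML) = 3"
proof -
  note * = zcomponents_three[OF NML_decomposition zclosed_zclosure zclosed_zclosure zclosed_zclosure
      zirreducible_param]
  note mem = standard_mem_param(1) standard_mem_param(2)[of 0] standard_mem_param(3)[of 0]
  have ne: "\<not> zclosure (range param1) \<subseteq> zclosure (range param12)"
    "\<not> zclosure (range param1) \<subseteq> zclosure (range param14)"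
    "\<not> zclosure (range param12) \<subseteq> zclosure (range param1)"
    "\<not> zclosure (range param12) \<subseteq> zclosure (range param14)"
    "\<not> zclosure (range param14) \<subseteq> zclosure (range param1)"
    "\<not> zclosure (range param14) \<subseteq> zclosure (range param12)"
    using mem param_conditions standard_conditions by blast+
  show "zcomponents NML = {zclosure (range param1), zclosure (range param12), zclosure (range param14)}"
    "card (zcomponents NML) = 3"
    by (rule *[OF ne])+
qed

section \<open>The dimension\<close>

definition truncate :: "nat \<Rightarrow> struct \<Rightarrow> struct" where
  "truncate n x = (\<lambda>t. if t \<in> set (take n vars12) then x t else 0)"

lemma param12_nth:
  "param12 x (i, j, k) = (\<Sum>l\<in>UNIV. unip (drop12 x) $ k $ l *
     mult (proj12 x) (unip_inv (drop12 x) (axis i 1)) (unip_inv (drop12 x) (axis j 1)) $ l)"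
  by (simp add: param12_def act_nth matrix_inv_unip)

lemmas param12_eval = param12_nth sum_idx mult_proj12 unip_inv_def Let_def unip_def axis_def drop12_def

text \<open>While all unipotent entries are zero, the coefficients of \<open>param12\<close> are the
  parameters themselves; this settles the first ten steps. For each later step there is a polynomial
  that the next unipotent entry makes nonzero.\<close>

lemma truncate_step:
  assumes "n < 15"
  shows "\<exists>f\<in>poly_fun. (\<forall>x. f (param12 (truncate n x)) = 0) \<and> (\<exists>x. f (param12 (truncate (Suc n) x)) \<noteq> 0)"
proof -
  \<comment> \<open>Only \<open>e1e2 = - e2e1 = e3\<close> and \<open>e3e3 = e4\<close>, moved by
    unipotent entries equal to 1: the simplest structure on which the last five functions do not
    vanish.\<close>
  define w :: struct where
    "w = (\<lambda>t. if t = (E1,E2,E3) \<or> t = (E3,E3,E4) \<or> snd (snd t) = E1 then 1 else 0)"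
  have "n \<in> {0,1,2,3,4,5,6,7,8,9} \<or> n = 10 \<or> n = 11 \<or> n = 12 \<or> n = 13 \<or> n = 14"
    using assms unfolding insert_iff empty_iff by presburger
  then consider "n \<in> {0,1,2,3,4,5,6,7,8,9}" | "n = 10" | "n = 11" | "n = 12" | "n = 13" | "n = 14"
    by blast
  then show ?thesis
  proof cases
    case 1
    show ?thesis
    proof (intro bexI[of _ "\<lambda>\<mu>. \<mu> (vars12 ! n)"] conjI allI)
      show "param12 (truncate n x) (vars12 ! n) = 0" for x
        using 1 by (elim insertE; simp add: param12_eval truncate_def vars12_def)
      show "\<exists>x. param12 (truncate (Suc n) x) (vars12 ! n) \<noteq> 0"
        using 1 by (intro exI[of _ "\<lambda>_. 1"], elim insertE; simp add: param12_eval truncate_def vars12_def)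
    qed (rule pf_coord)
  next
    case 2
    show ?thesis
      by (rule bexI[of _ "\<lambda>\<mu>. \<mu> (E4,E4,E4)"])
        (auto simp: param12_eval truncate_def vars12_def w_def 2 intro: poly_fun_intros intro!: exI[of _ w])
  next
    case 3
    show ?thesis
      by (rule bexI[of _ "\<lambda>\<mu>. \<mu> (E3,E3,E2)"])
        (auto simp: param12_eval truncate_def vars12_def w_def 3 intro: poly_fun_intros intro!: exI[of _ w])
  next
    case 4
    show ?thesis
      by (rule bexI[of _ "\<lambda>\<mu>. \<mu> (E3,E3,E1)"])
        (auto simp: param12_eval truncate_def vars12_def w_def 4 intro: poly_fun_intros intro!: exI[of _ w])
  next
    \<comment> \<open>While the new entry is off, \<open>e3e3\<close> is a multiple of the image of
      \<open>e4\<close>. The 2-by-2 minor with \<open>e1e2\<close> therefore removes the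
      contribution of the fourth column and isolates the entry (1,3), and in the next case
      (2,3).\<close>
    case 5
    show ?thesis
    proof (rule bexI[of _ "\<lambda>\<mu>. \<mu> (E1,E2,E1) * \<mu> (E3,E3,E4) - \<mu> (E1,E2,E4) * \<mu> (E3,E3,E1)"])
      show "(\<lambda>\<mu>. \<mu> (E1,E2,E1) * \<mu> (E3,E3,E4) - \<mu> (E1,E2,E4) * \<mu> (E3,E3,E1)) \<in> poly_fun" by (intro poly_fun_intros)
    qed (auto simp: param12_eval truncate_def vars12_def w_def 5 intro!: exI[of _ w])
  next
    case 6
    show ?thesis
    proof (rule bexI[of _ "\<lambda>\<mu>. \<mu> (E1,E2,E2) * \<mu> (E3,E3,E4) - \<mu> (E1,E2,E4) * \<mu> (E3,E3,E2)"])
      show "(\<lambda>\<mu>. \<mu> (E1,E2,E2) * \<mu> (E3,E3,E4) - \<mu> (E1,E2,E4) * \<mu> (E3,E3,E2)) \<in> poly_fun" by (intro poly_fun_intros)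
    qed (auto simp: param12_eval truncate_def vars12_def w_def 6 intro!: exI[of _ w])
  qed
qed

lemma zchain_NML: "zchain NML 15 (\<lambda>n. zclosure (range (\<lambda>x. param12 (truncate n x))))"
proof -
  let ?Z = "\<lambda>n. zclosure (range (\<lambda>x. param12 (truncate n x)))"
  have p: "(\<lambda>x. param12 (truncate n x) t) \<in> poly_fun" for n t
  proof (rule poly_fun_compose[OF poly_fun_param(2)])
    show "(\<lambda>x. truncate n x i) \<in> poly_fun" for i
      by (cases "i \<in> set (take n vars12)") (auto simp: truncate_def intro: poly_fun_intros)
  qed
  have sub: "?Z n \<subseteq> NML" for n
    by (rule zclosure_minimal[OF _ NML_eq(2)]) (use range_param_subset_NML(2) in blast)
  have "\<exists>C. zclosed C \<and> ?Z n = NML \<inter> C" for n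
    using sub[of n] zclosed_zclosure by (intro exI[of _ "?Z n"]) blast
  moreover have "zirreducible (?Z n)" for n
    by (intro zirreducible_zclosure zirreducible_range p)
  moreover have "?Z n \<subset> ?Z (Suc n)" if n: "n < 15" for n
  proof
    have "truncate n x = truncate (Suc n) (truncate n x)" for x
      using set_take_subset_set_take[of n "Suc n" vars12] by (auto simp: truncate_def fun_eq_iff)
    then show "?Z n \<subseteq> ?Z (Suc n)"
      by (intro zclosure_mono image_subsetI) (metis rangeI)
    obtain f x where f: "f \<in> poly_fun" "\<And>x. f (param12 (truncate n x)) = 0"
        "f (param12 (truncate (Suc n) x)) \<noteq> 0"
      using truncate_step[OF n] by blast
    have "param12 (truncate (Suc n) x) \<notin> ?Z n"
      using zclosureD[of _ _ f] f by blast
    moreover have "param12 (truncate (Suc n) x) \<in> ?Z (Suc n)"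
      by (rule subsetD[OF subset_zclosure]) blast
    ultimately show "?Z n \<noteq> ?Z (Suc n)" by metis
  qed
  ultimately show ?thesis by (simp add: zchain_def)
qed

text \<open>The top of a chain is irreducible, so it lies in one of the three closures, and each of
  these has at most 15 parameters.\<close>

lemma has_zdim_NML: "has_zdim NML 15"
  unfolding has_zdim_def
proof (intro conjI allI impI)
  show "\<exists>Z. zchain NML 15 Z" using zchain_NML by blast
  fix k Z assume Z: "zchain NML k Z"
  then have irr: "zirreducible (Z k)" and sub: "Z k \<subseteq> NML" unfolding zchain_def by blast+
  have "Z k \<subseteq> zclosure (range param1) \<union> zclosure (range param12) \<or> Z k \<subseteq> zclosure (range param14)"
    using sub unfolding NML_decomposition
    by (intro zirreducible_subset_Un irr zclosed_Un zclosed_zclosure)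
  then have "Z k \<subseteq> zclosure (range param1) \<or> Z k \<subseteq> zclosure (range param12) \<or> Z k \<subseteq> zclosure (range param14)"
    using zirreducible_subset_Un[OF irr zclosed_zclosure zclosed_zclosure] by blast
  then have "k \<le> card (set vars1) \<or> k \<le> card (set vars12) \<or> k \<le> card (set vars14)"
    using zchain_le_card[where \<phi> = param1, OF Z finite_set poly_in_param(1)]
      zchain_le_card[where \<phi> = param12, OF Z finite_set poly_in_param(2)]
      zchain_le_card[where \<phi> = param14, OF Z finite_set poly_in_param(3)] by blast
  moreover have "length vars1 = 12" "length vars12 = 15" "length vars14 = 15"
    by (simp_all add: vars1_def vars12_def vars14_def)
  ultimately show "k \<le> 15"
    using card_length[of vars1] card_length[of vars12] card_length[of vars14] by linarith
qed

section \<open>Rigid structures\<close>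

lemma orbit_eqD:
  assumes "\<tau> \<in> orbit \<nu>"
  obtains v where "\<And>i j. mult \<tau> (v i) (v j) = \<nu> (i,j,E1) *s v E1 + \<nu> (i,j,E2) *s v E2
      + \<nu> (i,j,E3) *s v E3 + \<nu> (i,j,E4) *s v E4" "\<And>i. v i \<noteq> 0"
proof -
  obtain g where g: "invertible g" "\<tau> = act g \<nu>" using assms by (auto simp: orbit_def)
  define v where "v i = g *v axis i 1" for i
  have "mult \<tau> (v i) (v j) = \<nu> (i,j,E1) *s v E1 + \<nu> (i,j,E2) *s v E2
      + \<nu> (i,j,E3) *s v E3 + \<nu> (i,j,E4) *s v E4" for i j
    using matrix_vector_expand[of g "\<chi> k. \<nu> (i, j, k)"]
    by (simp add: v_def g mult_act_apply mult_axis sum_idx)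
  moreover have "v i \<noteq> 0" for i
    unfolding v_def using matrix_inv_vec(2)[OF g(1), of "axis i 1"] by (auto simp: axis_eq_0_iff vec.zero)
  ultimately show ?thesis using that by blast
qed

text \<open>The multiplication table leaves almost no freedom: up to \<open>e4\<close>, the images
  of \<open>e1\<close> and \<open>e2\<close> are \<open>z e1\<close> and \<open>e2\<close> with
  \<open>z * z = 1\<close>. Comparing the squares of \<open>e1\<close> then gives the claim.\<close>

lemma M12_orbit_parameter:
  assumes "M12 \<beta> \<in> orbit (M12 \<alpha>)" shows "\<alpha> = \<beta>"
proof -
  obtain v where v: "\<And>i j. mult (M12 \<beta>) (v i) (v j) = M12 \<alpha> (i,j,E1) *s v E1 + M12 \<alpha> (i,j,E2) *s v E2
      + M12 \<alpha> (i,j,E3) *s v E3 + M12 \<alpha> (i,j,E4) *s v E4" and nz: "\<And>i. v i \<noteq> 0"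
    using orbit_eqD[OF assms] by blast
  define x1 x2 x3 where x: "x1 = v E1 $ E1" "x2 = v E1 $ E2" "x3 = v E1 $ E3"
  define y1 y2 y3 where y: "y1 = v E2 $ E1" "y2 = v E2 $ E2" "y3 = v E2 $ E3"
  define z s where zs: "z = v E3 $ E3" "s = v E4 $ E4"
  have v3: "v E3 $ E1 = 0" "v E3 $ E2 = 0" "x1 * y2 - x2 * y1 = z"
    using v[of E1 E2] unfolding mult_standard by (simp_all add: M12_def vec_eq_idx x y zs)
  have v4: "v E4 $ E1 = 0" "v E4 $ E2 = 0" "v E4 $ E3 = 0"
    using v[of E1 E3] v3 unfolding mult_standard by (simp_all add: M12_def vec_eq_idx)
  have s0: "s \<noteq> 0" using nz[of E4] v4 by (auto simp: vec_eq_idx zs)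
  have e: "x1 * z + x3 * z = s" "- (z * x1) + z * x3 = - s" "y1 * z + y3 * z = 0" "- (z * y1) + z * y3 = 0"
      "z * z = s" "y2 * y2 + y3 * y3 + \<beta> * y1 * y1 + y1 * y3 - y3 * y1 = s"
      "\<beta> * x1 * x1 + x2 * x2 + x1 * x3 - x3 * x1 + x3 * x3 = \<alpha> * s"
    using v[of E1 E3] v[of E3 E1] v[of E2 E3] v[of E3 E2] v[of E3 E3] v[of E2 E2] v[of E1 E1] v3 v4
    unfolding mult_standard by (simp_all add: M12_def vec_eq_idx x y zs algebra_simps)
  have e': "\<beta> * x1 * y1 + x2 * y2 + x1 * y3 - x3 * y1 + x3 * y3
      = - (\<beta> * y1 * x1 + y2 * x2 + y1 * x3 - y3 * x1 + y3 * x3)"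
    using v[of E1 E2] v[of E2 E1] unfolding mult_standard by (simp add: M12_def vec_eq_idx x y zs)
  have z0: "z \<noteq> 0" using s0 e(5) by auto
  have "2 * (z * y3) = 0" "2 * (z * y1) = 0" using e(3,4) by algebra+
  moreover have "(x1 * z + x3 * z) + (- (z * x1) + z * x3) = 0" unfolding e(1,2) by simp
  then have "2 * (z * x3) = 0" by (simp add: algebra_simps)
  ultimately have 0: "y3 = 0" "y1 = 0" "x3 = 0" using z0 by auto
  have "z * x1 = z * z" using e 0 by (simp add: mult.commute)
  then have x1: "x1 = z" using z0 by simp
  then have y2: "y2 = 1" using v3(3) 0 z0 by simp
  then have s1: "s = 1" using e(6) 0 by simp
  have "x2 = 0" using e' 0 y2 by simp
  then show ?thesis using e(5,7) 0 x1 s1 by (simp add: mult.assoc)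
qed

text \<open>In the first two coordinates an isomorphism can only scale \<open>e1\<close> and
  \<open>e2\<close> by the same factor, and the \<open>e3\<close>-part of \<open>e2e2\<close>,
  relative to that of \<open>e1e1\<close>, does not change under this.\<close>

lemma M14_orbit_parameter:
  assumes "M14 \<beta> \<in> orbit (M14 \<alpha>)" shows "\<alpha> = \<beta>"
proof -
  obtain v where v: "\<And>i j. mult (M14 \<beta>) (v i) (v j) = M14 \<alpha> (i,j,E1) *s v E1 + M14 \<alpha> (i,j,E2) *s v E2
      + M14 \<alpha> (i,j,E3) *s v E3 + M14 \<alpha> (i,j,E4) *s v E4" and nz: "\<And>i. v i \<noteq> 0"
    using orbit_eqD[OF assms] by blast
  define x1 x2 where x: "x1 = v E1 $ E1" "x2 = v E1 $ E2"
  define y1 y2 where y: "y1 = v E2 $ E1" "y2 = v E2 $ E2"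
  define z where z: "z = v E3 $ E3"
  have v3: "v E3 $ E1 = 0" "v E3 $ E2 = 0" "x1 * x1 + x1 * x2 + \<beta> * x2 * x2 = z"
    using v[of E1 E1] unfolding mult_standard by (simp_all add: M14_def vec_eq_idx x z)
  have v4: "v E4 $ E1 = 0" "v E4 $ E2 = 0" "v E4 $ E3 = 0" "v E4 $ E4 = z * y2"
    using v[of E3 E2] v3 unfolding mult_standard by (simp_all add: M14_def vec_eq_idx y z)
  have "z * y2 \<noteq> 0" using nz[of E4] v4 by (auto simp: vec_eq_idx)
  then have z0: "z \<noteq> 0" by auto
  have "z * x2 = 0" using v[of E3 E1] v3 unfolding mult_standard by (simp add: M14_def vec_eq_idx x z)
  then have x2: "x2 = 0" using z0 by simp
  have x1: "x1 * x1 = z" "x1 \<noteq> 0" using v3(3) x2 z0 by auto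
  have "x1 * y1 + x1 * y2 + \<beta> * x2 * y2 = z" "y1 * x1 + y1 * x2 + \<beta> * y2 * x2 = 0"
    "y1 * y1 + y1 * y2 + \<beta> * y2 * y2 = \<alpha> * z"
    using v[of E1 E2] v[of E2 E1] v[of E2 E2] v3 v4
    unfolding mult_standard by (simp_all add: M14_def vec_eq_idx x y z)
  then have "y1 = 0" "x1 * y2 = x1 * x1" "\<beta> * (y2 * y2) = \<alpha> * (x1 * x1)"
    using x2 x1 by (simp_all add: mult.assoc)
  moreover from this have "y2 = x1" using x1(2) by (metis mult_left_cancel)
  ultimately show ?thesis using x1 z0 by auto
qed

lemma rigid_meets:
  assumes "rigid_in NML \<mu>" "\<mu> \<in> zclosure S" "S \<subseteq> NML"
  obtains U where "zopen U" "orbit \<mu> = NML \<inter> U" "S \<inter> U \<noteq> {}"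
proof -
  obtain U where U: "zopen U" "orbit \<mu> = NML \<inter> U" using assms(1) by (auto simp: rigid_in_def)
  have "S \<inter> U \<noteq> {}"
  proof
    assume "S \<inter> U = {}"
    then have "zclosure S \<subseteq> - U" using U(1) by (intro zclosure_minimal) (auto simp: zopen_def)
    then show False using orbit_refl[of \<mu>] U(2) assms(2) by blast
  qed
  then show ?thesis using that U by blast
qed

text \<open>A nonempty open set contains all but finitely many members of a line.\<close>

lemma not_rigid_family:
  fixes M :: "complex \<Rightarrow> struct"
  assumes line: "\<And>t. M t = (\<lambda>i. M 0 i + t * (M 1 i - M 0 i))"
    and inj: "\<And>\<alpha> \<beta>. M \<beta> \<in> orbit (M \<alpha>) \<Longrightarrow> \<alpha> = \<beta>"
    and sub: "(\<Union>\<alpha>. orbit (M \<alpha>)) \<subseteq> NML" and \<mu>: "\<mu> \<in> zclosure (\<Union>\<alpha>. orbit (M \<alpha>))"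
  shows "\<not> rigid_in NML \<mu>"
proof
  assume "rigid_in NML \<mu>"
  then obtain U where U: "zopen U" "orbit \<mu> = NML \<inter> U" "(\<Union>\<alpha>. orbit (M \<alpha>)) \<inter> U \<noteq> {}"
    using rigid_meets \<mu> sub by metis
  then obtain \<nu> \<alpha> where \<nu>: "\<nu> \<in> orbit (M \<alpha>)" "\<nu> \<in> orbit \<mu>" using sub by blast
  then have M\<alpha>: "M \<alpha> \<in> orbit \<mu>" using orbit_sym orbit_trans by blast
  then have "M \<alpha> \<notin> - U" using U(2) by blast
  then obtain f where f: "f \<in> poly_fun" "f (M \<alpha>) \<noteq> 0" "\<And>y. y \<in> - U \<Longrightarrow> f y = 0"
    using zclosed_separate[of "- U" "M \<alpha>"] U(1) by (auto simp: zopen_def)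
  obtain p where p: "\<And>t. f (M t) = poly p t"
    using poly_fun_line[OF f(1), of "M 0" "M 1"] line by metis
  have "p \<noteq> 0" using p[of \<alpha>] f(2) by auto
  then have "finite (insert \<alpha> {t. poly p t = 0})" by (simp add: poly_roots_finite)
  then obtain \<beta> where \<beta>: "\<beta> \<noteq> \<alpha>" "poly p \<beta> \<noteq> 0"
    using ex_new_if_finite[OF infinite_UNIV_char_0, of "insert \<alpha> {t. poly p t = 0}"] by auto
  then have "M \<beta> \<in> U" using f(3) p by force
  moreover have "M \<beta> \<in> NML" using sub orbit_refl by blast
  ultimately have "M \<beta> \<in> orbit (M \<alpha>)" using U(2) M\<alpha> orbit_sym orbit_trans by blast
  then show False using inj \<beta>(1) by blast
qed

lemma orbits_subset_NML:
  "orbit L2 \<subseteq> NML" "(\<Union>\<alpha>. orbit (M12 \<alpha>)) \<subseteq> NML" "(\<Union>\<alpha>. orbit (M14 \<alpha>)) \<subseteq> NML"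
  using subset_zclosure[of "orbit L2"] subset_zclosure[of "\<Union>\<alpha>. orbit (M12 \<alpha>)"]
    subset_zclosure[of "\<Union>\<alpha>. orbit (M14 \<alpha>)"]
  unfolding zclosure_orbits NML_decomposition by blast+

text \<open>Structures from the other two families satisfy \<open>((xy)z)w = 0\<close>. In the first
  family this product is governed by the three coefficients required in \<open>orbit_L2I\<close>, so
  it is not identically zero only if all three are nonzero.\<close>

lemma orbit_L2_eq: "orbit L2 = NML \<inter> - left_nilpotent4"
proof
  show "orbit L2 \<subseteq> NML \<inter> - left_nilpotent4"
  proof
    fix \<mu> assume \<mu>: "\<mu> \<in> orbit L2"
    then obtain g where g: "invertible g" "\<mu> = act g L2" by (auto simp: orbit_def)
    let ?e = "vec4 1 0 0 0"
    have *: "mult \<mu> (mult \<mu> (mult \<mu> (g *v ?e) (g *v ?e)) (g *v ?e)) (g *v ?e) = g *v vec4 0 0 0 1"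
      by (simp add: g mult_act_apply mult_standard)
    have "g *v vec4 0 0 0 1 \<noteq> 0"
    proof
      assume "g *v vec4 0 0 0 1 = 0"
      then have "vec4 0 0 0 1 = 0"
        using matrix_inv_vec(2)[OF g(1), of "vec4 0 0 0 1"] by (simp add: vec.zero)
      then show False by (simp add: vec_eq_idx)
    qed
    then have "mult \<mu> (mult \<mu> (mult \<mu> (g *v ?e) (g *v ?e)) (g *v ?e)) (g *v ?e) \<noteq> 0"
      using * by simp
    then have "\<mu> \<notin> left_nilpotent4" unfolding left_nilpotent4_def by blast
    then show "\<mu> \<in> NML \<inter> - left_nilpotent4" using \<mu> orbits_subset_NML(1) by blast
  qed
  show "NML \<inter> - left_nilpotent4 \<subseteq> orbit L2"
  proof
    fix \<mu> assume "\<mu> \<in> NML \<inter> - left_nilpotent4"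
    then have \<mu>: "\<mu> \<in> GL_saturation families" "\<mu> \<notin> left_nilpotent4" by (auto simp: NML_eq(1))
    then obtain g \<tau> where g: "invertible g" "\<tau> \<in> families" "\<mu> = act g \<tau>"
      unfolding GL_saturation_iff by blast
    have "\<mu> \<in> zclosure (range param12) \<Longrightarrow> False" "\<mu> \<in> zclosure (range param14) \<Longrightarrow> False"
      using param_conditions(3,5) \<mu>(2) by blast+
    then have "\<tau> \<notin> range proj12" "\<tau> \<notin> range proj14"
      using GL_saturation_subset_zclosure_param(2,3) g unfolding GL_saturation_iff subset_iff by blast+
    then have "\<tau> \<in> range proj1" using g(2) unfolding families_def by blast
    then have \<tau>: "proj1 \<tau> = \<tau>" by (simp add: mem_range_proj)
    have M: "mult \<tau> x y = mult (proj1 \<tau>) x y" for x y by (simp add: \<tau>)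
    have "\<tau> (E1,E1,E2) \<noteq> 0 \<and> \<tau> (E2,E1,E3) \<noteq> 0 \<and> \<tau> (E3,E1,E4) \<noteq> 0"
    proof (rule ccontr)
      assume z: "\<not> ?thesis"
      have "mult \<tau> (mult \<tau> (mult \<tau> x y) z) w = 0" for x y z w
        unfolding M mult_proj1 vec_eq_idx using z by auto
      then have "\<mu> \<in> left_nilpotent4"
        by (simp add: left_nilpotent4_def g(1,3) mult_act matrix_inv_vec vec.zero)
      then show False using \<mu>(2) by blast
    qed
    then have "\<tau> \<in> orbit L2" using orbit_L2I \<tau> by blast
    moreover have "\<mu> \<in> orbit \<tau>" using g by (auto simp: orbit_def)
    ultimately show "\<mu> \<in> orbit L2" using orbit_trans by blast
  qed
qed

text \<open>A rigid structure lies outside the closures of both one-parameter families, hence in the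
  closure of the orbit of \<open>L2\<close>; being open, its orbit meets that orbit and so coincides
  with it.\<close>

lemma rigid_NML_iff: "rigid_in NML \<mu> \<longleftrightarrow> \<mu> \<in> orbit L2"
proof
  assume r: "rigid_in NML \<mu>"
  have line: "M12 t = (\<lambda>i. M12 0 i + t * (M12 1 i - M12 0 i))"
    "M14 t = (\<lambda>i. M14 0 i + t * (M14 1 i - M14 0 i))" for t
    by (auto simp: M12_def M14_def fun_eq_iff)
  have "\<mu> \<notin> zclosure (\<Union>\<alpha>. orbit (M12 \<alpha>))" "\<mu> \<notin> zclosure (\<Union>\<alpha>. orbit (M14 \<alpha>))"
    using not_rigid_family[of M12, OF line(1) M12_orbit_parameter orbits_subset_NML(2)]
      not_rigid_family[of M14, OF line(2) M14_orbit_parameter orbits_subset_NML(3)] r by blast+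
  moreover have "\<mu> \<in> NML" using r by (simp add: rigid_in_def)
  ultimately have "\<mu> \<in> zclosure (orbit L2)"
    unfolding NML_decomposition zclosure_orbits by blast
  then obtain U where "orbit \<mu> = NML \<inter> U" "orbit L2 \<inter> U \<noteq> {}"
    using rigid_meets[OF r _ orbits_subset_NML(1)] by metis
  then obtain \<nu> where "\<nu> \<in> orbit L2" "\<nu> \<in> orbit \<mu>" using orbits_subset_NML(1) by blast
  then show "\<mu> \<in> orbit L2" using orbit_sym orbit_trans by blast
next
  assume \<mu>: "\<mu> \<in> orbit L2"
  then have "orbit \<mu> = orbit L2" using orbit_sym orbit_trans by blast
  moreover have "zopen (- left_nilpotent4)" by (simp add: zopen_def zclosed_conditions(1))
  ultimately show "rigid_in NML \<mu>"
    unfolding rigid_in_def using \<mu> orbits_subset_NML(1) orbit_L2_eq by blast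
qed

theorem theoremF:
  shows "has_zdim NML 15 \<and>
         zcomponents NML =
           {zclosure (orbit L2),
            zclosure (\<Union>\<alpha>. orbit (M12 \<alpha>)),
            zclosure (\<Union>\<alpha>. orbit (M14 \<alpha>))} \<and>
         card (zcomponents NML) = 3 \<and>
         (\<exists>\<mu>. rigid_in NML \<mu>) \<and>
         (\<forall>\<mu> \<nu>. rigid_in NML \<mu> \<longrightarrow> rigid_in NML \<nu> \<longrightarrow> \<nu> \<in> orbit \<mu>)"
proof (intro conjI allI impI)
  show "has_zdim NML 15" by (rule has_zdim_NML)
  show "zcomponents NML = {zclosure (orbit L2), zclosure (\<Union>\<alpha>. orbit (M12 \<alpha>)), zclosure (\<Union>\<alpha>. orbit (M14 \<alpha>))}"
    unfolding zclosure_orbits by (rule zcomponents_NML(1))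
  show "card (zcomponents NML) = 3" by (rule zcomponents_NML(2))
  show "\<exists>\<mu>. rigid_in NML \<mu>" using rigid_NML_iff orbit_refl by blast
  show "\<nu> \<in> orbit \<mu>" if "rigid_in NML \<mu>" "rigid_in NML \<nu>" for \<mu> \<nu>
    using that orbit_sym orbit_trans unfolding rigid_NML_iff by blast
qed

end
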